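(* For real $\alpha$ and $r$ put $$\zeta_\alpha(r):=(16\alpha^3-8\alpha^2+\alpha-1)r^4+4(1-\alpha)(1-2\alpha)(3-4\alpha)r^3+2(8\alpha^3-44\alpha^2+47\alpha-19)r^2+12(1-\alpha)(1-2\alpha)r+9\alpha-1 .$$ Let $r_{cc}$ $(=0.8098\cdots)$ be the radius of close-to-convexity of $\mathcal{S}$, and let $\alpha_0$ $(=0.1361\cdots)$ be the smallest positive root, in the variable $\alpha$, of the equation $$\zeta_\alpha\left(\frac{2-\sqrt{3}}{r_{cc}}\right)=0 .$$ For $\alpha\in(0,1)$ let $R_1(\alpha)$ be the least $r\in(3-2\sqrt{2},1)$ satisfying $\zeta_\alpha(r)=0$. Let $\alpha\in[0,1)$. Then the radius of starlikeness of the set $\mathcal{S}\ast\mathcal{S}t(\alpha)=\{f\ast g: f\in\mathcal{S},\ g\in\mathcal{S}t(\alpha)\}$ is at least $$R(\alpha):=\begin{cases}2-\sqrt{3}, & \text{if } \alpha\in[0,\alpha_0],\\ R_1(\alpha)\,r_{cc}, & \text{if } \alpha\in(\alpha_0,1).\end{cases}$$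
   Context: $\mathbb{D}=\{z\in\mathbb{C}:|z|<1\}$. $\mathcal{A}$ is the set of analytic functions $f$ on $\mathbb{D}$ with $f(0)=0$ and $f'(0)=1$; $\mathcal{S}$ is the set of univalent (injective) functions in $\mathcal{A}$. For $\alpha<1$, $\mathcal{S}t(\alpha)=\{f\in\mathcal{A}: \operatorname{Re}(zf'(z)/f(z))>\alpha,\ z\in\mathbb{D}\}$ is the set of starlike functions of order $\alpha$. For analytic $f(z)=\sum_{n\ge0}a_nz^n$ and $g(z)=\sum_{n\ge0}b_nz^n$ on $\mathbb{D}$, the convolution (Hadamard product) is $(f\ast g)(z)=\sum_{n\ge0}a_nb_nz^n$. The radius of starlikeness of a subset $\mathcal{A}_1\subseteq\mathcal{A}$ is the largest $r\in(0,1]$ such that each $F\in\mathcal{A}_1$ is starlike in $\mathbb{D}_r=\{|z|<r\}$, i.e. $F$ maps $\mathbb{D}_r$ univalently onto a domain starlike with respect to the origin; equivalently, $\operatorname{Re}(zF'(z)/F(z))>0$ for $|z|<r$ (with value $1$ at $z=0$). A function $f\in\mathcal{A}$ is close-to-convex if there is a convex function $h$ (an analytic univalent function on $\mathbb{D}$ with convex image, not required to be normalized) such that $\operatorname{Re}(f'(z)/h'(z))>0$ for all $z\in\mathbb{D}$. The radius of close-to-convexity $r_{cc}$ of $\mathcal{S}$ is the largest $r\in(0,1]$ such that $z\mapsto f(rz)/r$ is close-to-convex for every $f\in\mathcal{S}$. It is known that $r_{cc}$ is the unique real root in $(\tanh(\pi/4),1)$ of the equation $$2\operatorname{arccot}\left(\frac{1-r^2}{1+r^2}x_0(r)\right)+\log\left(1+x_0(r)^2\right)-2\log\left(\frac{2r}{1-r^2}\right)=0,$$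 where, with $a=(1+r^2)/(1-r^2)$, $x_0(r)$ is the unique (real) root of $x^3-ax^2+a^2x-a=0$. *)

theory Defs
  imports "HOL-Complex_Analysis.Complex_Analysis"
begin

text \<open>
  Functions on the open unit disc are total functions of type complex to complex; their values
  outside the disc are arbitrary and never enter into any of the notions below.
\<close>

definition class_A :: "(complex \<Rightarrow> complex) set" where
  "class_A = {f. f holomorphic_on ball 0 1 \<and> f 0 = 0 \<and> deriv f 0 = 1}"

definition class_S :: "(complex \<Rightarrow> complex) set" where
  "class_S = {f \<in> class_A. inj_on f (ball 0 1)}"

text \<open>
  At the origin the quotient has the limit 1, which exceeds every order below 1, whereas
  division in HOL would give 0 there; the origin is therefore left out. Since HOL also sets
  the quotient to 0 at any other zero of \<open>f\<close>, the absence of such zeros is stated explicitly.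
\<close>

definition class_St :: "real \<Rightarrow> (complex \<Rightarrow> complex) set" where
  "class_St \<alpha> = {f \<in> class_A. \<forall>z \<in> ball 0 1 - {0}.
     f z \<noteq> 0 \<and> Re (z * deriv f z / f z) > \<alpha>}"

definition hadamard :: "(complex \<Rightarrow> complex) \<Rightarrow> (complex \<Rightarrow> complex) \<Rightarrow> complex \<Rightarrow> complex" where
  "hadamard f g z =
     (\<Sum>n. fps_nth (fps_expansion f 0) n * fps_nth (fps_expansion g 0) n * z ^ n)"

definition hadamard_set ::
    "(complex \<Rightarrow> complex) set \<Rightarrow> (complex \<Rightarrow> complex) set \<Rightarrow> (complex \<Rightarrow> complex) set" where
  "hadamard_set M N = {hadamard f g | f g. f \<in> M \<and> g \<in> N}"

text \<open>The library's \<open>starlike\<close> leaves the centre unspecified; here it is the origin.\<close>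

definition starlike_wrt_0 :: "complex set \<Rightarrow> bool" where
  "starlike_wrt_0 U \<longleftrightarrow> 0 \<in> U \<and> (\<forall>w \<in> U. closed_segment 0 w \<subseteq> U)"

definition starlike_in_disc :: "(complex \<Rightarrow> complex) \<Rightarrow> real \<Rightarrow> bool" where
  "starlike_in_disc F r \<longleftrightarrow> inj_on F (ball 0 r) \<and> starlike_wrt_0 (F ` ball 0 r)"

text \<open>
  The two radii are defined as suprema of bounded sets of radii; whenever a largest admissible
  radius exists, the supremum is that radius.
\<close>

definition radius_of_starlikeness :: "(complex \<Rightarrow> complex) set \<Rightarrow> real" where
  "radius_of_starlikeness M = Sup {r. 0 < r \<and> r \<le> 1 \<and> (\<forall>F \<in> M. starlike_in_disc F r)}"

definition convex_function :: "(complex \<Rightarrow> complex) \<Rightarrow> bool" where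
  "convex_function h \<longleftrightarrow>
     h holomorphic_on ball 0 1 \<and> inj_on h (ball 0 1) \<and> convex (h ` ball 0 1)"

definition close_to_convex :: "(complex \<Rightarrow> complex) \<Rightarrow> bool" where
  "close_to_convex f \<longleftrightarrow> f \<in> class_A \<and>
     (\<exists>h. convex_function h \<and> (\<forall>z \<in> ball 0 1. Re (deriv f z / deriv h z) > 0))"

definition r_cc :: real where
  "r_cc = Sup {r. 0 < r \<and> r \<le> 1 \<and>
     (\<forall>f \<in> class_S. close_to_convex (\<lambda>z. f (complex_of_real r * z) / complex_of_real r))}"

definition zeta_poly :: "real \<Rightarrow> real \<Rightarrow> real" where
  "zeta_poly \<alpha> r =
     (16 * \<alpha>^3 - 8 * \<alpha>^2 + \<alpha> - 1) * r^4
     + 4 * (1 - \<alpha>) * (1 - 2 * \<alpha>) * (3 - 4 * \<alpha>) * r^3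
     + 2 * (8 * \<alpha>^3 - 44 * \<alpha>^2 + 47 * \<alpha> - 19) * r^2
     + 12 * (1 - \<alpha>) * (1 - 2 * \<alpha>) * r
     + 9 * \<alpha> - 1"

definition \<alpha>\<^sub>0 :: real where
  "\<alpha>\<^sub>0 = (LEAST \<alpha>. 0 < \<alpha> \<and> zeta_poly \<alpha> ((2 - sqrt 3) / r_cc) = 0)"

text \<open>Only meaningful for orders strictly between 0 and 1.\<close>

definition R\<^sub>1 :: "real \<Rightarrow> real" where
  "R\<^sub>1 \<alpha> = (LEAST r. 3 - 2 * sqrt 2 < r \<and> r < 1 \<and> zeta_poly \<alpha> r = 0)"

definition R_bound :: "real \<Rightarrow> real" where
  "R_bound \<alpha> = (if \<alpha> \<le> \<alpha>\<^sub>0 then 2 - sqrt 3 else R\<^sub>1 \<alpha> * r_cc)"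

end

theory Submission
  imports Defs
begin

text \<open>
  Everything rests on one nonvanishing statement of Ruscheweyh and Sheil-Small: if \<open>\<phi>\<close> is convex,
  \<open>g\<close> is starlike and \<open>P\<close> takes values in an open half-plane bounded by a line through 0, then
  \<open>\<phi> * (g P)\<close> has no zero besides 0. For \<open>P(z) = (1 - x z)/(1 - y z)\<close> the argument of \<open>g P\<close> on the unit
  circle increases except for one jump by \<open>- \<pi>\<close>, so that for a suitable direction the imaginary part of
  \<open>g P\<close> changes its sign exactly twice; by convexity so does a suitable coordinate of \<open>\<phi>\<close>, at the same
  two points, and the convolution integral is not 0. Superposition gives general \<open>P\<close>.

  A function \<open>F = f * g\<close> is starlike if \<open>z F' + i s F = f * (z g' + i s g)\<close> has no zero besides 0, for all
  real \<open>s\<close>. Put \<open>p = z g'/g\<close>, so that \<open>z g' + i s g = g (p + i s)\<close>. In the disc of radius \<open>2 - sqrt 3\<close> each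
  \<open>f \<in> S\<close> is convex, and the statement applies with \<open>P = p + i s\<close>. If \<open>f(r z)\<close> is close-to-convex, then
  \<open>z f'(r z) = k P\<close> with \<open>k\<close> starlike, and \<open>f * G = (z f') * H\<close> with \<open>z H' = G = g (p + i s)\<close>; so the statement
  applies as long as \<open>H\<close> is convex, that is, as long as \<open>Re (p + z p'/(p + i s)) > 0\<close>. With \<open>u = Re p\<close> and
  \<open>\<bar>z\<bar> = r\<close> this follows from a quadratic inequality in \<open>u\<close>, which holds when \<open>\<zeta>\<^sub>\<alpha>(r) > 0\<close>.
\<close>

text \<open>The factors (1 - x z)/(1 - y z) with \<bar>x\<bar> = 1 and \<bar>y\<bar> < 1 suit the
  argument count because 1 - cis t turns at the constant rate 1/2, which just compensates the bound
  Re (w/(1 - w)) > - 1/2 for w = y z. The argument of the product thus increases throughout, by 3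
  \<pi> on the period cut at the zero: three arcs of alternating sign, the outer two meeting at the
  zero. Superposition needs no representing measure. The values of the functional on the kernels
  1/(1 - y z) form a power series in y whose coefficients are its values on monomials, and a circle
  integral pairs this series with P. Convexity of f in the disc of radius 2 - sqrt 3 comes from the
  sharp second coefficient bound, and that from the area theorem. The same bound gives
  \<open>r_cc\<close> at least 1/10.\<close>

section \<open>Estimates in discs and derivative rules\<close>

lemma scale_in_ball:
  fixes c z :: complex
  assumes "c \<noteq> 0" "cmod c * r \<le> R" "z \<in> ball 0 r"
  shows "c * z \<in> ball 0 R"
proof -
  have "cmod c * cmod z < cmod c * r" using assms by simp
  also have "\<dots> \<le> R" by (rule assms(2))
  finally show ?thesis by (simp add: norm_mult)
qed

lemma norm_mult_less_1:
  fixes y z :: complex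
  assumes "cmod y * R \<le> 1" "z \<in> ball 0 R"
  shows "cmod (y * z) < 1"
  using scale_in_ball[of y R 1 z] assms by (cases "y = 0") auto

lemma one_minus_mult_nonzero:
  fixes y z :: complex
  assumes "cmod y * R \<le> 1" "z \<in> ball 0 R"
  shows "1 - y * z \<noteq> 0"
  using norm_mult_less_1[OF assms] by auto

text \<open>The kernel 1/(1 - y z) has to be holomorphic beyond the unit circle for circle integrals
  to apply; \<open>cmod y * r \<le> 1\<close> keeps its pole out of the disc of radius r.\<close>

lemma obtain_geometric_radius:
  fixes y :: complex
  assumes "cmod y < 1" "1 < R"
  obtains r where "1 < r" "r \<le> R" "cmod y * r \<le> 1"
proof
  show "1 < (if y = 0 then R else min R (1 / cmod y))" "(if y = 0 then R else min R (1 / cmod y)) \<le> R"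
    "cmod y * (if y = 0 then R else min R (1 / cmod y)) \<le> 1"
    using assms by (auto simp: min_def field_simps)
qed

lemma Re_inverse_one_minus:
  fixes w :: complex
  assumes "cmod w < 1"
  shows "1 / 2 < Re (1 / (1 - w))"
proof -
  have "(cmod w)\<^sup>2 < 1" using assms by (simp add: abs_square_less_1)
  then have "(cmod (1 - w))\<^sup>2 < 2 * Re (1 - w)"
    unfolding cmod_power2 by (simp add: power2_eq_square algebra_simps)
  moreover have "0 < (cmod (1 - w))\<^sup>2" using assms by auto
  ultimately show ?thesis by (simp add: Re_divide' field_simps)
qed

lemma has_vector_derivative_chain:
  fixes f :: "real \<Rightarrow> complex"
  assumes "(f has_vector_derivative f') (at t)" "(g has_field_derivative g') (at (f t))"
  shows "((\<lambda>t. g (f t)) has_vector_derivative f' * g') (at t)"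
  using field_vector_diff_chain_at[OF assms] by (simp add: o_def)

lemma has_real_derivative_Re:
  assumes "(f has_vector_derivative f') (at t)"
  shows "((\<lambda>t. Re (f t)) has_real_derivative Re f') (at t)"
  using bounded_linear.has_vector_derivative[OF bounded_linear_Re assms]
  by (simp add: has_real_derivative_iff_has_vector_derivative)

lemma has_real_derivative_Im:
  assumes "(f has_vector_derivative f') (at t)"
  shows "((\<lambda>t. Im (f t)) has_real_derivative Im f') (at t)"
  using bounded_linear.has_vector_derivative[OF bounded_linear_Im assms]
  by (simp add: has_real_derivative_iff_has_vector_derivative)

lemma has_vector_derivative_cis: "(cis has_vector_derivative \<i> * cis t) (at t)"
proof -
  have "((\<lambda>z. exp (\<i> * z)) has_field_derivative \<i> * exp (\<i> * of_real t)) (at (of_real t))"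
    by (auto intro!: derivative_eq_intros)
  from has_vector_derivative_real_field[OF this] show ?thesis by (simp add: cis_conv_exp[abs_def])
qed

lemma holomorphic_scale:
  assumes "f holomorphic_on ball 0 R" "\<And>z. z \<in> ball 0 r \<Longrightarrow> c * z \<in> ball 0 R"
  shows "(\<lambda>z. f (c * z)) holomorphic_on ball 0 r"
  using holomorphic_on_compose_gen[of "\<lambda>z. c * z" "ball 0 r" f "ball 0 R"] assms
  by (simp add: o_def image_subset_iff holomorphic_intros del: mem_ball)

lemma deriv_scale:
  assumes "f holomorphic_on ball 0 R" "c * z \<in> ball 0 R"
  shows "deriv (\<lambda>z. f (c * z)) z = c * deriv f (c * z)"
proof -
  have "(f has_field_derivative deriv f (c * z)) (at (c * z))" using assms by (simp add: holomorphic_derivI)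
  then have "((\<lambda>z. f (c * z)) has_field_derivative deriv f (c * z) * c) (at z)"
    by (rule DERIV_chain2) (auto intro!: derivative_eq_intros)
  then show ?thesis by (simp add: DERIV_imp_deriv mult.commute)
qed

lemma deriv_id_times:
  assumes "q holomorphic_on ball 0 R" "\<And>z. cmod z < R \<Longrightarrow> f z = z * q z" "z \<in> ball 0 R"
  shows "deriv f z = q z + z * deriv q z"
proof -
  have "(q has_field_derivative deriv q z) (at z)" using assms by (simp add: holomorphic_derivI)
  then have "((\<lambda>z. z * q z) has_field_derivative q z + z * deriv q z) (at z)"
    by (auto intro!: derivative_eq_intros)
  then have "(f has_field_derivative q z + z * deriv q z) (at z)"
    by (rule has_field_derivative_transform_within_open[OF _ open_ball assms(3)]) (use assms(2) in simp)
  then show ?thesis by (rule DERIV_imp_deriv)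
qed

lemma deriv_exp_log:
  assumes "l holomorphic_on ball 0 R" "\<And>z. z \<in> ball 0 R \<Longrightarrow> exp (l z) = q z" "z \<in> ball 0 R"
  shows "deriv q z = q z * deriv l z"
proof -
  have "(l has_field_derivative deriv l z) (at z)" using assms by (simp add: holomorphic_derivI)
  then have "((\<lambda>z. exp (l z)) has_field_derivative exp (l z) * deriv l z) (at z)"
    by (auto intro!: derivative_eq_intros)
  then have "(q has_field_derivative exp (l z) * deriv l z) (at z)"
    by (rule has_field_derivative_transform_within_open[OF _ open_ball assms(3)]) (use assms(2) in simp)
  then show ?thesis using assms(2)[OF assms(3)] by (simp add: DERIV_imp_deriv)
qed

lemma fps_expansion_cong_ball:
  assumes "0 < R" "\<And>z. z \<in> ball 0 R \<Longrightarrow> f z = g z"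
  shows "fps_expansion f 0 = fps_expansion g 0"
proof -
  have "eventually (\<lambda>z. z \<in> ball 0 R) (nhds (0::complex))" using assms by (intro eventually_nhds_in_open) auto
  then have "eventually (\<lambda>z. f z = g z) (nhds 0)" by eventually_elim (rule assms(2))
  then show ?thesis by (rule fps_expansion_cong)
qed

subsection \<open>Fourier coefficients on the unit circle\<close>

lemma sums_fps_expansion:
  assumes "f holomorphic_on ball 0 R" "cmod z < R"
  shows "(\<lambda>n. fps_nth (fps_expansion f 0) n * z ^ n) sums f z"
proof -
  have "f holomorphic_on eball 0 (ereal R)" using assms(1) by simp
  moreover have "R > 0" using assms(2) norm_ge_zero[of z] by linarith
  ultimately show ?thesis
    using has_fps_expansion_imp_sums_complex[of f "fps_expansion f 0" R z] assms
      has_fps_expansion_fps_expansion[of "ball 0 R" f] by auto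
qed

lemma abs_summable_fps_expansion:
  assumes "f holomorphic_on ball 0 R" "0 \<le> r" "r < R"
  shows "summable (\<lambda>n. cmod (fps_nth (fps_expansion f 0) n) * r ^ n)"
proof -
  have R: "0 < R" using assms by simp
  obtain t where t: "r < t" "t < R" using dense[OF assms(3)] by auto
  have t0: "0 < t" using t assms by linarith
  have "summable (\<lambda>n. fps_nth (fps_expansion f 0) n * (of_real t) ^ n)"
    using sums_fps_expansion[OF assms(1), of "of_real t"] t t0 by (auto simp: sums_iff)
  then have "summable (\<lambda>n. norm (fps_nth (fps_expansion f 0) n * (of_real r) ^ n))"
    by (rule powser_insidea) (use t t0 assms in auto)
  then show ?thesis using assms by (simp add: norm_mult norm_power)
qed

lemma has_integral_cis_int:
  "((\<lambda>t. cis (of_int k * t)) has_integral (if k = 0 then of_real (2 * pi) else 0)) {0..2 * pi}"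
proof (cases "k = 0")
  case True
  then show ?thesis using has_integral_const_real[of "1::complex" 0 "2 * pi"] by (simp add: scaleR_conv_of_real)
next
  case False
  define F where "F t = cis (of_int k * t) / (\<i> * of_int k)" for t
  have "((\<lambda>t. cis (of_int k * t)) has_integral (F (2 * pi) - F 0)) {0..2 * pi}"
  proof (rule fundamental_theorem_of_calculus)
    fix t :: real
    have "((\<lambda>z. exp (\<i> * of_int k * z) / (\<i> * of_int k)) has_field_derivative exp (\<i> * of_int k * of_real t)) (at (of_real t))"
      using False by (auto intro!: derivative_eq_intros)
    from has_vector_derivative_real_field[OF this]
    have "(F has_vector_derivative cis (of_int k * t)) (at t)"
      unfolding F_def cis_conv_exp by (simp add: mult.assoc)
    then show "(F has_vector_derivative cis (of_int k * t)) (at t within {0..2 * pi})"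
      by (rule has_vector_derivative_at_within)
  qed simp
  moreover have "cis (of_int k * (2 * pi)) = 1"
    using cis_multiple_2pi[of "of_int k"] by (simp add: mult.commute)
  ultimately show ?thesis using False by (simp add: F_def)
qed



text \<open>Since R > 1, the Taylor coefficients are absolutely summable, so the Weierstrass test
  allows termwise integration against any continuous G. The sign \<sigma> treats cis t and cis (- t)
  at once.\<close>

lemma fps_expansion_circle_sums:
  assumes f: "f holomorphic_on ball 0 R" and R: "1 < R" and G: "continuous_on {0..2 * pi} G"
    and \<sigma>: "\<bar>\<sigma>\<bar> = (1::int)"
  shows "(\<lambda>n. fps_nth (fps_expansion f 0) n * integral {0..2 * pi} (\<lambda>t. cis (of_int (\<sigma> * int n) * t) * G t))
    sums integral {0..2 * pi} (\<lambda>t. f (cis (of_int \<sigma> * t)) * G t)"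
proof -
  define a where "a n = fps_nth (fps_expansion f 0) n" for n
  define h where "h n t = a n * (cis (of_int (\<sigma> * int n) * t) * G t)" for n t
  have sm: "summable (\<lambda>n. cmod (a n))"
    using abs_summable_fps_expansion[OF f, of 1] R by (simp add: a_def)
  have "compact (G ` {0..2 * pi})" using G by (intro compact_continuous_image) auto
  then have "bounded (G ` {0..2 * pi})" by (rule compact_imp_bounded)
  then obtain C where "\<forall>x\<in>G ` {0..2 * pi}. cmod x \<le> C"
    unfolding bounded_iff by blast
  then have C: "\<And>t. t \<in> {0..2 * pi} \<Longrightarrow> cmod (G t) \<le> C" by auto
  have hs: "(\<lambda>n. h n t) sums (f (cis (of_int \<sigma> * t)) * G t)" for t
  proof -
    have "(\<lambda>n. a n * cis (of_int \<sigma> * t) ^ n) sums f (cis (of_int \<sigma> * t))"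
      using sums_fps_expansion[OF f, of "cis (of_int \<sigma> * t)"] R by (simp add: a_def)
    from sums_mult2[OF this, of "G t"] show ?thesis
      by (simp add: h_def Complex.DeMoivre mult_ac)
  qed
  have "uniform_limit {0..2 * pi} (\<lambda>N t. \<Sum>n<N. h n t) (\<lambda>t. \<Sum>n. h n t) sequentially"
  proof (rule Weierstrass_m_test)
    show "cmod (h n t) \<le> cmod (a n) * C" if "t \<in> {0..2 * pi}" for n t
      using C[OF that] by (simp add: h_def norm_mult mult_left_mono)
    show "summable (\<lambda>n. cmod (a n) * C)" by (rule summable_mult2[OF sm])
  qed
  moreover have "(\<Sum>n. h n t) = f (cis (of_int \<sigma> * t)) * G t" for t using hs by (simp add: sums_iff)
  ultimately have u: "uniform_limit {0..2 * pi} (\<lambda>N t. \<Sum>n<N. h n t) (\<lambda>t. f (cis (of_int \<sigma> * t)) * G t) sequentially"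
    by simp
  have hc: "continuous_on {0..2 * pi} (h n)" for n
    unfolding h_def by (intro continuous_intros G)
  obtain I J where IJ: "\<And>N. ((\<lambda>t. \<Sum>n<N. h n t) has_integral I N) {0..2 * pi}"
    "((\<lambda>t. f (cis (of_int \<sigma> * t)) * G t) has_integral J) {0..2 * pi}" "(I \<longlongrightarrow> J) sequentially"
    by (rule uniform_limit_integral[OF u]) (auto intro!: continuous_intros hc)
  have "((\<lambda>t. h n t) has_integral a n * integral {0..2 * pi} (\<lambda>t. cis (of_int (\<sigma> * int n) * t) * G t)) {0..2 * pi}" for n
    unfolding h_def
    by (intro has_integral_mult_right integrable_integral integrable_continuous_interval continuous_intros G)
  then have "((\<lambda>t. \<Sum>n<N. h n t) has_integral
     (\<Sum>n<N. a n * integral {0..2 * pi} (\<lambda>t. cis (of_int (\<sigma> * int n) * t) * G t))) {0..2 * pi}" for N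
    by (intro has_integral_sum) auto
  then have "I = (\<lambda>N. \<Sum>n<N. a n * integral {0..2 * pi} (\<lambda>t. cis (of_int (\<sigma> * int n) * t) * G t))"
    using IJ(1) has_integral_unique by blast
  moreover have "J = integral {0..2 * pi} (\<lambda>t. f (cis (of_int \<sigma> * t)) * G t)"
    using IJ(2) by (simp add: integral_unique)
  ultimately show ?thesis using IJ(3) by (simp add: sums_def a_def)
qed

lemma continuous_on_circle:
  assumes "f holomorphic_on ball 0 R" "1 < R"
  shows "continuous_on S (\<lambda>t. f (cis (c * t)))"
proof -
  have "continuous_on (ball 0 R) f" using assms(1) by (rule holomorphic_on_imp_continuous_on)
  then show ?thesis
    by (rule continuous_on_compose2) (use assms in \<open>auto intro!: continuous_intros\<close>)
qed

lemma fourier_coeff_circle: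
  assumes f: "f holomorphic_on ball 0 R" and R: "1 < R" and \<sigma>: "\<bar>\<sigma>\<bar> = (1::int)"
  shows "integral {0..2 * pi} (\<lambda>t. f (cis (of_int \<sigma> * t)) * cis (of_int (\<sigma> * m) * t)) =
    (if m \<le> 0 then 2 * pi * fps_nth (fps_expansion f 0) (nat (- m)) else 0)"
proof -
  have c: "(\<lambda>t. cis (of_int (\<sigma> * int n) * t) * cis (of_int (\<sigma> * m) * t)) = (\<lambda>t. cis (of_int (\<sigma> * (int n + m)) * t))" for n
    by (simp add: cis_mult algebra_simps)
  have \<sigma>0: "\<sigma> \<noteq> 0" using \<sigma> by auto
  have "(\<lambda>n. fps_nth (fps_expansion f 0) n * (if \<sigma> * (int n + m) = 0 then of_real (2 * pi) else 0))
     sums integral {0..2 * pi} (\<lambda>t. f (cis (of_int \<sigma> * t)) * cis (of_int (\<sigma> * m) * t))"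
    by (rule fps_expansion_circle_sums[OF f R _ \<sigma>, of "\<lambda>t. cis (of_int (\<sigma> * m) * t)",
          unfolded c has_integral_cis_int[THEN integral_unique]]) (intro continuous_intros)
  moreover have "(\<lambda>n. fps_nth (fps_expansion f 0) n * (if \<sigma> * (int n + m) = 0 then of_real (2 * pi) else 0))
    sums (\<Sum>n\<in>{n. int n + m = 0}. fps_nth (fps_expansion f 0) n * (if \<sigma> * (int n + m) = 0 then of_real (2 * pi) else 0))"
  proof (rule sums_finite)
    have "{n. int n + m = 0} \<subseteq> {nat (- m)}" by auto
    then show "finite {n. int n + m = 0}" using finite_subset by blast
  qed (use \<sigma>0 in auto)
  moreover have "{n. int n + m = 0} = (if m \<le> 0 then {nat (- m)} else {})" by auto
  ultimately show ?thesis using sums_unique2 by fastforce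
qed

text \<open>Orthogonality pairs the frequency - n of the first factor with the frequency n of the
  second. Only the point 1 is treated; other points are reached by scaling the factors.\<close>

lemma hadamard_1_integral:
  assumes f: "f holomorphic_on ball 0 R" and g: "g holomorphic_on ball 0 R" and R: "1 < R"
  shows "integral {0..2 * pi} (\<lambda>t. f (cis (- t)) * g (cis t)) = 2 * pi * hadamard f g 1"
    and "(\<lambda>n. fps_nth (fps_expansion f 0) n * fps_nth (fps_expansion g 0) n) sums hadamard f g 1"
proof -
  have "integral {0..2 * pi} (\<lambda>t. cis (of_int (- 1 * int n) * t) * g (cis t)) = 2 * pi * fps_nth (fps_expansion g 0) n" for n
    using fourier_coeff_circle[OF g R, of 1 "- int n"] by (simp add: mult.commute)
  then have s: "(\<lambda>n. fps_nth (fps_expansion f 0) n * (2 * pi * fps_nth (fps_expansion g 0) n))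
    sums integral {0..2 * pi} (\<lambda>t. f (cis (- t)) * g (cis t))"
    using fps_expansion_circle_sums[OF f R, of "\<lambda>t. g (cis t)" "-1"] continuous_on_circle[OF g R, of _ 1] by simp
  then have "(\<lambda>n. (fps_nth (fps_expansion f 0) n * (2 * pi * fps_nth (fps_expansion g 0) n)) / (2 * pi))
    sums (integral {0..2 * pi} (\<lambda>t. f (cis (- t)) * g (cis t)) / (2 * pi))"
    by (rule sums_divide)
  then have s2: "(\<lambda>n. fps_nth (fps_expansion f 0) n * fps_nth (fps_expansion g 0) n)
    sums (integral {0..2 * pi} (\<lambda>t. f (cis (- t)) * g (cis t)) / (2 * pi))" by simp
  then have "hadamard f g 1 = integral {0..2 * pi} (\<lambda>t. f (cis (- t)) * g (cis t)) / (2 * pi)"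
    by (simp add: hadamard_def sums_iff)
  then show "integral {0..2 * pi} (\<lambda>t. f (cis (- t)) * g (cis t)) = 2 * pi * hadamard f g 1"
    "(\<lambda>n. fps_nth (fps_expansion f 0) n * fps_nth (fps_expansion g 0) n) sums hadamard f g 1"
    using s2 by simp_all
qed

text \<open>Both f (cis (- t)) and the conjugate of g (cis t) contain only frequencies at most 0, so
  that the constant terms alone contribute to the mean.\<close>

lemma integral_cnj_circle:
  assumes f: "f holomorphic_on ball 0 R" and g: "g holomorphic_on ball 0 R" and R: "1 < R"
  shows "integral {0..2 * pi} (\<lambda>t. f (cis (- t)) * cnj (g (cis t))) = 2 * pi * (f 0 * cnj (g 0))"
proof -
  have *: "integral {0..2 * pi} (\<lambda>t. cis (of_int (- 1 * int n) * t) * cnj (g (cis t))) = (if n = 0 then 2 * pi * cnj (g 0) else 0)" for n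
  proof -
    have "integral {0..2 * pi} (\<lambda>t. cnj (cis (of_int (int n) * t) * g (cis t)))
      = cnj (integral {0..2 * pi} (\<lambda>t. cis (of_int (int n) * t) * g (cis t)))"
      by (rule integral_cnj[symmetric])
    also have "integral {0..2 * pi} (\<lambda>t. cis (of_int (int n) * t) * g (cis t)) = (if n = 0 then 2 * pi * g 0 else 0)"
      using fourier_coeff_circle[OF g R, of 1 "int n"] by (simp add: mult.commute fps_expansion_def)
    finally show ?thesis by (cases "n = 0") (simp_all add: cis_cnj)
  qed
  have "(\<lambda>n. fps_nth (fps_expansion f 0) n * (if n = 0 then 2 * pi * cnj (g 0) else 0))
    sums integral {0..2 * pi} (\<lambda>t. f (cis (- t)) * cnj (g (cis t)))"
    using fps_expansion_circle_sums[OF f R, of "\<lambda>t. cnj (g (cis t))" "-1"] continuous_on_circle[OF g R, of _ 1]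
    unfolding * by (simp add: continuous_on_cnj)
  moreover have "(\<lambda>n. fps_nth (fps_expansion f 0) n * (if n = 0 then 2 * pi * cnj (g 0) else 0))
    sums (\<Sum>n\<in>{0}. fps_nth (fps_expansion f 0) n * (if n = 0 then 2 * pi * cnj (g 0) else 0))"
    by (rule sums_finite) auto
  ultimately show ?thesis using sums_unique2 by (fastforce simp: fps_expansion_def)
qed

lemma fps_expansion_scale:
  assumes f: "f holomorphic_on ball 0 R" "0 < R"
  shows "fps_nth (fps_expansion (\<lambda>z. f (c * z)) 0) n = fps_nth (fps_expansion f 0) n * c ^ n"
proof -
  \<comment> \<open>The summand 1 keeps the radius finite when c = 0.\<close>
  define r where "r = R / (cmod c + 1)"
  have r: "0 < r" using f by (simp add: r_def add_nonneg_pos)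
  have "c * w \<in> ball 0 R" if "w \<in> ball 0 r" for w
  proof -
    have "cmod (c * w) \<le> (cmod c + 1) * cmod w" unfolding norm_mult by (intro mult_right_mono) auto
    also have "\<dots> < R" using that by (simp add: r_def pos_less_divide_eq add_nonneg_pos mult.commute)
    finally show ?thesis by simp
  qed
  then have "(deriv ^^ n) (\<lambda>w. f (c * w)) 0 = c ^ n * (deriv ^^ n) f (c * 0)"
    using higher_deriv_compose_linear[of f "ball 0 R" "ball 0 r" 0 c n] f r by auto
  then show ?thesis by (simp add: fps_expansion_def)
qed

text \<open>The n-th term depends only on the product of the three scalars. Hence a scalar can be
  moved between the two factors and the argument, which is how every point is normalised to
  1.\<close>

lemma hadamard_scale:
  assumes "f holomorphic_on ball 0 R" "0 < R" "g holomorphic_on ball 0 R'" "0 < R'"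
  shows "hadamard (\<lambda>z. f (c * z)) (\<lambda>z. g (d * z)) z = hadamard f g (c * d * z)"
  unfolding hadamard_def fps_expansion_scale[OF assms(1,2)] fps_expansion_scale[OF assms(3,4)]
  by (simp add: power_mult_distrib mult_ac)

subsection \<open>Sign changes along convex and starlike curves\<close>

text \<open>\<open>cos (of_int k * pi)\<close> stands for (-1)^k, the sign of the sine between k
  \<pi> and (k + 1) \<pi>.\<close>

lemma sin_scaled_pos:
  assumes "of_int k * pi < x" "x < of_int (k + 1) * pi"
  shows "0 < cos (of_int k * pi) * sin x"
proof -
  have "sin (x - of_int k * pi) > 0" using assms by (intro sin_gt_zero) (auto simp: algebra_simps)
  moreover have "sin (of_int k * pi) = 0" using sin_integer_2pi sin_int_times_real by (simp add: sin_zero_iff_int2)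
  ultimately show ?thesis by (simp add: sin_diff mult.commute)
qed



text \<open>Rolle's theorem puts a zero of the derivative into each of the two arcs; these exhaust the
  zeros of \<open>sin \<circ> \<Phi>\<close> on a period, so \<open>a\<close> is piecewise monotone with three pieces.\<close>

lemma periodic_two_sign_changes:
  fixes a \<Phi> \<rho> :: "real \<Rightarrow> real"
  assumes der: "\<And>t. (a has_real_derivative \<rho> t * sin (\<Phi> t)) (at t)" and \<rho>: "\<And>t. 0 < \<rho> t"
    and mono: "\<And>s t. s < t \<Longrightarrow> \<Phi> s < \<Phi> t" and per: "\<And>t. \<Phi> (t + 2 * pi) = \<Phi> t + 2 * pi"
    and p: "p1 < p2" "p2 < p1 + 2 * pi" and z: "a p1 = 0" "a p2 = 0" "a (p1 + 2 * pi) = 0"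
  obtains e :: real where "\<And>t. p1 < t \<Longrightarrow> t < p2 \<Longrightarrow> 0 < e * a t"
    and "\<And>t. p2 < t \<Longrightarrow> t < p1 + 2 * pi \<Longrightarrow> e * a t < 0"
proof -
  have cont: "continuous_on S a" for S
    using der by (meson DERIV_isCont continuous_at_imp_continuous_on)
  have rolle: "\<exists>c. u < c \<and> c < v \<and> sin (\<Phi> c) = 0" if uv: "u < v" "a u = a v" for u v
  proof -
    obtain c where c: "u < c" "c < v" "(a has_real_derivative 0) (at c)"
      using Rolle[OF uv cont] der real_differentiable_def by metis
    then show ?thesis using DERIV_unique[OF der[of c] c(3)] \<rho>[of c] by auto
  qed
  obtain c1 where c1: "p1 < c1" "c1 < p2" "sin (\<Phi> c1) = 0" using rolle[OF p(1)] z by auto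
  obtain c2 where c2: "p2 < c2" "c2 < p1 + 2 * pi" "sin (\<Phi> c2) = 0" using rolle[OF p(2)] z by auto
  obtain k1 where k1: "\<Phi> c1 = of_int k1 * pi" using c1(3) by (auto simp: sin_zero_iff_int2)
  obtain k2 where k2: "\<Phi> c2 = of_int k2 * pi" using c2(3) by (auto simp: sin_zero_iff_int2)
  have "of_int k1 * pi < of_int k2 * pi" using mono[of c1 c2] c1 c2 k1 k2 by simp
  then have "k1 < k2" by simp
  \<comment> \<open>A period adds only 2 \<pi> to \<open>\<Phi>\<close>, so two zeros less than a
    period apart belong to consecutive multiples of \<pi>.\<close>
  have "\<Phi> c2 < \<Phi> (c1 + 2 * pi)" using c1 c2 by (intro mono) auto
  then have "of_int k2 * pi < of_int (k1 + 2) * pi" using k1 k2 per[of c1] by (simp add: algebra_simps)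
  then have "k2 < k1 + 2" by (simp only: mult_less_cancel_right of_int_less_iff) auto
  then have kk: "k2 = k1 + 1" using \<open>k1 < k2\<close> by simp
  \<comment> \<open>With this sign \<open>e * a\<close> falls between c1 and c2, where
    \<open>sin (\<Phi> t)\<close> has the sign of \<open>cos (of_int k1 * pi)\<close>, and rises on
    both sides.\<close>
  define e where "e = - cos (of_int k1 * pi)"
  have e1: "e = cos (of_int (k1 - 1) * pi)" "e = cos (of_int (k1 + 1) * pi)"
    by (simp_all add: e_def algebra_simps cos_diff cos_add)
  have d: "((\<lambda>t. e * a t) has_real_derivative \<rho> t * (e * sin (\<Phi> t))) (at t)" for t
    using DERIV_cmult[OF der[of t], of e] by (simp add: mult_ac)
  have cont': "continuous_on S (\<lambda>t. e * a t)" for S by (intro continuous_intros cont)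
  have s1: "0 < \<rho> t * (e * sin (\<Phi> t))" if "p1 \<le> t" "t < c1" for t
  proof -
    have "\<Phi> t < \<Phi> c1" using that by (intro mono)
    moreover have "\<Phi> c2 < \<Phi> (t + 2 * pi)" using c2 that by (intro mono) auto
    ultimately have "0 < cos (of_int (k1 - 1) * pi) * sin (\<Phi> t)"
      using k1 k2 kk per[of t] by (intro sin_scaled_pos) (auto simp: algebra_simps)
    then show ?thesis using \<rho>[of t] by (simp only: e1(1)[symmetric] mult_pos_pos)
  qed
  have s2: "\<rho> t * (e * sin (\<Phi> t)) < 0" if "c1 < t" "t < c2" for t
  proof -
    have "0 < cos (of_int k1 * pi) * sin (\<Phi> t)"
      using mono[OF that(1)] mono[OF that(2)] k1 k2 kk by (intro sin_scaled_pos) auto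
    then show ?thesis using \<rho>[of t] by (simp add: e_def mult_pos_neg)
  qed
  have s3: "0 < \<rho> t * (e * sin (\<Phi> t))" if "c2 < t" "t \<le> p1 + 2 * pi" for t
  proof -
    have "\<Phi> c2 < \<Phi> t" using that by (intro mono)
    moreover have "\<Phi> t < \<Phi> (c1 + 2 * pi)" using c1 that by (intro mono) auto
    ultimately have "0 < cos (of_int (k1 + 1) * pi) * sin (\<Phi> t)"
      using k1 k2 kk per[of c1] by (intro sin_scaled_pos) (auto simp: algebra_simps)
    then show ?thesis using \<rho>[of t] by (simp only: e1(2)[symmetric] mult_pos_pos)
  qed
  have up1: "e * a u < e * a v" if "p1 \<le> u" "u < v" "v \<le> c1" for u v
    by (rule DERIV_pos_imp_increasing_open[OF that(2) _ cont']) (use d s1 that in force)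
  have down: "e * a v < e * a u" if "c1 \<le> u" "u < v" "v \<le> c2" for u v
    by (rule DERIV_neg_imp_decreasing_open[OF that(2) _ cont']) (use d s2 that in force)
  have up2: "e * a u < e * a v" if "c2 \<le> u" "u < v" "v \<le> p1 + 2 * pi" for u v
    by (rule DERIV_pos_imp_increasing_open[OF that(2) _ cont']) (use d s3 that in force)
  show thesis
  proof (rule that[of e])
    fix t assume t: "p1 < t" "t < p2"
    show "0 < e * a t"
      using up1[of p1 t] down[of t p2] t c1 c2 z by (cases "t \<le> c1") auto
  next
    fix t assume t: "p2 < t" "t < p1 + 2 * pi"
    show "e * a t < 0"
      using down[of p2 t] up2[of t "p1 + 2 * pi"] t c1 c2 z by (cases "t \<le> c2") auto
  qed
qed

text \<open>The quantity is the argument of z^c exp (m z) at z = cis t, continued along the circle;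
  its derivative in t is Re (c + z m'(z)).\<close>

lemma cis_arg_strict_mono:
  fixes m :: "complex \<Rightarrow> complex"
  assumes m: "m holomorphic_on ball 0 R" and R: "1 < R"
    and pos: "\<And>z. z \<in> ball 0 R \<Longrightarrow> 0 < Re (of_real c + z * deriv m z)" and st: "s < t"
  shows "c * s + Im (m (cis s)) < c * t + Im (m (cis t))"
proof (rule DERIV_pos_imp_increasing[OF st])
  fix u
  have b: "cis u \<in> ball 0 R" using R by simp
  have "(m has_field_derivative deriv m (cis u)) (at (cis u))" using m b by (simp add: holomorphic_derivI)
  from has_real_derivative_Im[OF has_vector_derivative_chain[OF has_vector_derivative_cis this]]
  have "((\<lambda>u. Im (m (cis u))) has_real_derivative Re (cis u * deriv m (cis u))) (at u)"
    by (simp add: mult.assoc)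
  then have "((\<lambda>u. c * u + Im (m (cis u))) has_real_derivative (c + Re (cis u * deriv m (cis u)))) (at u)"
    by (rule DERIV_add[OF DERIV_cmult_Id])
  then show "\<exists>y. ((\<lambda>u. c * u + Im (m (cis u))) has_real_derivative y) (at u) \<and> 0 < y"
    using pos[OF b] by auto
qed

text \<open>A star factor \<open>q\<close> is what makes \<open>z q(z)\<close> starlike, and \<open>\<phi>\<close> convex if \<open>q = \<phi>'\<close>.\<close>

definition star_factor :: "(complex \<Rightarrow> complex) \<Rightarrow> complex set \<Rightarrow> bool" where
  "star_factor q S \<longleftrightarrow> q holomorphic_on S \<and> (\<forall>z\<in>S. q z \<noteq> 0 \<and> 0 < Re (1 + z * deriv q z / q z))"

text \<open>A holomorphic logarithm turns q'/q into l' and provides Im l as a continuous argument of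
  q.\<close>

lemma star_factor_log:
  assumes q: "star_factor q (ball 0 R)" and R: "0 < R"
  obtains l where "l holomorphic_on ball 0 R" "\<And>z. z \<in> ball 0 R \<Longrightarrow> exp (l z) = q z"
    "\<And>z. z \<in> ball 0 R \<Longrightarrow> 0 < Re (1 + z * deriv l z)"
proof -
  have qh: "q holomorphic_on ball 0 R" and q0: "\<And>z. z \<in> ball 0 R \<Longrightarrow> q z \<noteq> 0"
    using q by (auto simp: star_factor_def)
  obtain l where l: "l holomorphic_on ball 0 R" "\<And>z. z \<in> ball 0 R \<Longrightarrow> exp (l z) = q z"
    using holomorphic_logarithm_exists[OF convex_ball open_ball qh q0, of 0] R by auto
  have "deriv q z / q z = deriv l z" if z: "z \<in> ball 0 R" for z
    using deriv_exp_log[OF l z] q0[OF z] by simp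
  then have "0 < Re (1 + z * deriv l z)" if "z \<in> ball 0 R" for z
    using q that by (auto simp: star_factor_def simp flip: times_divide_eq_right)
  then show thesis using that l by blast
qed

text \<open>The direction of the tangent to \<phi> (cis t) increases by 2 \<pi> in a period, so the
  image of the circle is a strictly convex curve; the line through two of its points separates the
  two arcs between them.\<close>

lemma convex_curve_sign_changes:
  assumes \<phi>: "\<phi> holomorphic_on ball 0 R" and q: "star_factor (deriv \<phi>) (ball 0 R)" and R: "1 < R"
    and p: "p1 < p2" "p2 < p1 + 2 * pi"
  obtains \<delta> where "\<And>t. p1 < t \<Longrightarrow> t < p2 \<Longrightarrow> 0 < Im (\<delta> * (\<phi> (cis t) - \<phi> (cis p1)))"
    and "\<And>t. p2 < t \<Longrightarrow> t < p1 + 2 * pi \<Longrightarrow> Im (\<delta> * (\<phi> (cis t) - \<phi> (cis p1))) < 0"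
    and "Im (\<delta> * (\<phi> (cis p2) - \<phi> (cis p1))) = 0"
proof -
  obtain l where l: "l holomorphic_on ball 0 R" "\<And>z. z \<in> ball 0 R \<Longrightarrow> exp (l z) = deriv \<phi> z"
    "\<And>z. z \<in> ball 0 R \<Longrightarrow> 0 < Re (1 + z * deriv l z)"
    using star_factor_log[OF q] R by auto
  \<comment> \<open>Rotation by d makes the chord real, so the imaginary part vanishes at both of
    its ends.\<close>
  define d where "d = - Arg (\<phi> (cis p2) - \<phi> (cis p1))"
  define a where "a t = Im (cis d * (\<phi> (cis t) - \<phi> (cis p1)))" for t
  define \<Phi> where "\<Phi> t = d + pi / 2 + t + Im (l (cis t))" for t
  have cisR: "cis t \<in> ball 0 R" for t using R by simp
  have Arg: "cis (- Arg w) * w = of_real (cmod w)" for w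
  proof -
    have "cis (- Arg w) * (of_real (cmod w) * cis (Arg w)) = of_real (cmod w)"
      by (simp add: cis_mult)
    then show ?thesis by (simp add: rcis_cmod_Arg flip: rcis_def)
  qed
  have a2: "a p2 = 0" unfolding a_def using Arg[of "\<phi> (cis p2) - \<phi> (cis p1)"] by (simp add: d_def)
  have der: "(a has_real_derivative exp (Re (l (cis t))) * sin (\<Phi> t)) (at t)" for t
  proof -
    have "(\<phi> has_field_derivative exp (l (cis t))) (at (cis t))"
      using \<phi> cisR[of t] l(2)[OF cisR[of t]] by (simp add: holomorphic_derivI)
    then have "((\<lambda>t. cis d * (\<phi> (cis t) - \<phi> (cis p1))) has_vector_derivative
        cis d * (\<i> * cis t * exp (l (cis t)) - 0)) (at t)"
      by (intro has_vector_derivative_mult_right has_vector_derivative_diff has_vector_derivative_const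
          has_vector_derivative_chain[OF has_vector_derivative_cis])
    then have "(a has_real_derivative Im (cis d * (\<i> * cis t * exp (l (cis t)) - 0))) (at t)"
      unfolding a_def by (rule has_real_derivative_Im)
    moreover have "cis d * (\<i> * cis t * exp (l (cis t)) - 0) = of_real (exp (Re (l (cis t)))) * cis (\<Phi> t)"
    proof -
      have "exp (l (cis t)) = of_real (exp (Re (l (cis t)))) * cis (Im (l (cis t)))"
        by (simp add: exp_eq_polar)
      moreover have "\<i> = cis (pi / 2)" by simp
      ultimately show ?thesis by (simp add: \<Phi>_def cis_mult[symmetric] add_ac del: cis_pi_half)
    qed
    ultimately have "(a has_real_derivative Im (of_real (exp (Re (l (cis t)))) * cis (\<Phi> t))) (at t)"
      by (simp only:)
    then show ?thesis by simp
  qed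
  have mono: "\<Phi> s < \<Phi> t" if "s < t" for s t
    using cis_arg_strict_mono[of l R 1 s t] l R that by (simp add: \<Phi>_def)
  have cper: "cis (t + 2 * pi) = cis t" for t by (simp add: cis_mult[symmetric])
  have per: "\<Phi> (t + 2 * pi) = \<Phi> t + 2 * pi" for t by (simp add: \<Phi>_def cper)
  obtain e :: real where e: "\<And>t. p1 < t \<Longrightarrow> t < p2 \<Longrightarrow> 0 < e * a t"
    "\<And>t. p2 < t \<Longrightarrow> t < p1 + 2 * pi \<Longrightarrow> e * a t < 0"
    using periodic_two_sign_changes[of a "\<lambda>t. exp (Re (l (cis t)))" \<Phi> p1 p2] der mono per p a2
    by (auto simp: a_def cper)
  have eq: "Im (of_real e * cis d * w) = e * Im (cis d * w)" for w by (simp add: algebra_simps)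
  show thesis
    by (rule that[of "of_real e * cis d"]) (unfold eq a_def[symmetric], use e a2 in simp_all)
qed

text \<open>On the open period 1 - cis t equals 2 sin (t/2) cis (t/2 - \<pi>/2) with a positive
  modulus. The argument of the whole product therefore increases from its initial value by 3 \<pi>,
  and \<tau>1, \<tau>2 are the points where \<pi> and 2 \<pi> have been gained.\<close>

lemma starlike_curve_sign_changes:
  assumes q: "star_factor q (ball 0 R)" and R: "1 < R" and y: "cmod y * R \<le> 1"
  obtains \<beta> \<tau>1 \<tau>2 where "0 < \<tau>1" "\<tau>1 < \<tau>2" "\<tau>2 < 2 * pi"
    and "\<And>t. 0 < t \<Longrightarrow> t < \<tau>1 \<Longrightarrow> 0 < Im (\<beta> * (cis t * q (cis t) * (1 - cis t) / (1 - y * cis t)))"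
    and "\<And>t. \<tau>1 < t \<Longrightarrow> t < \<tau>2 \<Longrightarrow> Im (\<beta> * (cis t * q (cis t) * (1 - cis t) / (1 - y * cis t))) < 0"
    and "\<And>t. \<tau>2 < t \<Longrightarrow> t < 2 * pi \<Longrightarrow> 0 < Im (\<beta> * (cis t * q (cis t) * (1 - cis t) / (1 - y * cis t)))"
proof -
  obtain l where l: "l holomorphic_on ball 0 R" "\<And>z. z \<in> ball 0 R \<Longrightarrow> exp (l z) = q z"
    "\<And>z. z \<in> ball 0 R \<Longrightarrow> 0 < Re (1 + z * deriv l z)"
    using star_factor_log[OF q] R by auto
  note yz = norm_mult_less_1[OF y]
  have Re1: "0 < Re (1 - w)" "1 - w \<noteq> 0" if "cmod w < 1" for w
    using complex_Re_le_cmod[of w] that by auto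
  define m where "m z = l z - Ln (1 - y * z)" for z
  have dLn: "((\<lambda>z. Ln (1 - y * z)) has_field_derivative - y / (1 - y * z)) (at z)" if "z \<in> ball 0 R" for z
  proof -
    have "1 - y * z \<notin> \<real>\<^sub>\<le>\<^sub>0"
      using Re1[OF yz[OF that]] by (auto simp: complex_nonpos_Reals_iff)
    then show ?thesis by (auto intro!: derivative_eq_intros simp: divide_inverse)
  qed
  have dm: "(m has_field_derivative deriv l z + y / (1 - y * z)) (at z)" if "z \<in> ball 0 R" for z
  proof -
    have "(l has_field_derivative deriv l z) (at z)" using l(1) that by (simp add: holomorphic_derivI)
    from DERIV_diff[OF this dLn[OF that]] show ?thesis by (simp add: m_def[abs_def])
  qed
  have mh: "m holomorphic_on ball 0 R"
    unfolding holomorphic_on_def using dm by (meson field_differentiable_at_within field_differentiable_def)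
  \<comment> \<open>Of 3/2, the part 1 belongs to the starlike factor and the part 1/2 to 1 - cis t;
    the latter absorbs Re (w / (1 - w)) > - 1/2.\<close>
  have mpos: "0 < Re (of_real (3/2) + z * deriv m z)" if z: "z \<in> ball 0 R" for z
  proof -
    define w where "w = y * z"
    have w: "cmod w < 1" "1 - w \<noteq> 0" using yz[OF z] Re1[OF yz[OF z]] by (auto simp: w_def)
    have "z * (deriv l z + y / (1 - y * z)) = z * deriv l z + w / (1 - w)"
      by (simp add: w_def algebra_simps)
    moreover have "- (1/2) < Re (w / (1 - w))"
    proof -
      have "w / (1 - w) = 1 / (1 - w) - 1" using w by (simp add: field_simps)
      then show ?thesis using Re_inverse_one_minus[OF w(1)] by simp
    qed
    ultimately show ?thesis using l(3)[OF z] DERIV_imp_deriv[OF dm[OF z]] by simp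
  qed
  define \<Theta> where "\<Theta> t = 3/2 * t + Im (m (cis t))" for t
  have mono: "\<Theta> s < \<Theta> t" if "s < t" for s t
    using cis_arg_strict_mono[OF mh R mpos that] by (simp add: \<Theta>_def)
  have \<Theta>2pi: "\<Theta> (2 * pi) = \<Theta> 0 + 3 * pi" by (simp add: \<Theta>_def)
  have "continuous_on (ball 0 R) m" using mh by (rule holomorphic_on_imp_continuous_on)
  then have "continuous_on UNIV (\<lambda>t. m (cis t))"
    by (rule continuous_on_compose2) (use R in \<open>auto intro!: continuous_intros\<close>)
  then have cont: "continuous_on {0..2 * pi} \<Theta>" unfolding \<Theta>_def
    by (intro continuous_intros) (auto intro: continuous_on_subset)
  have ivt: "\<exists>t. 0 \<le> t \<and> t \<le> 2 * pi \<and> \<Theta> t = v" if "\<Theta> 0 \<le> v" "v \<le> \<Theta> (2 * pi)" for v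
    using IVT'[of \<Theta> 0 v "2 * pi"] that cont by auto
  obtain \<tau>1 where t1: "0 \<le> \<tau>1" "\<tau>1 \<le> 2 * pi" "\<Theta> \<tau>1 = \<Theta> 0 + pi"
    using ivt[of "\<Theta> 0 + pi"] \<Theta>2pi by auto
  obtain \<tau>2 where t2: "0 \<le> \<tau>2" "\<tau>2 \<le> 2 * pi" "\<Theta> \<tau>2 = \<Theta> 0 + 2 * pi"
    using ivt[of "\<Theta> 0 + 2 * pi"] \<Theta>2pi by auto
  have less: "s < t" if "\<Theta> s < \<Theta> t" for s t
  proof (rule ccontr)
    assume "\<not> s < t"
    then have "s = t \<or> t < s" by linarith
    then show False using mono[of t s] that by auto
  qed
  have ord: "0 < \<tau>1" "\<tau>1 < \<tau>2" "\<tau>2 < 2 * pi"     using less[of 0 \<tau>1] less[of \<tau>1 \<tau>2] less[of \<tau>2 "2 * pi"] t1 t2 \<Theta>2pi by auto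
  \<comment> \<open>This rotation makes the argument tend to 0 as t decreases to 0, so that the sign
    pattern is that of the sine on (0, 3 \<pi>).\<close>
  define \<beta> where "\<beta> = cis (pi / 2 - \<Theta> 0)"
  have B: "\<beta> * (cis t * q (cis t) * (1 - cis t) / (1 - y * cis t)) =
      of_real (2 * sin (t/2) * exp (Re (m (cis t)))) * cis (\<Theta> t - \<Theta> 0)" for t
  proof -
    have b: "cis t \<in> ball 0 R" using R by simp
    have "exp (m (cis t)) = q (cis t) / (1 - y * cis t)"
      using l(2)[OF b] Re1(2)[OF yz[OF b]] by (simp add: m_def exp_diff)
    then have "q (cis t) / (1 - y * cis t) = of_real (exp (Re (m (cis t)))) * cis (Im (m (cis t)))"
      by (simp add: exp_eq_polar)
    moreover have "1 - cis t = of_real (2 * sin (t/2)) * cis (t/2 - pi/2)"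
    proof -
      have "cos t = 1 - 2 * (sin (t/2))\<^sup>2" using cos_double_sin[of "t/2"] by simp
      moreover have "sin t = 2 * sin (t/2) * cos (t/2)" using sin_double[of "t/2"] by simp
      ultimately show ?thesis by (simp add: complex_eq_iff cos_diff sin_diff power2_eq_square)
    qed
    moreover have "\<beta> * (cis t * q (cis t) * (1 - cis t) / (1 - y * cis t)) =
      cis (pi/2 - \<Theta> 0) * cis t * (q (cis t) / (1 - y * cis t)) * (1 - cis t)" by (simp add: \<beta>_def)
    ultimately have "\<beta> * (cis t * q (cis t) * (1 - cis t) / (1 - y * cis t)) =
      cis (pi/2 - \<Theta> 0) * cis t * (of_real (exp (Re (m (cis t)))) * cis (Im (m (cis t)))) * (of_real (2 * sin (t/2)) * cis (t/2 - pi/2))"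
      by (simp only:)
    also have "\<dots> = of_real (2 * sin (t/2) * exp (Re (m (cis t)))) * (cis (pi/2 - \<Theta> 0) * cis t * cis (Im (m (cis t))) * cis (t/2 - pi/2))"
      by (simp only: of_real_mult mult_ac)
    also have "cis (pi/2 - \<Theta> 0) * cis t * cis (Im (m (cis t))) * cis (t/2 - pi/2) = cis (\<Theta> t - \<Theta> 0)"
      unfolding cis_mult by (rule arg_cong[of _ _ cis]) (simp add: \<Theta>_def)
    finally show ?thesis .
  qed
  have ImB: "Im (\<beta> * (cis t * q (cis t) * (1 - cis t) / (1 - y * cis t))) =
      (2 * sin (t/2) * exp (Re (m (cis t)))) * sin (\<Theta> t - \<Theta> 0)" for t
    unfolding B by simp
  have s0: "0 < 2 * sin (t/2) * exp (Re (m (cis t)))" if "0 < t" "t < 2 * pi" for t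
    using that by (auto intro!: mult_pos_pos sin_gt_zero)
  show thesis
  proof (rule that[OF ord, of \<beta>])
    fix t assume t: "0 < t" "t < \<tau>1"
    have sn: "0 < sin (\<Theta> t - \<Theta> 0)" using mono[OF t(1)] mono[OF t(2)] t1 by (intro sin_gt_zero) auto
    show "0 < Im (\<beta> * (cis t * q (cis t) * (1 - cis t) / (1 - y * cis t)))"
      unfolding ImB by (rule mult_pos_pos[OF s0 sn]) (use t ord in auto)
  next
    fix t assume t: "\<tau>1 < t" "t < \<tau>2"
    have sn: "sin (\<Theta> t - \<Theta> 0) < 0" using mono[OF t(1)] mono[OF t(2)] t1 t2 by (intro sin_lt_zero) auto
    show "Im (\<beta> * (cis t * q (cis t) * (1 - cis t) / (1 - y * cis t))) < 0"
      unfolding ImB by (rule mult_pos_neg[OF s0 sn]) (use t ord in auto)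
  next
    fix t assume t: "\<tau>2 < t" "t < 2 * pi"
    have "0 < sin (\<Theta> t - \<Theta> 0 - 2 * pi)" using mono[OF t(1)] mono[OF t(2)] t2 \<Theta>2pi by (intro sin_gt_zero) auto
    then have sn: "0 < sin (\<Theta> t - \<Theta> 0)" by (simp add: sin_diff)
    show "0 < Im (\<beta> * (cis t * q (cis t) * (1 - cis t) / (1 - y * cis t)))"
      unfolding ImB by (rule mult_pos_pos[OF s0 sn]) (use t ord in auto)
  qed
qed

text \<open>Both factors of the integrand below have the same two sign changes. On the other hand
  \<open>2 Im u Im v = Re (u cnj v) - Re (u v)\<close>, and the mean of \<open>u cnj v\<close> vanishes because the Fourier
  frequencies of both factors are of one sign.\<close>

lemma hadamard_nonzero_extremal:
  assumes \<phi>: "\<phi> holomorphic_on ball 0 R" "star_factor (deriv \<phi>) (ball 0 R)"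
    and q: "star_factor q (ball 0 R)" and R: "1 < R" and y: "cmod y * R \<le> 1"
  shows "hadamard \<phi> (\<lambda>z. z * q z * (1 - z) / (1 - y * z)) 1 \<noteq> 0"
proof
  define G where "G z = z * q z * (1 - z) / (1 - y * z)" for z
  assume "hadamard \<phi> (\<lambda>z. z * q z * (1 - z) / (1 - y * z)) 1 = 0"
  then have H0: "hadamard \<phi> G 1 = 0" by (simp add: G_def[abs_def])
  note yz = one_minus_mult_nonzero[OF y]
  have Gh: "G holomorphic_on ball 0 R"
    unfolding G_def[abs_def] using q yz by (intro holomorphic_intros) (auto simp: star_factor_def)
  obtain \<beta> \<tau>1 \<tau>2 where \<tau>: "0 < \<tau>1" "\<tau>1 < \<tau>2" "\<tau>2 < 2 * pi"
    and B: "\<And>t. 0 < t \<Longrightarrow> t < \<tau>1 \<Longrightarrow> 0 < Im (\<beta> * G (cis t))"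
      "\<And>t. \<tau>1 < t \<Longrightarrow> t < \<tau>2 \<Longrightarrow> Im (\<beta> * G (cis t)) < 0"
      "\<And>t. \<tau>2 < t \<Longrightarrow> t < 2 * pi \<Longrightarrow> 0 < Im (\<beta> * G (cis t))"
    using starlike_curve_sign_changes[OF q R y] unfolding G_def[symmetric] by metis
  \<comment> \<open>The convolution integral evaluates \<phi> at cis (- t); the chord is therefore
    drawn between the reflected points - \<tau>2 and - \<tau>1.\<close>
  define c where "c = \<phi> (cis (- \<tau>2))"
  obtain \<delta> where A: "\<And>t. - \<tau>2 < t \<Longrightarrow> t < - \<tau>1 \<Longrightarrow> 0 < Im (\<delta> * (\<phi> (cis t) - c))"
    "\<And>t. - \<tau>1 < t \<Longrightarrow> t < - \<tau>2 + 2 * pi \<Longrightarrow> Im (\<delta> * (\<phi> (cis t) - c)) < 0"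
    "Im (\<delta> * (\<phi> (cis (- \<tau>1)) - c)) = 0"
    using convex_curve_sign_changes[OF \<phi> R, of "- \<tau>2" "- \<tau>1"] \<tau> unfolding c_def by auto
  define u where "u t = \<delta> * (\<phi> (cis (- t)) - c)" for t
  define v where "v t = \<beta> * G (cis t)" for t
  note V = B[folded v_def]
  have u1: "Im (u t) < 0" if "0 < t" "t < \<tau>1" for t using A(2)[of "- t"] that \<tau> by (simp add: u_def)
  have u2: "0 < Im (u t)" if "\<tau>1 < t" "t < \<tau>2" for t using A(1)[of "- t"] that \<tau> by (simp add: u_def)
  have u3: "Im (u t) < 0" if "\<tau>2 < t" "t < 2 * pi" for t
  proof -
    have "cis (2 * pi - t) = cis (- t)" by (simp add: cis_mult[symmetric] diff_conv_add_uminus del: add_uminus_conv_diff)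
    then show ?thesis using A(2)[of "2 * pi - t"] that \<tau> by (simp add: u_def)
  qed
  have cu: "continuous_on {0..2 * pi} u" and cv: "continuous_on {0..2 * pi} v"
    unfolding u_def v_def using continuous_on_circle[OF \<phi>(1) R, of _ "-1"] continuous_on_circle[OF Gh R, of _ 1]
    by (auto intro!: continuous_intros)
  have h1: "(\<lambda>z. \<phi> z - c) holomorphic_on ball 0 R" using \<phi>(1) by (intro holomorphic_intros)
  have G0: "G 0 = 0" by (simp add: G_def)
  have cA: "continuous_on {0..2 * pi} (\<lambda>t. \<phi> (cis (- t)))" and cB: "continuous_on {0..2 * pi} (\<lambda>t. G (cis t))"
    using continuous_on_circle[OF \<phi>(1) R, of _ "-1"] continuous_on_circle[OF Gh R, of _ 1] by simp_all
  \<comment> \<open>Because G vanishes at 0 it has mean 0 on the circle, so subtracting the constant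
    c from \<phi> does not change the convolution integral.\<close>
  have iG: "integral {0..2 * pi} (\<lambda>t. G (cis t)) = 0"
    using fourier_coeff_circle[OF Gh R, of 1 0] G0 by (simp add: fps_expansion_def)
  have "integral {0..2 * pi} (\<lambda>t. u t * v t) =
     \<delta> * \<beta> * (integral {0..2 * pi} (\<lambda>t. \<phi> (cis (- t)) * G (cis t)) - c * integral {0..2 * pi} (\<lambda>t. G (cis t)))"
  proof -
    have "integral {0..2 * pi} (\<lambda>t. \<phi> (cis (- t)) * G (cis t) - c * G (cis t)) =
      integral {0..2 * pi} (\<lambda>t. \<phi> (cis (- t)) * G (cis t)) - integral {0..2 * pi} (\<lambda>t. c * G (cis t))"
      by (intro integral_diff integrable_continuous_interval continuous_intros cA cB)
    moreover have "(\<lambda>t. u t * v t) = (\<lambda>t. \<delta> * \<beta> * (\<phi> (cis (- t)) * G (cis t) - c * G (cis t)))"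
      by (simp add: u_def v_def algebra_simps)
    ultimately show ?thesis by simp
  qed
  then have i1: "integral {0..2 * pi} (\<lambda>t. u t * v t) = 0"
    using hadamard_1_integral(1)[OF \<phi>(1) Gh R] H0 iG by simp
  have i2: "integral {0..2 * pi} (\<lambda>t. u t * cnj (v t)) = 0"
  proof -
    have "(\<lambda>t. u t * cnj (v t)) = (\<lambda>t. \<delta> * cnj \<beta> * ((\<phi> (cis (- t)) - c) * cnj (G (cis t))))"
      by (simp add: u_def v_def algebra_simps)
    then show ?thesis using integral_cnj_circle[OF h1 Gh R] G0 by simp
  qed
  define F where "F t = - (Im (u t) * Im (v t))" for t
  have I: "((\<lambda>t. Re (u t * v t - u t * cnj (v t)) / 2) has_integral 0) {0..2 * pi}"
  proof -
    have "((\<lambda>t. u t * v t - u t * cnj (v t)) has_integral (0 - 0)) {0..2 * pi}"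
      using i1 i2 by (intro has_integral_diff) (auto intro!: integrable_continuous_interval continuous_intros cu cv
        simp: has_integral_integrable_integral)
    from has_integral_linear[OF this bounded_linear_Re]
    have "((\<lambda>t. Re (u t * v t - u t * cnj (v t))) has_integral 0) {0..2 * pi}"
      unfolding o_def by (simp only: diff_0_right zero_complex.sel)
    from has_integral_divide[OF this, of 2] show ?thesis by simp
  qed
  moreover have "(\<lambda>t. Re (u t * v t - u t * cnj (v t)) / 2) = F" by (auto simp: F_def)
  ultimately have IF: "(F has_integral 0) (cbox 0 (2 * pi))" by simp
  have pos: "0 \<le> F t" if "t \<in> cbox 0 (2 * pi)" for t
  proof -
    have ends: "v 0 = 0" "v (2 * pi) = 0" by (simp_all add: v_def G_def)
    have "u \<tau>2 = 0" by (simp add: u_def c_def)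
    have "Im (u \<tau>1) = 0" using A(3) by (simp add: u_def)
    have t01: "0 \<le> t" "t \<le> 2 * pi" using that by auto
    consider "t = 0" | "0 < t" "t < \<tau>1" | "t = \<tau>1" | "\<tau>1 < t" "t < \<tau>2" | "t = \<tau>2" | "\<tau>2 < t" "t < 2 * pi" | "t = 2 * pi"
      using t01 \<tau> by linarith
    then show ?thesis
    proof cases
      case 2
      then show ?thesis using mult_neg_pos[OF u1[of t] V(1)[of t]] by (simp add: F_def)
    next
      case 4
      then show ?thesis using mult_pos_neg[OF u2[of t] V(2)[of t]] by (simp add: F_def)
    next
      case 6
      then show ?thesis using mult_neg_pos[OF u3[of t] V(3)[of t]] by (simp add: F_def)
    qed (use ends \<open>u \<tau>2 = 0\<close> \<open>Im (u \<tau>1) = 0\<close> in \<open>simp_all add: F_def\<close>)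
  qed
  have cF: "continuous_on (cbox 0 (2 * pi)) F" unfolding F_def using cu cv by (auto intro!: continuous_intros)
  have "F (\<tau>1 / 2) = 0"
    by (rule has_integral_0_cbox_imp_0[OF cF _ IF]) (use pos \<tau> in auto)
  moreover have "0 < F (\<tau>1 / 2)"
    using mult_neg_pos[OF u1[of "\<tau>1/2"] V(1)[of "\<tau>1/2"]] \<tau> by (simp add: F_def)
  ultimately show False by simp
qed

subsection \<open>Scaling and rotation of Hadamard products\<close>

text \<open>Both factors are shrunk by the same ratio, the square root of \<bar>z\<bar>/(R1 R2),
  hence each stays strictly inside its own disc. The value of a Hadamard product at z becomes a
  value at 1 for two functions holomorphic beyond the unit circle.\<close>

lemma factor_disc:
  fixes z :: complex
  assumes "0 < R1" "0 < R2" "0 < cmod z" "cmod z < R1 * R2"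
  obtains s t where "z = s * t" "0 < cmod s" "cmod s < R1" "0 < cmod t" "cmod t < R2"
proof -
  define k where "k = sqrt (cmod z / (R1 * R2))"
  have k: "0 < k" "k < 1" "k\<^sup>2 = cmod z / (R1 * R2)" using assms by (auto simp: k_def)
  define s where "s = (of_real (R1 * k) :: complex)"
  have s: "cmod s = R1 * k" using assms k by (simp add: s_def norm_mult)
  have "cmod (z / s) = R2 * k"
    using k assms unfolding norm_divide s by (simp add: field_simps power2_eq_square)
  moreover have "s \<noteq> 0" using k assms by (simp add: s_def)
  ultimately show thesis using that[of s "z / s"] s assms k by auto
qed

lemma hadamard_sums:
  assumes f: "f holomorphic_on ball 0 R1" "0 < R1" and g: "g holomorphic_on ball 0 R2" "0 < R2"
    and z: "z \<in> ball 0 (R1 * R2)"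
  shows "(\<lambda>n. fps_nth (fps_expansion f 0) n * fps_nth (fps_expansion g 0) n * z ^ n) sums hadamard f g z"
proof (cases "z = 0")
  case True
  then show ?thesis
    using powser_sums_zero[of "\<lambda>n. fps_nth (fps_expansion f 0) n * fps_nth (fps_expansion g 0) n"]
    by (simp add: hadamard_def sums_iff)
next
  case False
  then obtain s t where st: "z = s * t" "0 < cmod s" "cmod s < R1" "0 < cmod t" "cmod t < R2"
    using factor_disc[of R1 R2 z] f g z by auto
  define R where "R = min (R1 / cmod s) (R2 / cmod t)"
  have R: "1 < R" using st by (simp add: R_def)
  have sb: "s * w \<in> ball 0 R1" "t * w \<in> ball 0 R2" if "w \<in> ball 0 R" for w
    using that st by (auto simp: R_def norm_mult pos_less_divide_eq mult.commute)
  have "(\<lambda>w. f (s * w)) holomorphic_on ball 0 R" "(\<lambda>w. g (t * w)) holomorphic_on ball 0 R"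
    using holomorphic_scale[OF f(1) sb(1)] holomorphic_scale[OF g(1) sb(2)] by blast+
  from hadamard_1_integral(2)[OF this R] show ?thesis
    unfolding fps_expansion_scale[OF f] fps_expansion_scale[OF g] hadamard_scale[OF f g]
    by (simp add: st(1) power_mult_distrib mult_ac)
qed

lemma
  assumes f: "f holomorphic_on ball 0 R1" "0 < R1" and g: "g holomorphic_on ball 0 R2" "0 < R2"
  shows hadamard_holomorphic: "hadamard f g holomorphic_on ball 0 (R1 * R2)"
    and fps_expansion_hadamard: "fps_nth (fps_expansion (hadamard f g) 0) n =
      fps_nth (fps_expansion f 0) n * fps_nth (fps_expansion g 0) n"
proof -
  show "hadamard f g holomorphic_on ball 0 (R1 * R2)"
    using power_series_holomorphic[of 0 "R1 * R2" "\<lambda>n. fps_nth (fps_expansion f 0) n * fps_nth (fps_expansion g 0) n"]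
      hadamard_sums[OF f g] by simp
  have "eventually (\<lambda>z. z \<in> ball 0 (R1 * R2)) (nhds (0::complex))"
    using f g by (intro eventually_nhds_in_open) auto
  then have "hadamard f g has_fps_expansion Abs_fps (\<lambda>n. fps_nth (fps_expansion f 0) n * fps_nth (fps_expansion g 0) n)"
    by (intro has_fps_expansionI, elim eventually_mono) (use hadamard_sums[OF f g] in simp)
  then have "fps_expansion (hadamard f g) 0 = Abs_fps (\<lambda>n. fps_nth (fps_expansion f 0) n * fps_nth (fps_expansion g 0) n)"
    by (rule fps_expansion_eqI)
  then show "fps_nth (fps_expansion (hadamard f g) 0) n =
      fps_nth (fps_expansion f 0) n * fps_nth (fps_expansion g 0) n" by simp
qed

lemma hadamard_1_linear:
  assumes f: "f holomorphic_on ball 0 R" and g: "g holomorphic_on ball 0 R" and h: "h holomorphic_on ball 0 R"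
    and R: "1 < R"
  shows "hadamard f (\<lambda>z. g z - c * h z) 1 = hadamard f g 1 - c * hadamard f h 1"
proof -
  have cf: "continuous_on {0..2 * pi} (\<lambda>t. f (cis (- t)))" using continuous_on_circle[OF f R, of _ "-1"] by simp
  have cg: "continuous_on {0..2 * pi} (\<lambda>t. g (cis t))" using continuous_on_circle[OF g R, of _ 1] by simp
  have ch: "continuous_on {0..2 * pi} (\<lambda>t. h (cis t))" using continuous_on_circle[OF h R, of _ 1] by simp
  have gh: "(\<lambda>z. g z - c * h z) holomorphic_on ball 0 R" using g h by (intro holomorphic_intros)
  have "2 * pi * hadamard f (\<lambda>z. g z - c * h z) 1 = integral {0..2 * pi} (\<lambda>t. f (cis (- t)) * (g (cis t) - c * h (cis t)))"
    using hadamard_1_integral(1)[OF f gh R] by simp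
  also have "\<dots> = integral {0..2 * pi} (\<lambda>t. f (cis (- t)) * g (cis t) - c * (f (cis (- t)) * h (cis t)))"
    by (simp add: algebra_simps)
  also have "\<dots> = integral {0..2 * pi} (\<lambda>t. f (cis (- t)) * g (cis t)) - integral {0..2 * pi} (\<lambda>t. c * (f (cis (- t)) * h (cis t)))"
    by (intro integral_diff integrable_continuous_interval continuous_intros cf cg ch)
  also have "\<dots> = 2 * pi * (hadamard f g 1 - c * hadamard f h 1)"
    using hadamard_1_integral(1)[OF f g R] hadamard_1_integral(1)[OF f h R] by (simp add: algebra_simps)
  finally show ?thesis by simp
qed

lemma star_factor_subset: "star_factor q S \<Longrightarrow> T \<subseteq> S \<Longrightarrow> star_factor q T"
  by (auto simp: star_factor_def intro: holomorphic_on_subset)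

lemma star_factor_scale:
  assumes q: "star_factor q (ball 0 R)" and c: "c \<noteq> 0" "cmod c * r \<le> R" and d: "d \<noteq> 0"
  shows "star_factor (\<lambda>z. d * q (c * z)) (ball 0 r)"
proof -
  have qh: "q holomorphic_on ball 0 R" using q by (simp add: star_factor_def)
  note cz = scale_in_ball[OF c]
  have "(\<lambda>z. q (c * z)) holomorphic_on ball 0 r" by (rule holomorphic_scale[OF qh cz])
  moreover have dq: "deriv (\<lambda>z. d * q (c * z)) z = d * (deriv q (c * z) * c)" if z: "z \<in> ball 0 r" for z
  proof -
    have "(\<lambda>z. q (c * z)) field_differentiable at z"
      using calculation z by (simp add: holomorphic_on_imp_differentiable_at)
    then show ?thesis using deriv_scale[OF qh cz[OF z]] by (simp add: deriv_cmult mult.commute)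
  qed
  moreover have "d * q (c * z) \<noteq> 0 \<and> 0 < Re (1 + z * deriv (\<lambda>z. d * q (c * z)) z / (d * q (c * z)))"
    if z: "z \<in> ball 0 r" for z
  proof -
    have nz: "q (c * z) \<noteq> 0" and pos: "0 < Re (1 + (c * z) * deriv q (c * z) / q (c * z))"
      using q cz[OF z] unfolding star_factor_def by blast+
    have "z * (d * (deriv q (c * z) * c)) / (d * q (c * z)) = (d * ((c * z) * deriv q (c * z))) / (d * q (c * z))"
      by (simp only: mult_ac)
    also have "\<dots> = (c * z) * deriv q (c * z) / q (c * z)"
      using d by (rule mult_divide_mult_cancel_left)
    finally have e: "z * deriv (\<lambda>z. d * q (c * z)) z / (d * q (c * z)) = (c * z) * deriv q (c * z) / q (c * z)"
      unfolding dq[OF z] .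
    show ?thesis unfolding e using nz pos d by simp
  qed
  moreover have "(\<lambda>z. d * q (c * z)) holomorphic_on ball 0 r" using calculation(1) by (intro holomorphic_intros)
  ultimately show ?thesis unfolding star_factor_def by blast
qed



lemma star_factor_cong:
  assumes "star_factor q S" "open S" "\<And>z. z \<in> S \<Longrightarrow> p z = q z"
  shows "star_factor p S"
proof -
  have "p holomorphic_on S" using assms holomorphic_cong[of S S p q] by (simp add: star_factor_def)
  moreover have "deriv p z = deriv q z" if "z \<in> S" for z
    using assms that by (intro deriv_cong_ev) (auto intro: eventually_nhds_in_open[THEN eventually_mono])
  ultimately show ?thesis using assms by (simp add: star_factor_def)
qed

lemma convex_scale:
  assumes \<phi>: "\<phi> holomorphic_on ball 0 R" "star_factor (deriv \<phi>) (ball 0 R)" and c: "c \<noteq> 0" "cmod c * r \<le> R"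
  shows "(\<lambda>z. \<phi> (c * z)) holomorphic_on ball 0 r" "star_factor (deriv (\<lambda>z. \<phi> (c * z))) (ball 0 r)"
proof -
  note cz = scale_in_ball[OF c]
  show "(\<lambda>z. \<phi> (c * z)) holomorphic_on ball 0 r" by (rule holomorphic_scale[OF \<phi>(1) cz])
  show "star_factor (deriv (\<lambda>z. \<phi> (c * z))) (ball 0 r)"
    by (rule star_factor_cong[OF star_factor_scale[OF \<phi>(2) c c(1)]])
      (use deriv_scale[OF \<phi>(1) cz] in auto)
qed

text \<open>Replacing z by z/x in the second factor moves the zero of 1 - x z to 1, and x z in the
  first factor undoes this in the product. Rotation preserves convexity and starlikeness.\<close>

lemma hadamard_nonzero_extremal_rotated:
  assumes \<phi>: "\<phi> holomorphic_on ball 0 R" "star_factor (deriv \<phi>) (ball 0 R)"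
    and q: "star_factor q (ball 0 R)" and R: "1 < R" and y: "cmod y * R \<le> 1" and x: "cmod x = 1"
  shows "hadamard \<phi> (\<lambda>z. z * q z * (1 - x * z) / (1 - y * z)) 1 \<noteq> 0"
proof -
  define G where "G z = z * q z * (1 - x * z) / (1 - y * z)" for z
  have x0: "x \<noteq> 0" using x by auto
  note yz = one_minus_mult_nonzero[OF y]
  have Gh: "G holomorphic_on ball 0 R"
    unfolding G_def[abs_def] using q yz by (intro holomorphic_intros) (auto simp: star_factor_def)
  have "hadamard (\<lambda>z. \<phi> (x * z)) (\<lambda>z. z * (1 / x * q (1 / x * z)) * (1 - z) / (1 - y / x * z)) 1 \<noteq> 0"
    by (rule hadamard_nonzero_extremal[OF convex_scale[OF \<phi>] star_factor_scale[OF q] R])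
      (use x x0 y in \<open>auto simp: norm_divide\<close>)
  also have "(\<lambda>z. z * (1 / x * q (1 / x * z)) * (1 - z) / (1 - y / x * z)) = (\<lambda>z. G (1 / x * z))"
    using x0 by (auto simp: G_def)
  also have "hadamard (\<lambda>z. \<phi> (x * z)) (\<lambda>z. G (1 / x * z)) 1 = hadamard \<phi> G 1"
    using hadamard_scale[OF \<phi>(1) _ Gh, of x "1 / x" 1] R x0 by simp
  finally show ?thesis by (simp add: G_def[abs_def])
qed

subsection \<open>The Ruscheweyh--Sheil-Small theorem\<close>

text \<open>Let m and n be the convolutions of \<phi> with z q/(1 - y z) and z^2 q/(1 - y z). The
  extremal case says m - x n is nonzero for all unimodular x, that is \<bar>m\<bar> and
  \<bar>n\<bar> differ. Near 0 the function m dominates, so by continuity it still does at 1. Since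
  \<Lambda> = M - y N with N = n(1), the quotient M/\<Lambda> is 1/(1 - w) with \<bar>w\<bar> <
  1.\<close>

lemma hadamard_Cauchy_kernel:
  assumes \<phi>: "\<phi> holomorphic_on ball 0 R" "star_factor (deriv \<phi>) (ball 0 R)"
    and q: "star_factor q (ball 0 R)" and R: "1 < R" and y: "cmod y < 1"
  defines "M \<equiv> hadamard \<phi> (\<lambda>z. z * q z / (1 - y * z)) 1" and "\<Lambda> \<equiv> hadamard \<phi> (\<lambda>z. z * q z) 1"
  shows "\<Lambda> \<noteq> 0" "0 < Re (2 * M / \<Lambda> - 1)"
proof -
  obtain r where r: "1 < r" "r \<le> R" "cmod y * r \<le> 1" using obtain_geometric_radius[OF y R] .
  have sub: "ball 0 r \<subseteq> ball (0::complex) R" using r by auto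
  have \<phi>r: "\<phi> holomorphic_on ball 0 r" "star_factor (deriv \<phi>) (ball 0 r)" and qr: "star_factor q (ball 0 r)"
    using \<phi> q sub star_factor_subset holomorphic_on_subset by blast+
  have qh: "q holomorphic_on ball 0 r" using qr by (simp add: star_factor_def)
  note yz = one_minus_mult_nonzero[OF r(3)]
  define G1 where "G1 z = z * q z / (1 - y * z)" for z
  define G2 where "G2 z = z * (z * q z) / (1 - y * z)" for z
  have Gh: "G1 holomorphic_on ball 0 r" "G2 holomorphic_on ball 0 r"
    unfolding G1_def[abs_def] G2_def[abs_def] using qh yz by (auto intro!: holomorphic_intros)
  have r0: "0 < r" using r by simp
  have r2: "1 < r * r" using r by (simp add: less_1_mult)
  define m n where "m = hadamard \<phi> G1" and "n = hadamard \<phi> G2"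
  have mh: "m holomorphic_on ball 0 (r * r)" and nh: "n holomorphic_on ball 0 (r * r)"
    unfolding m_def n_def using hadamard_holomorphic[OF \<phi>r(1) r0 _ r0] Gh by auto
  have c1: "fps_nth (fps_expansion f 0) 0 = f 0" "fps_nth (fps_expansion f 0) 1 = deriv f 0" for f
    by (simp_all add: fps_expansion_def)
  have dG: "deriv G1 0 = q 0" "deriv G2 0 = 0"
  proof -
    have "0 \<in> ball 0 r" using r by simp
    then have dq: "(q has_field_derivative deriv q 0) (at 0)" using qh by (simp add: holomorphic_derivI)
    show "deriv G1 0 = q 0" unfolding G1_def
      by (rule DERIV_imp_deriv) (auto intro!: derivative_eq_intros dq)
    show "deriv G2 0 = 0" unfolding G2_def
      by (rule DERIV_imp_deriv) (auto intro!: derivative_eq_intros dq)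
  qed
  have m0: "m 0 = 0" "n 0 = 0" "deriv m 0 = deriv \<phi> 0 * q 0" "deriv n 0 = 0"
    using fps_expansion_hadamard[OF \<phi>r(1) r0 Gh(1) r0, of 0] fps_expansion_hadamard[OF \<phi>r(1) r0 Gh(1) r0, of 1]
      fps_expansion_hadamard[OF \<phi>r(1) r0 Gh(2) r0, of 0] fps_expansion_hadamard[OF \<phi>r(1) r0 Gh(2) r0, of 1]
    unfolding c1 dG by (auto simp: m_def n_def G1_def G2_def)
  obtain hm where hm: "hm holomorphic_on ball 0 (r * r)" "\<And>z. cmod z < r * r \<Longrightarrow> m z = z * hm z" "deriv m 0 = hm 0"
    using Schwarz3[OF mh m0(1)] by blast
  obtain hn where hn: "hn holomorphic_on ball 0 (r * r)" "\<And>z. cmod z < r * r \<Longrightarrow> n z = z * hn z" "deriv n 0 = hn 0"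
    using Schwarz3[OF nh m0(2)] by blast
  \<comment> \<open>Equal moduli would give a unimodular x with m \<tau> = x n \<tau>; the extremal
    case is applied to \<phi> (\<tau> z), which is convex again.\<close>
  have ne: "cmod (m \<tau>) \<noteq> cmod (n \<tau>)" if \<tau>: "\<tau> = of_real t" "0 < t" "t \<le> 1" for \<tau> t
  proof
    assume eq: "cmod (m \<tau>) = cmod (n \<tau>)"
    obtain x where x: "cmod x = 1" "m \<tau> = x * n \<tau>"
    proof (cases "n \<tau> = 0")
      case True
      then show thesis using that[of 1] eq by simp
    next
      case False
      then show thesis using that[of "m \<tau> / n \<tau>"] eq by (simp add: norm_divide)
    qed
    have t0: "\<tau> \<noteq> 0" and t1: "cmod \<tau> * r \<le> r" using \<tau> r by (auto simp: mult_left_le_one_le)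
    note \<phi>t = convex_scale[OF \<phi>r t0 t1]
    have "hadamard (\<lambda>z. \<phi> (\<tau> * z)) (\<lambda>z. z * q z * (1 - x * z) / (1 - y * z)) 1 \<noteq> 0"
      by (rule hadamard_nonzero_extremal_rotated[OF \<phi>t qr r(1) r(3) x(1)])
    also have "(\<lambda>z. z * q z * (1 - x * z) / (1 - y * z)) = (\<lambda>z. G1 z - x * G2 z)"
      by (auto simp: G1_def G2_def diff_divide_distrib algebra_simps)
    also have "hadamard (\<lambda>z. \<phi> (\<tau> * z)) (\<lambda>z. G1 z - x * G2 z) 1 =
      hadamard (\<lambda>z. \<phi> (\<tau> * z)) G1 1 - x * hadamard (\<lambda>z. \<phi> (\<tau> * z)) G2 1"
      by (rule hadamard_1_linear[OF \<phi>t(1) Gh r(1)])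
    also have "hadamard (\<lambda>z. \<phi> (\<tau> * z)) G1 1 = m \<tau>"
      using hadamard_scale[OF \<phi>r(1) r0 Gh(1) r0, of \<tau> 1 1] by (simp add: m_def)
    also have "hadamard (\<lambda>z. \<phi> (\<tau> * z)) G2 1 = n \<tau>"
      using hadamard_scale[OF \<phi>r(1) r0 Gh(2) r0, of \<tau> 1 1] by (simp add: n_def)
    finally show False using x by simp
  qed
  \<comment> \<open>The common zero at 0 is divided out, so that D is continuous up to t = 0 and
    positive there: \<open>hn\<close> vanishes at 0 and \<open>hm\<close> does not.\<close>
  define D where "D t = cmod (hm (of_real t)) - cmod (hn (of_real t))" for t :: real
  have inb: "cmod (of_real t) < r * r" if "0 \<le> t" "t \<le> 1" for t :: real using that r2 by simp
  have D0: "0 < D 0"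
  proof -
    have "deriv \<phi> 0 \<noteq> 0" "q 0 \<noteq> 0" using \<phi>r(2) qr r by (auto simp: star_factor_def)
    then show ?thesis using m0 hm(3) hn(3) by (simp add: D_def)
  qed
  have Dne: "D t \<noteq> 0" if "0 < t" "t \<le> 1" for t
  proof
    assume "D t = 0"
    then have "cmod (m (of_real t)) = cmod (n (of_real t))"
      using hm(2)[OF inb] hn(2)[OF inb] that by (simp add: D_def norm_mult)
    then show False using ne[OF refl that] by simp
  qed
  have "continuous_on {0..1} D"
  proof -
    have c: "continuous_on {0..1} (\<lambda>t. f (of_real t))" if f: "f holomorphic_on ball 0 (r * r)" for f :: "complex \<Rightarrow> complex"
    proof (rule continuous_on_compose2[OF holomorphic_on_imp_continuous_on[OF f]])
      show "of_real ` {0..1} \<subseteq> ball (0::complex) (r * r)" using inb by auto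
    qed (intro continuous_intros)
    show ?thesis unfolding D_def by (intro continuous_on_diff continuous_on_norm c hm(1) hn(1))
  qed
  then have Dc: "continuous_on {0..1} D" .
  have D1: "0 < D 1"
  proof (rule ccontr)
    assume "\<not> 0 < D 1"
    then obtain t where t: "0 \<le> t" "t \<le> 1" "D t = 0" using IVT2'[of D 1 0 0] D0 Dc by auto
    then show False using Dne[of t] D0 by (cases "t = 0") auto
  qed
  define N where "N = n 1"
  have M1: "M = m 1" by (simp add: M_def m_def G1_def[abs_def])
  have NM: "cmod N < cmod M"
    using D1 hm(2)[of 1] hn(2)[of 1] r2 by (simp add: D_def M1 N_def)
  have "\<Lambda> = M - y * N"
  proof -
    have "hadamard \<phi> (\<lambda>z. G1 z - y * G2 z) 1 = M - y * N"
      using hadamard_1_linear[OF \<phi>r(1) Gh r(1), of y] by (simp add: M1 N_def m_def n_def)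
    moreover have "hadamard \<phi> (\<lambda>z. G1 z - y * G2 z) 1 = \<Lambda>"
    proof -
      \<comment> \<open>The identity holds only where 1 - y z is nonzero, since division by 0 gives
        0; \<open>hadamard\<close> sees only the expansion at 0, so agreement on a disc
        suffices.\<close>
      have eq: "G1 z - y * G2 z = z * q z" if "z \<in> ball 0 r" for z
      proof -
        have "G1 z - y * G2 z = z * q z * (1 - y * z) / (1 - y * z)"
          by (simp add: G1_def G2_def diff_divide_distrib algebra_simps)
        then show ?thesis using yz[OF that] by simp
      qed
      have "fps_expansion (\<lambda>z. G1 z - y * G2 z) 0 = fps_expansion (\<lambda>z. z * q z) 0"
        by (rule fps_expansion_cong_ball[OF r0 eq])
      then show ?thesis by (simp add: hadamard_def \<Lambda>_def)
    qed
    ultimately show ?thesis by simp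
  qed
  moreover have M0: "M \<noteq> 0" using NM by auto
  ultimately have W: "\<Lambda> / M = 1 - y * (N / M)" by (simp add: field_simps)
  have "cmod (y * (N / M)) < 1"
  proof -
    have "cmod (N / M) < 1" using NM M0 by (simp add: norm_divide)
    then have "cmod y * cmod (N / M) < 1 * 1" using y by (intro mult_strict_mono') auto
    then show ?thesis by (simp only: norm_mult)
  qed
  moreover define w where "w = y * (N / M)"
  ultimately have w: "cmod w < 1" by simp
  then have w1: "1 - w \<noteq> 0" by auto
  then show \<Lambda>0: "\<Lambda> \<noteq> 0" using W w_def by auto
  have eq: "2 * M / \<Lambda> - 1 = 2 * (1 / (1 - w)) - 1"
  proof -
    have "1 / (1 - w) = M / \<Lambda>" unfolding w_def W[symmetric] by simp
    then show ?thesis by simp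
  qed
  note half = Re_inverse_one_minus[OF w]
  have Re2: "Re (2 * v - 1) = 2 * Re v - 1" for v by simp
  show "0 < Re (2 * M / \<Lambda> - 1)" unfolding eq Re2 using half by linarith
qed

lemma fps_expansion_geometric:
  fixes y :: complex
  shows "fps_nth (fps_expansion (\<lambda>z. 1 / (1 - y * z)) 0) n = y ^ n"
proof -
  have "eventually (\<lambda>z. z \<in> ball 0 (1 / (cmod y + 1))) (nhds (0::complex))"
    by (intro eventually_nhds_in_open) (auto simp: add_nonneg_pos)
  then have "(\<lambda>z. 1 / (1 - y * z)) has_fps_expansion Abs_fps (\<lambda>n. y ^ n)"
  proof (intro has_fps_expansionI, elim eventually_mono)
    fix z :: complex assume "z \<in> ball 0 (1 / (cmod y + 1))"
    then have "(cmod y + 1) * cmod z < 1" by (simp add: pos_less_divide_eq add_nonneg_pos mult.commute)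
    moreover have "cmod y * cmod z \<le> (cmod y + 1) * cmod z" by (intro mult_right_mono) auto
    ultimately have "cmod (y * z) < 1" by (simp add: norm_mult)
    from geometric_sums[OF this] show "(\<lambda>n. fps_nth (Abs_fps (\<lambda>n. y ^ n)) n * z ^ n) sums (1 / (1 - y * z))"
      by (simp add: power_mult_distrib)
  qed
  then show ?thesis by (simp add: fps_expansion_eqI)
qed

text \<open>Ruscheweyh and Sheil-Small: as a functional of \<open>P\<close>, the Hadamard product at 1 is up to a factor the
  pairing of \<open>P\<close> with a function of positive real part (its values on the Cauchy kernels), and such a
  pairing of two functions with positive real part does not vanish.\<close>

lemma hadamard_nonzero_unit:
  assumes \<phi>: "\<phi> holomorphic_on ball 0 R" "star_factor (deriv \<phi>) (ball 0 R)"
    and q: "star_factor q (ball 0 R)" and R: "1 < R" and P: "P holomorphic_on ball 0 R"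
    and pos: "\<And>z. z \<in> ball 0 R \<Longrightarrow> 0 < Re (P z)"
  shows "hadamard \<phi> (\<lambda>z. z * q z * P z) 1 \<noteq> 0"
proof
  assume zero: "hadamard \<phi> (\<lambda>z. z * q z * P z) 1 = 0"
  have qh: "q holomorphic_on ball 0 R" using q by (simp add: star_factor_def)
  define K where "K t = \<phi> (cis (- t)) * (cis t * q (cis t))" for t
  have cK: "continuous_on {0..2 * pi} K"
    unfolding K_def using continuous_on_circle[OF \<phi>(1) R, of _ "-1"] continuous_on_circle[OF qh R, of _ 1]
    by (auto intro!: continuous_intros)
  \<comment> \<open>\<open>\<mu> n\<close> is the value of the functional on the monomial z^n, up to
    the factor 2 \<pi>; by L every value of the functional is a series in these numbers.\<close>
  define \<mu> where "\<mu> n = integral {0..2 * pi} (\<lambda>t. cis (real n * t) * K t)" for n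
  have L: "(\<lambda>n. fps_nth (fps_expansion f 0) n * \<mu> n) sums (2 * pi * hadamard \<phi> (\<lambda>z. z * q z * f z) 1)"
    if f: "f holomorphic_on ball 0 r" and r: "1 < r" "r \<le> R" for f r
  proof -
    have sub: "ball 0 r \<subseteq> ball (0::complex) R" using r by auto
    have h: "(\<lambda>z. z * q z * f z) holomorphic_on ball 0 r" "\<phi> holomorphic_on ball 0 r"
      using qh f \<phi>(1) holomorphic_on_subset[OF _ sub] by (auto intro!: holomorphic_intros)
    have "2 * pi * hadamard \<phi> (\<lambda>z. z * q z * f z) 1 = integral {0..2 * pi} (\<lambda>t. f (cis t) * K t)"
      using hadamard_1_integral(1)[OF h(2,1) r(1)] by (simp add: K_def mult_ac)
    then show ?thesis using fps_expansion_circle_sums[OF f r(1) cK, of 1] by (simp add: \<mu>_def)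
  qed
  define \<Lambda> where "\<Lambda> = 2 * pi * hadamard \<phi> (\<lambda>z. z * q z) 1"
  define M where "M y = 2 * pi * hadamard \<phi> (\<lambda>z. z * q z / (1 - y * z)) 1" for y
  have Msums: "(\<lambda>n. \<mu> n * y ^ n) sums M y" if y: "cmod y < 1" for y
  proof -
    obtain r where r: "1 < r" "r \<le> R" "cmod y * r \<le> 1" using obtain_geometric_radius[OF y R] .
    have "(\<lambda>z. 1 / (1 - y * z)) holomorphic_on ball 0 r"
      by (intro holomorphic_intros one_minus_mult_nonzero[OF r(3)]) auto
    from L[OF this r(1,2)] have "(\<lambda>n. y ^ n * \<mu> n) sums M y"
      by (simp add: fps_expansion_geometric M_def)
    then show ?thesis by (simp add: mult.commute)
  qed
  have \<Lambda>0: "\<Lambda> \<noteq> 0" and Mpos: "\<And>y. cmod y < 1 \<Longrightarrow> 0 < Re (2 * M y / \<Lambda> - 1)"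
    using hadamard_Cauchy_kernel(1)[OF \<phi> q R, of 0] hadamard_Cauchy_kernel(2)[OF \<phi> q R]
    by (simp_all add: \<Lambda>_def M_def)
  have Mh: "M holomorphic_on ball 0 1"
    using power_series_holomorphic[of 0 1 \<mu> M] Msums by simp
  have "eventually (\<lambda>z. z \<in> ball 0 1) (nhds (0::complex))" by (intro eventually_nhds_in_open) auto
  then have "M has_fps_expansion Abs_fps \<mu>"
    by (intro has_fps_expansionI, elim eventually_mono) (use Msums in simp)
  then have Mfps: "fps_expansion M 0 = Abs_fps \<mu>" by (rule fps_expansion_eqI)
  \<comment> \<open>M is known only inside the unit disc, while P reaches beyond it. Passing to M
    (z/s) and P (s z) makes both holomorphic beyond the circle without changing their product at
    1.\<close>
  obtain s where s: "1 < s" "s < R" using dense[OF R] by auto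
  define r where "r = min (R / s) s"
  have r: "1 < r" using s by (simp add: r_def)
  define Ps where "Ps z = P (of_real s * z)" for z
  define Ms where "Ms z = M (of_real (1 / s) * z)" for z
  have sR: "of_real s * z \<in> ball 0 R" "of_real (1 / s) * z \<in> ball 0 1" if "z \<in> ball 0 r" for z :: complex
    using that s by (auto simp: r_def norm_mult norm_divide field_simps)
  have Psh: "Ps holomorphic_on ball 0 r" and Msh: "Ms holomorphic_on ball 0 r"
    unfolding Ps_def[abs_def] Ms_def[abs_def]
    by (rule holomorphic_scale[OF P sR(1)] holomorphic_scale[OF Mh sR(2)]; assumption)+
  have "hadamard Ms Ps 1 = hadamard M P (of_real (1 / s) * of_real s * 1)"
    unfolding Ps_def[abs_def] Ms_def[abs_def] using R by (intro hadamard_scale[OF Mh _ P]) auto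
  also have "\<dots> = (\<Sum>n. fps_nth (fps_expansion P 0) n * \<mu> n)"
    using s by (simp add: hadamard_def Mfps mult.commute)
  also have "\<dots> = 0" using L[OF P R] zero by (simp add: sums_iff)
  finally have H0: "hadamard Ms Ps 1 = 0" .
  define m where "m t = Ms (cis (- t))" for t
  define p where "p t = Ps (cis t)" for t
  have cm: "continuous_on {0..2 * pi} m" and cp: "continuous_on {0..2 * pi} p"
    unfolding m_def p_def using continuous_on_circle[OF Msh r, of _ "-1"] continuous_on_circle[OF Psh r, of _ 1] by simp_all
  have I1: "integral {0..2 * pi} (\<lambda>t. m t * p t) = 0"
    using hadamard_1_integral(1)[OF Msh Psh r] H0 by (simp add: m_def p_def)
  have Ms0: "Ms 0 = \<Lambda>" by (simp add: Ms_def M_def \<Lambda>_def)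
  have I2: "integral {0..2 * pi} (\<lambda>t. m t * cnj (p t)) = 2 * pi * (\<Lambda> * cnj (P 0))"
    using integral_cnj_circle[OF Msh Psh r] by (simp add: m_def p_def Ms0 Ps_def)
  have I3: "integral {0..2 * pi} p = 2 * pi * P 0"
    using fourier_coeff_circle[OF Psh r, of 1 0] by (simp add: p_def[abs_def] fps_expansion_def Ps_def)
  have I4: "integral {0..2 * pi} (\<lambda>t. cnj (p t)) = 2 * pi * cnj (P 0)"
    using integral_cnj[of "{0..2 * pi}" p] I3 by simp
  define k where "k = 2 / \<Lambda>"
  \<comment> \<open>W is 2 Re p times a function of positive real part. If the functional vanished
    at P, its integral would be 2 \<pi> (cnj (P 0) - P 0), which is purely imaginary.\<close>
  define W where "W t = (k * m t - 1) * (p t + cnj (p t))" for t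
  have i: "(\<lambda>t. m t * p t) integrable_on {0..2 * pi}" "(\<lambda>t. m t * cnj (p t)) integrable_on {0..2 * pi}"
    "p integrable_on {0..2 * pi}" "(\<lambda>t. cnj (p t)) integrable_on {0..2 * pi}"
    by (intro integrable_continuous_interval continuous_intros cm cp)+
  have "((\<lambda>t. (2 / \<Lambda>) * (m t * p t) + (2 / \<Lambda>) * (m t * cnj (p t)) - (p t + cnj (p t))) has_integral
      ((2 / \<Lambda>) * 0 + (2 / \<Lambda>) * (2 * pi * (\<Lambda> * cnj (P 0))) - (2 * pi * P 0 + 2 * pi * cnj (P 0)))) {0..2 * pi}"
    using i[THEN integrable_integral] unfolding I1 I2 I3 I4
    by (intro has_integral_diff has_integral_add has_integral_mult_right)
  moreover have "(\<lambda>t. (2 / \<Lambda>) * (m t * p t) + (2 / \<Lambda>) * (m t * cnj (p t)) - (p t + cnj (p t))) = W"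
    unfolding W_def k_def[symmetric] by (rule ext) (simp add: algebra_simps)
  moreover have "(2 / \<Lambda>) * 0 + (2 / \<Lambda>) * (2 * pi * (\<Lambda> * cnj (P 0))) - (2 * pi * P 0 + 2 * pi * cnj (P 0)) =
      2 * pi * (cnj (P 0) - P 0)"
    using \<Lambda>0 by (simp add: algebra_simps)
  ultimately have "(W has_integral 2 * pi * (cnj (P 0) - P 0)) {0..2 * pi}" by simp
  from has_integral_linear[OF this bounded_linear_Re]
  have IW: "((\<lambda>t. Re (W t)) has_integral 0) (cbox 0 (2 * pi))" by (simp add: o_def)
  have Wpos: "0 < Re (W t)" for t
  proof -
    have c: "cis t \<in> ball 0 r" "cis (- t) \<in> ball 0 r" using r by auto
    have "0 < Re (p t)" unfolding p_def Ps_def by (rule pos[OF sR(1)[OF c(1)]])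
    moreover have "0 < Re (2 * m t / \<Lambda> - 1)"
      unfolding m_def Ms_def using sR(2)[OF c(2)] by (intro Mpos) simp
    moreover have "W t = of_real (2 * Re (p t)) * (2 * m t / \<Lambda> - 1)"
      by (simp add: W_def k_def complex_add_cnj)
    moreover have "Re (of_real x * w) = x * Re w" for x w by simp
    ultimately show ?thesis by (metis mult_pos_pos zero_less_numeral)
  qed
  have "Re (W 0) = 0"
  proof (rule has_integral_0_cbox_imp_0[OF _ _ IW])
    show "continuous_on (cbox 0 (2 * pi)) (\<lambda>t. Re (W t))"
      unfolding W_def using cm cp by (auto intro!: continuous_intros)
  qed (use Wpos in \<open>auto intro: less_imp_le dest!: leD\<close>)
  then show False using Wpos[of 0] by simp
qed

theorem hadamard_nonzero:
  assumes \<phi>: "\<phi> holomorphic_on ball 0 R1" "star_factor (deriv \<phi>) (ball 0 R1)" "0 < R1"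
    and q: "star_factor q (ball 0 R2)" "0 < R2" and P: "P holomorphic_on ball 0 R2"
    and pos: "\<And>z. z \<in> ball 0 R2 \<Longrightarrow> 0 < Re (c * P z)"
    and z: "z \<in> ball 0 (R1 * R2)" "z \<noteq> 0"
  shows "hadamard \<phi> (\<lambda>z. z * q z * P z) z \<noteq> 0"
proof -
  obtain s t where st: "z = s * t" "0 < cmod s" "cmod s < R1" "0 < cmod t" "cmod t < R2"
    using factor_disc[of R1 R2 z] \<phi>(3) q(2) z by auto
  define R where "R = min (R1 / cmod s) (R2 / cmod t)"
  have R: "1 < R" using st by (simp add: R_def)
  have c0: "c \<noteq> 0" using pos[of 0] q(2) by auto
  have sR: "cmod s * R \<le> R1" "cmod t * R \<le> R2"
    using st by (simp_all add: R_def min_def field_simps)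
  have tb: "t * w \<in> ball 0 R2" if "w \<in> ball 0 R" for w
    using that st by (auto simp: R_def norm_mult pos_less_divide_eq mult.commute)
  have qh: "q holomorphic_on ball 0 R2" using q by (simp add: star_factor_def)
  have Gh: "(\<lambda>z. z * q z * P z) holomorphic_on ball 0 R2" using qh P by (intro holomorphic_intros)
  \<comment> \<open>The constant c turns the half-plane of P into the right one; its inverse goes
    into the star factor, where constants are harmless.\<close>
  have "hadamard (\<lambda>w. \<phi> (s * w)) (\<lambda>w. w * (t / c * q (t * w)) * (c * P (t * w))) 1 \<noteq> 0"
  proof (rule hadamard_nonzero_unit[OF _ _ _ R])
    show "(\<lambda>w. \<phi> (s * w)) holomorphic_on ball 0 R" "star_factor (deriv (\<lambda>w. \<phi> (s * w))) (ball 0 R)"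
      using convex_scale[OF \<phi>(1,2) _ sR(1)] st by auto
    show "star_factor (\<lambda>w. t / c * q (t * w)) (ball 0 R)"
      using star_factor_scale[OF q(1) _ sR(2), of "t / c"] st c0 by auto
    show "(\<lambda>w. c * P (t * w)) holomorphic_on ball 0 R"
      using holomorphic_scale[OF P tb] by (intro holomorphic_intros)
  qed (use pos tb in blast)
  also have "(\<lambda>w. w * (t / c * q (t * w)) * (c * P (t * w))) = (\<lambda>w. (\<lambda>z. z * q z * P z) (t * w))"
    using c0 by (auto simp: field_simps)
  finally show ?thesis using hadamard_scale[OF \<phi>(1,3) Gh q(2), of s t 1] st(1) by simp
qed

subsection \<open>Starlike and convex functions\<close>

text \<open>A zero of Re f would be a maximum of \<bar>exp (- f)\<bar>, forcing this function to be
  constant.\<close>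

lemma Re_pos_of_Re_nonneg:
  assumes f: "f holomorphic_on S" and S: "open S" "connected S"
    and nonneg: "\<And>z. z \<in> S \<Longrightarrow> 0 \<le> Re (f z)" and a: "a \<in> S" "0 < Re (f a)" and z: "z \<in> S"
  shows "0 < Re (f z)"
proof (rule ccontr)
  assume "\<not> 0 < Re (f z)"
  then have z0: "Re (f z) = 0" using nonneg[OF z] by simp
  have "(\<lambda>w. exp (- f w)) constant_on S"
  proof (rule maximum_modulus_principle[where U=S and \<xi>=z])
    show "(\<lambda>w. exp (- f w)) holomorphic_on S" using f by (intro holomorphic_intros)
    show "cmod (exp (- f w)) \<le> cmod (exp (- f z))" if "w \<in> S" for w
      using nonneg[OF that] z0 by simp
  qed (use S z in auto)
  then have "exp (- f a) = exp (- f z)" using a z unfolding constant_on_def by metis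
  then have "cmod (exp (- f a)) = cmod (exp (- f z))" by simp
  then show False using a z0 by simp
qed

text \<open>Along the segment from a to b the real part of f/(b - a) has derivative Re f' > 0, so it
  cannot take equal values at the ends.\<close>

lemma inj_on_of_Re_deriv_pos:
  fixes f f' :: "complex \<Rightarrow> complex"
  assumes "convex S" and der: "\<And>z. z \<in> S \<Longrightarrow> (f has_field_derivative f' z) (at z)"
    and pos: "\<And>z. z \<in> S \<Longrightarrow> 0 < Re (f' z)"
  shows "inj_on f S"
proof (rule inj_onI, rule ccontr)
  fix a b assume ab: "a \<in> S" "b \<in> S" "f a = f b" "a \<noteq> b"
  define l where "l t = a + of_real t * (b - a)" for t :: real
  have l: "l t \<in> S" if "0 \<le> t" "t \<le> 1" for t
    using convexD_alt[OF \<open>convex S\<close> ab(1,2) that] by (simp add: l_def algebra_simps scaleR_conv_of_real)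
  define m where "m t = Re (f (l t) / (b - a))" for t
  have d: "(m has_real_derivative Re (f' (l t))) (at t)" if "0 \<le> t" "t \<le> 1" for t
  proof -
    have "(l has_vector_derivative (b - a)) (at t)"
      unfolding l_def by (auto intro!: derivative_eq_intros)
    then have "((\<lambda>t. f (l t)) has_vector_derivative (b - a) * f' (l t)) (at t)"
      by (rule has_vector_derivative_chain[where f = l, OF _ der[OF l[OF that]]])
    then have "((\<lambda>t. f (l t) / (b - a)) has_vector_derivative ((b - a) * f' (l t)) / (b - a)) (at t)"
      by (rule has_vector_derivative_divide)
    then have "((\<lambda>t. f (l t) / (b - a)) has_vector_derivative f' (l t)) (at t)" using ab by simp
    then show ?thesis unfolding m_def by (rule has_real_derivative_Re)
  qed
  have "m 0 < m 1"
    by (rule DERIV_pos_imp_increasing[of 0 1 m]) (use d pos l in auto)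
  then show False using ab by (simp add: m_def l_def)
qed



text \<open>The number s is the least parameter at which the segment from 0 to v is outside the open
  image of the disc. The point reached is a limit of image points, so it lies in the compact image
  of the closed disc and must come from the circle.\<close>

lemma ray_meets_circle_image:
  assumes h: "h holomorphic_on ball 0 R" "inj_on h (ball 0 R)" "h 0 = 0" and \<epsilon>: "0 < \<epsilon>" "\<epsilon> < R"
    and v: "v \<notin> h ` ball 0 \<epsilon>"
  obtains s \<zeta> where "0 < s" "s \<le> 1" "cmod \<zeta> = \<epsilon>" "h \<zeta> = of_real s * v"
proof -
  define W where "W = h ` ball 0 \<epsilon>"
  have sub: "ball 0 \<epsilon> \<subseteq> ball (0::complex) R" "cball 0 \<epsilon> \<subseteq> ball (0::complex) R" using \<epsilon> by auto
  have W: "open W" unfolding W_def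
    using h sub by (intro open_mapping_thm3) (auto intro: holomorphic_on_subset inj_on_subset)
  have W0: "0 \<in> W" unfolding W_def using h \<epsilon> by (intro image_eqI[of _ _ 0]) auto
  have "compact (h ` cball 0 \<epsilon>)"
    using h sub by (intro compact_continuous_image) (auto intro: holomorphic_on_imp_continuous_on holomorphic_on_subset)
  then have cl: "closed (h ` cball 0 \<epsilon>)" by (rule compact_imp_closed)
  define T where "T = {0..1} \<inter> (\<lambda>s. of_real s * v) -` (- W)"
  have "closed T" unfolding T_def using W by (auto intro!: continuous_closed_preimage continuous_intros)
  moreover have "bounded T" by (rule bounded_subset[of "{0..1}"]) (auto simp: T_def)
  ultimately have "compact T" using compact_eq_bounded_closed by blast
  moreover have "1 \<in> T" using v by (simp add: T_def W_def)
  then have "T \<noteq> {}" by blast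
  ultimately obtain s where s: "s \<in> T" "\<And>t. t \<in> T \<Longrightarrow> s \<le> t" using compact_attains_inf[of T] by auto
  have s0: "0 < s" using s(1) W0 by (cases "s = 0") (auto simp: T_def)
  define C where "C = (\<lambda>s. of_real s * v) -` (h ` cball 0 \<epsilon>)"
  have "closed C" unfolding C_def by (intro continuous_closed_vimage cl) (auto intro!: continuous_intros)
  moreover have "{0<..<s} \<subseteq> C"
  proof
    fix t assume t: "t \<in> {0<..<s}"
    then have "t \<notin> T" using s(2)[of t] by auto
    then have "of_real t * v \<in> W" using t s(1) by (auto simp: T_def)
    then show "t \<in> C" unfolding C_def W_def by auto
  qed
  ultimately have "closure {0<..<s} \<subseteq> C" by (intro closure_minimal)
  then have "s \<in> C" using s0 by (simp add: closure_greaterThanLessThan subset_iff)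
  then obtain \<zeta> where \<zeta>: "cmod \<zeta> \<le> \<epsilon>" "h \<zeta> = of_real s * v" unfolding C_def by auto
  moreover have "\<zeta> \<notin> ball 0 \<epsilon>" using s(1) \<zeta>(2) unfolding T_def W_def by (metis ComplD IntD2 imageI vimageD)
  ultimately show thesis using that[OF s0 _ _ \<zeta>(2)] s(1) by (auto simp: T_def)
qed

text \<open>Injectivity is the Noshiro--Warschawski criterion for \<open>log F\<close> as a function of \<open>log z\<close>. If the
  image were not starlike, two points of one circle \<open>\<bar>z\<bar> = \<rho>\<close> would have images on the same ray,
  whereas the argument of \<open>F\<close> increases along the circle by \<open>2 \<pi>\<close> in total.\<close>

lemma starlike_in_disc_of_Re_pos:
  assumes r: "0 < r" and hol: "F holomorphic_on ball 0 r" and F0: "F 0 = 0" and F1: "deriv F 0 \<noteq> 0"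
    and pos: "\<And>z. z \<in> ball 0 r \<Longrightarrow> z \<noteq> 0 \<Longrightarrow> F z \<noteq> 0 \<and> 0 < Re (z * deriv F z / F z)"
  shows "starlike_in_disc F r"
proof -
  obtain q where q: "q holomorphic_on ball 0 r" "\<And>z. cmod z < r \<Longrightarrow> F z = z * q z" "deriv F 0 = q 0"
    using Schwarz3[OF hol F0] by blast
  have q0: "q z \<noteq> 0" if "z \<in> ball 0 r" for z
    using pos[OF that] q F1 that by (cases "z = 0") auto
  obtain l where l: "l holomorphic_on ball 0 r" "\<And>z. z \<in> ball 0 r \<Longrightarrow> exp (l z) = q z"
    using holomorphic_logarithm_exists[OF convex_ball open_ball q(1) q0, of 0] r by auto
  have F: "F z = z * exp (l z)" if "z \<in> ball 0 r" for z using q(2) l(2) that by simp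
  have dF: "deriv F z = exp (l z) * (1 + z * deriv l z)" if "z \<in> ball 0 r" for z
    using deriv_id_times[OF q(1,2) that] deriv_exp_log[OF l that] l(2)[OF that] by (simp add: algebra_simps)
  define H where "H = {\<zeta>::complex. Re \<zeta> < ln r}"
  have expH: "exp \<zeta> \<in> ball 0 r" if "\<zeta> \<in> H" for \<zeta>
  proof -
    have "exp (Re \<zeta>) < exp (ln r)" using that by (simp add: H_def)
    then show ?thesis using r by simp
  qed
  have lpos: "0 < Re (1 + z * deriv l z)" if "z \<in> ball 0 r" for z
  proof (cases "z = 0")
    case False
    have "z * deriv F z / F z = 1 + z * deriv l z" using F[OF that] dF[OF that] False by simp
    then show ?thesis using pos[OF that False] by simp
  qed simp
  have inj: "inj_on (\<lambda>\<zeta>. \<zeta> + l (exp \<zeta>)) H"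
  proof (rule inj_on_of_Re_deriv_pos[where f' = "\<lambda>\<zeta>. 1 + exp \<zeta> * deriv l (exp \<zeta>)"])
    show "convex H" unfolding H_def by (rule convex_halfspace_Re_lt)
    fix \<zeta> assume \<zeta>: "\<zeta> \<in> H"
    have "(l has_field_derivative deriv l (exp \<zeta>)) (at (exp \<zeta>))"
      using l(1) expH[OF \<zeta>] by (simp add: holomorphic_derivI)
    from DERIV_chain2[OF this DERIV_exp]
    have "((\<lambda>z. l (exp z)) has_field_derivative deriv l (exp \<zeta>) * exp \<zeta>) (at \<zeta>)" .
    then show "((\<lambda>\<zeta>. \<zeta> + l (exp \<zeta>)) has_field_derivative 1 + exp \<zeta> * deriv l (exp \<zeta>)) (at \<zeta>)"
      by (auto intro!: derivative_eq_intros)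
    show "0 < Re (1 + exp \<zeta> * deriv l (exp \<zeta>))" by (rule lpos[OF expH[OF \<zeta>]])
  qed
  have injF: "inj_on F (ball 0 r)"
  proof (rule inj_onI)
    fix a b assume ab: "a \<in> ball 0 r" "b \<in> ball 0 r" "F a = F b"
    show "a = b"
    proof (cases "a = 0 \<or> b = 0")
      case True
      then show ?thesis using ab F0 pos by metis
    next
      case False
      then obtain u v where uv: "a = exp u" "b = exp v" by (metis exp_Ln)
      have "exp (Re u) < r" "exp (Re v) < r" using ab uv by auto
      then have "Re u < ln r" "Re v < ln r" using r by (metis exp_gt_zero ln_exp ln_less_cancel_iff)+
      then have uvH: "u \<in> H" "v \<in> H" by (auto simp: H_def)
      have "exp (u + l (exp u)) = exp (v + l (exp v))"
        using ab uv F by (simp add: exp_add)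
      then obtain n :: int where n: "u + l (exp u) = v + l (exp v) + of_int (2 * n) * pi * \<i>"
        by (auto simp: exp_eq)
      \<comment> \<open>The map \<zeta> + l (exp \<zeta>) commutes with translation by 2 \<pi> i, so
        the ambiguity of the logarithm can be absorbed in v.\<close>
      define v' where "v' = v + of_int (2 * n) * pi * \<i>"
      have v': "exp v' = exp v" by (auto simp: exp_eq v'_def)
      have "v' \<in> H" using uvH by (simp add: H_def v'_def)
      moreover have "u + l (exp u) = v' + l (exp v')" using n v' by (simp add: v'_def)
      ultimately have "u = v'" using inj uvH by (auto dest: inj_onD)
      then show ?thesis using uv v' by simp
    qed
  qed
  define V where "V = F ` ball 0 r"
  have V0: "0 \<in> V" unfolding V_def using F0 r by (intro image_eqI[of _ _ 0]) auto
  have "of_real s * w \<in> V" if w: "w \<in> V" and s: "0 \<le> s" "s \<le> 1" for s w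
  proof (rule ccontr)
    assume no: "of_real s * w \<notin> V"
    obtain z0 where z0: "z0 \<in> ball 0 r" "w = F z0" using w by (auto simp: V_def)
    define \<rho> where "\<rho> = cmod z0"
    have s0: "0 < s" using no V0 s by (cases "s = 0") auto
    have w0: "w \<noteq> 0" using no V0 by auto
    have \<rho>: "0 < \<rho>" "\<rho> < r" using z0 w0 F0 by (auto simp: \<rho>_def)
    have "of_real s * w \<notin> F ` ball 0 \<rho>" using no \<rho> by (auto simp: V_def)
    then obtain t \<zeta> where t: "0 < t" "t \<le> 1" "cmod \<zeta> = \<rho>" "F \<zeta> = of_real t * (of_real s * w)"
      using ray_meets_circle_image[OF hol injF F0 \<rho>] by metis
    \<comment> \<open>Rescaling turns the circle of radius \<rho> into the unit circle, where the
      monotonicity of the argument is available.\<close>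
    define m where "m z = l (of_real \<rho> * z)" for z
    have \<rho>z: "of_real \<rho> * z \<in> ball 0 r" if "z \<in> ball 0 (r / \<rho>)" for z :: complex
      using that \<rho> by (simp add: norm_mult pos_less_divide_eq mult.commute)
    have mh: "m holomorphic_on ball 0 (r / \<rho>)" unfolding m_def[abs_def] by (rule holomorphic_scale[OF l(1) \<rho>z])
    have mpos: "0 < Re (of_real 1 + z * deriv m z)" if "z \<in> ball 0 (r / \<rho>)" for z
      using lpos[OF \<rho>z[OF that]] deriv_scale[OF l(1) \<rho>z[OF that]] by (simp add: m_def[abs_def] mult_ac)
    define \<Theta> where "\<Theta> x = 1 * x + Im (m (cis x))" for x
    have mono: "\<Theta> x < \<Theta> y" if "x < y" for x y
      unfolding \<Theta>_def by (rule cis_arg_strict_mono[OF mh _ mpos that]) (use \<rho> in auto)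
    have polar: "F (of_real \<rho> * cis x) = of_real (\<rho> * exp (Re (m (cis x)))) * cis (\<Theta> x)" for x
    proof -
      have "F (of_real \<rho> * cis x) = of_real \<rho> * (cis x * exp (m (cis x)))"
        using F[of "of_real \<rho> * cis x"] \<rho> by (simp add: m_def norm_mult)
      also have "cis x * exp (m (cis x)) = of_real (exp (Re (m (cis x)))) * cis (\<Theta> x)"
        by (simp add: exp_eq_polar \<Theta>_def flip: cis_mult)
      finally show ?thesis by simp
    qed
    define a b where "a = Arg \<zeta>" and "b = Arg z0"
    have ab: "\<zeta> = of_real \<rho> * cis a" "z0 = of_real \<rho> * cis b"
      using rcis_cmod_Arg[of \<zeta>] rcis_cmod_Arg[of z0] t(3) by (simp_all add: a_def b_def rcis_def \<rho>_def)
    define A B where "A = \<rho> * exp (Re (m (cis a)))" and "B = t * s * (\<rho> * exp (Re (m (cis b))))"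
    have AB: "0 < A" "0 < B" using \<rho> t s0 by (simp_all add: A_def B_def)
    have eq: "of_real A * cis (\<Theta> a) = of_real B * cis (\<Theta> b)"
      using t(4) unfolding z0(2) ab polar A_def B_def by (simp add: mult_ac)
    have "A = B" using arg_cong[OF eq, of cmod] AB by (simp add: norm_mult)
    then have "cis (\<Theta> a) = cis (\<Theta> b)" using eq AB by simp
    then have "sin (\<Theta> a) = sin (\<Theta> b) \<and> cos (\<Theta> a) = cos (\<Theta> b)" by (simp add: complex_eq_iff)
    then obtain n :: int where n: "\<Theta> a = \<Theta> b + 2 * pi * of_int n" using sin_cos_eq_iff by metis
    have c: "cis (b + 2 * pi * of_int n) = cis b" by (simp flip: cis_mult)
    have "\<Theta> a = \<Theta> (b + 2 * pi * of_int n)" unfolding n by (simp add: \<Theta>_def c)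
    then have "a = b + 2 * pi * of_int n"
      using mono[of a "b + 2 * pi * of_int n"] mono[of "b + 2 * pi * of_int n" a] by linarith
    then have "\<zeta> = z0" using ab c by simp
    then have "w = of_real (t * s) * w" using t(4) z0(2) by simp
    then have "t * s = 1" using w0 by (metis mult_cancel_right1 of_real_eq_1_iff)
    moreover have "t * s \<le> s" using t s by (simp add: mult_left_le_one_le)
    ultimately have "s = 1" using s by simp
    then show False using no w by simp
  qed
  with V0 have "starlike_wrt_0 V"
    by (auto simp: starlike_wrt_0_def closed_segment_def scaleR_conv_of_real)
  then show ?thesis using injF by (simp add: starlike_in_disc_def V_def)
qed

text \<open>For t in [0, 1] the point (1 - t) h \<xi> + t h (c \<xi>) stays in the convex image, so
  the inverse G of h turns it into a self-map of the disc fixing 0. By the Schwarz lemma \<bar>G (A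
  t z)\<bar> never exceeds \<bar>z\<bar>, its value at t = 0; the derivative there is thus
  nonpositive in the radial direction.\<close>

lemma convex_function_Re_chord_nonneg:
  assumes h: "convex_function h" and z: "z \<in> ball 0 1" and c: "cmod c \<le> 1"
  shows "0 \<le> Re ((h z - h (c * z)) / (z * deriv h z))"
proof (cases "z = 0")
  case False
  have hol: "h holomorphic_on ball 0 1" and inj: "inj_on h (ball 0 1)" and cx: "convex (h ` ball 0 1)"
    using h by (auto simp: convex_function_def)
  define V where "V = h ` ball 0 1"
  have "open V" unfolding V_def using open_mapping_thm3[OF hol open_ball inj] .
  obtain G where G: "G holomorphic_on V" "\<And>z. z \<in> ball 0 1 \<Longrightarrow> deriv h z * deriv G (h z) = 1"
    "\<And>z. z \<in> ball 0 1 \<Longrightarrow> G (h z) = z"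
    using holomorphic_has_inverse[OF hol open_ball inj] unfolding V_def by metis
  have cball: "c * \<xi> \<in> ball 0 1" if "\<xi> \<in> ball 0 1" for \<xi>
    using c that by (simp add: norm_mult) (meson le_less_trans mult_left_le_one_le norm_ge_zero)
  define A where "A t \<xi> = h \<xi> + of_real t * (h (c * \<xi>) - h \<xi>)" for t :: real and \<xi>
  have AV: "A t \<xi> \<in> V" if "0 \<le> t" "t \<le> 1" "\<xi> \<in> ball 0 1" for t \<xi>
    using convexD_alt[OF cx[folded V_def] _ _ that(1,2), of "h \<xi>" "h (c * \<xi>)"] cball[OF that(3)] that(3)
    by (auto simp: A_def V_def scaleR_conv_of_real algebra_simps)
  have G1: "G v \<in> ball 0 1" if "v \<in> V" for v using that G(3) by (auto simp: V_def)
  have hc: "(\<lambda>\<xi>. h (c * \<xi>)) holomorphic_on ball 0 1" by (rule holomorphic_scale[OF hol cball])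
  have le: "cmod (G (A t z)) \<le> cmod z" if t: "0 \<le> t" "t \<le> 1" for t
  proof (rule Schwarz_Lemma(1)[of "\<lambda>\<xi>. G (A t \<xi>)"])
    have "A t holomorphic_on ball 0 1" unfolding A_def[abs_def] using hol hc by (intro holomorphic_intros)
    then show "(\<lambda>\<xi>. G (A t \<xi>)) holomorphic_on ball 0 1"
      using holomorphic_on_compose_gen[of "A t" "ball 0 1" G V] G(1) AV[OF t] by (simp add: o_def image_subset_iff)
    show "G (A t 0) = 0" using G(3)[of 0] by (simp add: A_def)
    show "cmod (G (A t \<xi>)) < 1" if "cmod \<xi> < 1" for \<xi>
      using G1[OF AV[OF t, of \<xi>]] that by auto
  qed (use z in auto)
  define m where "m t = Re (cnj z * G (A t z))" for t
  have dh: "deriv h z \<noteq> 0" using holomorphic_injective_imp_regular[OF hol open_ball inj z] .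
  have hV: "h z \<in> V" using z by (auto simp: V_def)
  define D where "D = cnj z * ((h (c * z) - h z) / deriv h z)"
  have dm: "(m has_real_derivative Re D) (at 0)"
  proof -
    have dG: "(G has_field_derivative deriv G (h z)) (at (A 0 z))"
      using G(1) \<open>open V\<close> hV by (simp add: holomorphic_derivI A_def)
    have dG': "deriv G (h z) = 1 / deriv h z" using G(2)[OF z] dh by (simp add: field_simps)
    have "((\<lambda>t. A t z) has_vector_derivative (h (c * z) - h z)) (at 0)"
      unfolding A_def by (auto intro!: derivative_eq_intros)
    from has_vector_derivative_chain[OF this dG]
    have "((\<lambda>t. cnj z * G (A t z)) has_vector_derivative cnj z * ((h (c * z) - h z) * deriv G (h z))) (at 0)"
      by (rule has_vector_derivative_mult_right)
    then have "((\<lambda>t. cnj z * G (A t z)) has_vector_derivative D) (at 0)" by (simp add: D_def dG')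
    then show ?thesis unfolding m_def by (rule has_real_derivative_Re)
  qed
  have "m 0 = Re (cnj z * z)" using G(3)[OF z] by (simp add: m_def A_def)
  then have m0: "m 0 = (cmod z)\<^sup>2" by (simp add: cmod_def power2_eq_square)
  have mt: "m t \<le> m 0" if "0 \<le> t" "t \<le> 1" for t
  proof -
    have "m t \<le> cmod (cnj z * G (A t z))" unfolding m_def by (rule complex_Re_le_cmod)
    also have "\<dots> \<le> cmod z * cmod z" using le[OF that] by (simp add: norm_mult mult_left_mono)
    finally show ?thesis by (simp add: m0 power2_eq_square)
  qed
  have "Re D \<le> 0"
  proof (rule ccontr)
    assume "\<not> Re D \<le> 0"
    then obtain d where d: "d > 0" "\<And>t. 0 < t \<Longrightarrow> t < d \<Longrightarrow> m 0 < m (0 + t)"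
      using DERIV_pos_inc_right[OF dm] by auto
    define t where "t = min (d/2) 1"
    have "0 < t" "t < d" "t \<le> 1" using d(1) by (auto simp: t_def)
    then show False using d(2)[of t] mt[of t] by simp
  qed
  moreover have "(h z - h (c * z)) / (z * deriv h z) = - D / of_real ((cmod z)\<^sup>2)"
    using False dh unfolding D_def complex_norm_square by (simp add: field_simps)
  ultimately show ?thesis by (simp add: Re_divide_of_real divide_nonpos_nonneg del: of_real_power)
qed simp

text \<open>For \<open>c = e\<^sup>i\<^sup>t\<close> the inequality of the previous lemma has second order contact at \<open>t = 0\<close>, and the
  second derivative there is \<open>Re (1 + z h''/h')\<close>.\<close>

lemma convex_function_Re_pos:
  assumes h: "convex_function h" and z: "z \<in> ball 0 1"
  shows "deriv h z \<noteq> 0" and "0 < Re (1 + z * deriv (deriv h) z / deriv h z)"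
proof -
  have hol: "h holomorphic_on ball 0 1" and inj: "inj_on h (ball 0 1)"
    using h by (auto simp: convex_function_def)
  have dh: "deriv h w \<noteq> 0" if "w \<in> ball 0 1" for w
    using holomorphic_injective_imp_regular[OF hol open_ball inj that] .
  then show "deriv h z \<noteq> 0" using z .
  have hol1: "deriv h holomorphic_on ball 0 1" and hol2: "deriv (deriv h) holomorphic_on ball 0 1"
    using hol by (auto intro!: holomorphic_deriv)
  define Q where "Q w = 1 + w * deriv (deriv h) w / deriv h w" for w
  have nonneg: "0 \<le> Re (Q w)" if w: "w \<in> ball 0 1" for w
  proof (cases "w = 0")
    case False
    define e where "e t = exp (\<i> * of_real t)" for t :: real
    have e1: "cmod (e t) = 1" for t by (simp add: e_def)
    have ew: "e t * w \<in> ball 0 1" for t using w e1 by (simp add: norm_mult)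
    have de: "((\<lambda>t. e t * w) has_vector_derivative \<i> * e t * w) (at t)" for t
    proof -
      have "((\<lambda>z. exp (\<i> * z) * w) has_field_derivative \<i> * exp (\<i> * of_real t) * w) (at (of_real t))"
        by (auto intro!: derivative_eq_intros)
      from has_vector_derivative_real_field[OF this] show ?thesis by (simp add: e_def)
    qed
    define k where "k v = v * deriv h v" for v
    have kw: "k w \<noteq> 0" using False dh[OF w] by (simp add: k_def)
    define m where "m t = Re ((h w - h (e t * w)) / k w)" for t
    define m1 where "m1 t = Re (- \<i> * k (e t * w) / k w)" for t
    have dm: "(m has_real_derivative m1 t) (at t)" for t
    proof -
      have "(h has_field_derivative deriv h (e t * w)) (at (e t * w))"
        using hol ew by (simp add: holomorphic_derivI)
      from has_vector_derivative_chain[OF de this]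
      have "((\<lambda>t. h (e t * w)) has_vector_derivative \<i> * k (e t * w)) (at t)"
        by (simp add: k_def algebra_simps)
      then have "((\<lambda>t. (h w - h (e t * w)) / k w) has_vector_derivative (0 - \<i> * k (e t * w)) / k w) (at t)"
        by (intro has_vector_derivative_divide has_vector_derivative_diff has_vector_derivative_const)
      then have "(m has_real_derivative Re ((0 - \<i> * k (e t * w)) / k w)) (at t)" unfolding m_def
        by (rule has_real_derivative_Re)
      then show ?thesis by (simp add: m1_def)
    qed
    have dm1: "(m1 has_real_derivative Re (Q w)) (at 0)"
    proof -
      have "(deriv h has_field_derivative deriv (deriv h) w) (at w)"
        using hol1 w by (simp add: holomorphic_derivI)
      then have "(k has_field_derivative deriv h w + w * deriv (deriv h) w) (at (e 0 * w))"
        unfolding k_def by (auto intro!: derivative_eq_intros simp: e_def)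
      from has_vector_derivative_chain[OF de this]
      have "((\<lambda>t. k (e t * w)) has_vector_derivative \<i> * w * (deriv h w + w * deriv (deriv h) w)) (at 0)"
        by (simp add: e_def)
      then have "((\<lambda>t. - \<i> * k (e t * w) / k w) has_vector_derivative
           (- \<i> * (\<i> * w * (deriv h w + w * deriv (deriv h) w))) / k w) (at 0)"
        by (intro has_vector_derivative_divide has_vector_derivative_mult_right)
      moreover have "(- \<i> * (\<i> * w * (deriv h w + w * deriv (deriv h) w))) / k w = Q w"
        using False dh[OF w] by (simp add: k_def Q_def field_simps)
      ultimately have "((\<lambda>t. - \<i> * k (e t * w) / k w) has_vector_derivative Q w) (at 0)" by simp
      then show ?thesis unfolding m1_def by (rule has_real_derivative_Re)
    qed
    have mpos: "0 \<le> m t" for t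
      using convex_function_Re_chord_nonneg[OF h w, of "e t"] e1 by (simp add: m_def k_def)
    have m10: "m1 0 = 0" using kw by (simp add: m1_def e_def)
    show ?thesis
    proof (rule ccontr)
      assume "\<not> 0 \<le> Re (Q w)"
      then obtain d where d: "d > 0" "\<And>t. 0 < t \<Longrightarrow> t < d \<Longrightarrow> m1 (0 + t) < m1 0"
        using DERIV_neg_dec_right[OF dm1] by auto
      have "m (d/2) < m (d/4)"
        by (rule DERIV_neg_imp_decreasing[of "d/4" "d/2" m]) (use d m10 dm in fastforce)+
      moreover have "m (d/4) \<le> m 0"
        by (rule DERIV_nonpos_imp_nonincreasing[of 0 "d/4" m])
          (use d m10 dm in \<open>force intro: less_imp_le simp: le_less\<close>)+
      ultimately show False using mpos[of "d/2"] by (simp add: m_def e_def)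
    qed
  qed (simp add: Q_def)
  \<comment> \<open>Strictness comes from the maximum principle, as Q equals 1 at 0.\<close>
  have "0 < Re (Q z)"
  proof (rule Re_pos_of_Re_nonneg[where f=Q and S="ball 0 1" and a=0])
    show "Q holomorphic_on ball 0 1" unfolding Q_def using hol1 hol2 dh by (intro holomorphic_intros hol) auto
  qed (use z nonneg in \<open>auto simp: Q_def\<close>)
  then show "0 < Re (1 + z * deriv (deriv h) z / deriv h z)" by (simp add: Q_def)
qed

subsection \<open>The polynomial of the radius problem\<close>

text \<open>M is the value of (1 + z)/(1 - z) at r, which is the natural parameter of the estimates
  for functions with positive real part; \<zeta> is what remains after clearing its
  denominator.\<close>

lemma zeta_poly_eq:
  fixes \<alpha> r :: real
  assumes "r \<noteq> 1"
  defines "M \<equiv> (1 + r) / (1 - r)"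
  shows "zeta_poly \<alpha> r = (1 - r)^4 *
    (8 * \<alpha> * M * (\<alpha> * M + (1 - \<alpha>)) - (1 - \<alpha>) * (M\<^sup>2 - 2 * (\<alpha> * M + (1 - \<alpha>)))\<^sup>2)"
proof -
  \<comment> \<open>From 1 + r = M N = 2 - N both sides become polynomials without division.\<close>
  define N where "N = 1 - r"
  have P: "1 + r = M * N" and r: "r = 1 - N" using assms by (auto simp: N_def M_def)
  have P': "2 - N = M * N" using P r by simp
  have e: "8 * \<alpha> * (M*N) * (\<alpha> * (M*N) + (1 - \<alpha>) * N) * N^2 - (1 - \<alpha>) * ((M*N)\<^sup>2 - 2 * (\<alpha> * (M*N) + (1 - \<alpha>)*N) * N)\<^sup>2
     = N^4 * (8 * \<alpha> * M * (\<alpha> * M + (1 - \<alpha>)) - (1 - \<alpha>) * (M\<^sup>2 - 2 * (\<alpha> * M + (1 - \<alpha>)))\<^sup>2)"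
    by algebra
  have "zeta_poly \<alpha> (1 - N) = 8 * \<alpha> * (2-N) * (\<alpha> * (2-N) + (1 - \<alpha>) * N) * N^2 - (1 - \<alpha>) * ((2-N)\<^sup>2 - 2 * (\<alpha> * (2-N) + (1 - \<alpha>)*N) * N)\<^sup>2"
    unfolding zeta_poly_def by algebra
  then show ?thesis using e unfolding P' r by simp
qed

text \<open>As a quadratic in \<open>V = U M \<ge> 1\<close> the right-hand side either has its vertex to the left of 1, and then
  the value at 1 decides, or its discriminant is negative.\<close>

lemma quadratic_pos_of_zeta:
  fixes \<alpha> M U :: real
  assumes \<alpha>: "0 < \<alpha>" "\<alpha> < 1" and M: "0 < M"
    and Z: "0 < 8 * \<alpha> * M * (\<alpha> * M + (1 - \<alpha>)) - (1 - \<alpha>) * (M\<^sup>2 - 2 * (\<alpha> * M + (1 - \<alpha>)))\<^sup>2"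
    and U: "1 / M \<le> U"
  shows "0 < 2 * (\<alpha> + (1 - \<alpha>) * U)\<^sup>2 - (1 - \<alpha>) * U * (M - U)"
proof -
  define g t V where "g = 1 - \<alpha>" and "t = \<alpha> * M" and "V = U * M"
  define A B C where "A = g * (2*g+1)" and "B = g * (4 * t - M\<^sup>2)" and "C = 2 * t\<^sup>2"
  have g: "0 < g" "g < 1" and t: "0 < t" and V: "1 \<le> V"
    using assms by (auto simp: g_def t_def V_def field_simps)
  have A: "0 < A" using g by (simp add: A_def)
  have Z': "g * (M\<^sup>2 - 2 * (t + g))\<^sup>2 < 8 * t * (t + g)"
    using Z by (simp add: g_def t_def algebra_simps)
  \<comment> \<open>Four times the value of the quadratic at V = 1 differs from the positive
    expression of \<open>Z'\<close> by a nonnegative square.\<close>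
  have "4 * (2 * (t + g)\<^sup>2 - g * (M\<^sup>2 - 1)) = (8 * t * (t + g) - g * (M\<^sup>2 - 2 * (t + g))\<^sup>2) + g * (M\<^sup>2 - 2 * (t+g) - 2)\<^sup>2"
    by algebra
  also have "\<dots> > 0" using Z' g by (intro add_pos_nonneg) auto
  finally have T1: "0 < 2 * (t + g)\<^sup>2 - g * (M\<^sup>2 - 1)" by simp
  have "0 < A * V\<^sup>2 + B * V + C"
  \<comment> \<open>Up to the factor g the tested number is the derivative of the quadratic at V =
    1.\<close>
  proof (cases "0 \<le> 2 * (2*g+1) + 4*t - M\<^sup>2")
    case True
    have "A * V\<^sup>2 + B * V + C = (2 * (t + g)\<^sup>2 - g * (M\<^sup>2 - 1)) + (V - 1) * g * ((2*g+1) * (V - 1) + (2 * (2*g+1) + 4*t - M\<^sup>2))"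
      unfolding A_def B_def C_def by algebra
    moreover have "0 \<le> (V - 1) * g * ((2*g+1) * (V - 1) + (2 * (2*g+1) + 4*t - M\<^sup>2))"
      using True V g by (intro mult_nonneg_nonneg add_nonneg_nonneg) auto
    ultimately show ?thesis using T1 by linarith
  next
    case False
    define N s where "N = M\<^sup>2 - 2*t - 2*g" and "s = t + g"
    have N: "2 * s + 2 < N" using False by (simp add: N_def s_def)
    have s: "g < s" using t by (simp add: s_def)
    have Z'': "g * N\<^sup>2 < 8 * t * s" using Z' by (simp add: N_def s_def algebra_simps)
    have "(2 * s + 2)\<^sup>2 \<le> N\<^sup>2" using N s g by (intro power_mono) auto
    then have "g * (2 * s + 2)\<^sup>2 \<le> g * N\<^sup>2" using g by simp
    then have s1: "g * (s + 1)\<^sup>2 < 2 * t * s" using Z'' by (simp add: power2_eq_square algebra_simps)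
    have tg: "g \<le> t"
    proof (rule ccontr)
      assume "\<not> g \<le> t"
      then have "t * s \<le> g * s" using s g by (intro mult_right_mono) auto
      then have "g * (s+1)\<^sup>2 < g * (2 * s)" using s1 by (simp add: algebra_simps)
      then have "(s+1)\<^sup>2 < 2 * s" using g by simp
      moreover have "(s + 1)\<^sup>2 = s\<^sup>2 + 2 * s + 1" by (simp add: power2_eq_square algebra_simps)
      ultimately show False using zero_le_power2[of s] by linarith
    qed
    have "(2 - g) * s\<^sup>2 - 4 * g * s - g > 0"
      using s1 by (simp add: s_def power2_eq_square algebra_simps)
    then have "(4 - 2*g) * s\<^sup>2 - 8 * g * s - 2*g > 0" by (simp add: algebra_simps)
    moreover have "(4 - 2*g) * s\<^sup>2 \<le> 5 * s\<^sup>2" using g by (intro mult_right_mono) auto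
    ultimately have "0 < 5 * s\<^sup>2 - 8 * g * s - 2 * g" by linarith
    then have s2: "0 < 5 * t\<^sup>2 + 2 * t * g - 2 * g - 3 * g\<^sup>2"
      by (simp add: s_def power2_eq_square algebra_simps)
    \<comment> \<open>As M^2 - 4 t = N - 2 (t - g), the discriminant contains the cross term (t - g)
      N. The lower bound for N may be inserted in it because g \<le> t.\<close>
    have "(t - g) * (2 * s+2) \<le> (t - g) * N" using N tg by (intro mult_left_mono) auto
    then have "g * (N\<^sup>2 - 4 * ((t-g) * N) + 4 * (t-g)\<^sup>2) \<le> g * (N\<^sup>2 - 4 * ((t-g) * (2 * s+2)) + 4 * (t-g)\<^sup>2)"
      using g by (intro mult_left_mono) auto
    also have "\<dots> = g * N\<^sup>2 - g * (4 * ((t-g) * (2 * s+2)) - 4 * (t-g)\<^sup>2)"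
      by (simp add: algebra_simps)
    also have "\<dots> < 8 * t * s - g * (4 * ((t-g) * (2 * s+2)) - 4 * (t-g)\<^sup>2)" using Z'' by simp
    also have "\<dots> = 8 * (2*g+1) * t\<^sup>2 - 4 * g * (5 * t\<^sup>2 + 2 * t * g - 2 * g - 3 * g\<^sup>2)"
      unfolding s_def by algebra
    also have "\<dots> < 8 * (2*g+1) * t\<^sup>2" using s2 g by simp
    finally have "g * (M\<^sup>2 - 4*t)\<^sup>2 < 8 * (2*g+1) * t\<^sup>2"
      unfolding N_def by (simp add: power2_eq_square algebra_simps)
    then have "g * (g * (M\<^sup>2 - 4*t)\<^sup>2) < g * (8 * (2*g+1) * t\<^sup>2)" using g by simp
    then have D: "0 < 4 * A * C - B\<^sup>2"
      unfolding A_def B_def C_def by (simp add: power2_eq_square algebra_simps)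
    have "4 * A * (A * V\<^sup>2 + B * V + C) = (2 * A * V + B)\<^sup>2 + (4 * A * C - B\<^sup>2)" by algebra
    also have "\<dots> > 0" using D by (intro add_nonneg_pos) auto
    finally show ?thesis using A by (simp add: zero_less_mult_iff)
  qed
  also have "A * V\<^sup>2 + B * V + C = M\<^sup>2 * (2 * (\<alpha> + (1 - \<alpha>) * U)\<^sup>2 - (1 - \<alpha>) * U * (M - U))"
    unfolding A_def B_def C_def V_def t_def g_def by algebra
  finally show ?thesis using M by (simp add: zero_less_mult_iff)
qed

subsection \<open>A sharp differential inequality\<close>

lemma Moebius_in_ball:
  assumes "cmod a < 1" "cmod b < 1"
  shows "1 + cnj a * b \<noteq> 0" "cmod ((b + a) / (1 + cnj a * b)) < 1"
proof -
  show "1 + cnj a * b \<noteq> 0"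
  proof
    assume "1 + cnj a * b = 0"
    then have "cnj a * b = -1" by (simp add: eq_neg_iff_add_eq_0 add.commute)
    then have "cmod (cnj a * b) = 1" by simp
    moreover have "cmod (cnj a * b) < 1 * 1"
      unfolding norm_mult using assms by (intro mult_strict_mono') auto
    ultimately show False by simp
  qed
  show "cmod ((b + a) / (1 + cnj a * b)) < 1"
    using Moebius_function_norm_lt_1[of "-a" b 0] assms by (simp add: Moebius_function_simple)
qed

lemma Moebius_holomorphic:
  assumes "cmod a < 1"
  shows "(\<lambda>z. (z + a) / (1 + cnj a * z)) holomorphic_on ball 0 1"
  using Moebius_in_ball(1)[OF assms] by (intro holomorphic_intros) auto

lemma Moebius_deriv:
  assumes "cmod a < 1" and "z \<in> ball 0 1"
  shows "((\<lambda>z. (z + a) / (1 + cnj a * z)) has_field_derivative of_real (1 - (cmod a)\<^sup>2) / (1 + cnj a * z)\<^sup>2) (at z)"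
  using Moebius_in_ball(1)[OF assms(1), of z] assms(2) unfolding of_real_diff complex_norm_square
  by (auto intro!: derivative_eq_intros simp: power2_eq_square field_simps)

text \<open>Moebius maps move z and f z to 0; the claim is the derivative bound of the Schwarz lemma
  for the conjugated map.\<close>

lemma Schwarz_Pick_deriv:
  assumes f: "f holomorphic_on ball 0 1" and lt: "\<And>z. z \<in> ball 0 1 \<Longrightarrow> cmod (f z) < 1" and z: "z \<in> ball 0 1"
  shows "cmod (deriv f z) * (1 - (cmod z)\<^sup>2) \<le> 1 - (cmod (f z))\<^sup>2"
proof -
  define A where "A w = (w + z) / (1 + cnj z * w)" for w
  define b where "b = - f z"
  define B where "B w = (w + b) / (1 + cnj b * w)" for w
  have z1: "cmod z < 1" and b1: "cmod b < 1" using z lt[OF z] by (auto simp: b_def)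
  have A: "A w \<in> ball 0 1" if "w \<in> ball 0 1" for w
    using Moebius_in_ball[OF z1, of w] that by (simp add: A_def)
  have B: "B w \<in> ball 0 1" if "w \<in> ball 0 1" for w
    using Moebius_in_ball[OF b1, of w] that by (simp add: B_def)
  define F where "F w = B (f (A w))" for w
  have "(\<lambda>w. f (A w)) holomorphic_on ball 0 1"
    using holomorphic_on_compose_gen[OF Moebius_holomorphic[OF z1] f] A
    by (simp add: o_def image_subset_iff A_def)
  then have "F holomorphic_on ball 0 1"
    using holomorphic_on_compose_gen[OF _ Moebius_holomorphic[OF b1], of "\<lambda>w. f (A w)" "ball 0 1"] A lt
    by (simp add: o_def image_subset_iff B_def F_def[abs_def])
  moreover have "F 0 = 0" by (simp add: F_def A_def B_def b_def)
  moreover have "cmod (F w) < 1" if "cmod w < 1" for w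
    using B[of "f (A w)"] lt[OF A, of w] that by (simp add: F_def)
  ultimately have F1: "cmod (deriv F 0) \<le> 1" by (rule Schwarz_Lemma(2)[where \<xi>=0]) simp_all
  have dA: "(A has_field_derivative of_real (1 - (cmod z)\<^sup>2)) (at 0)"
    using Moebius_deriv[OF z1, of 0] by (simp add: A_def[abs_def])
  have A0: "A 0 = z" by (simp add: A_def)
  have df: "(f has_field_derivative deriv f z) (at (A 0))" using f z by (simp add: A0 holomorphic_derivI)
  have ne: "(1 - (cmod (f z))\<^sup>2) > 0" using lt[OF z] by (simp add: abs_square_less_1)
  have "1 + cnj b * f z = of_real (1 - (cmod (f z))\<^sup>2)"
    unfolding of_real_diff complex_norm_square by (simp add: b_def mult.commute)
  then have "of_real (1 - (cmod b)\<^sup>2) / (1 + cnj b * f z)\<^sup>2 = 1 / (of_real (1 - (cmod (f z))\<^sup>2) :: complex)"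
    using ne by (simp add: power2_eq_square b_def del: of_real_diff)
  then have dB: "(B has_field_derivative 1 / of_real (1 - (cmod (f z))\<^sup>2)) (at (f (A 0)))"
    using Moebius_deriv[OF b1, of "f z"] lt[OF z] by (simp add: B_def[abs_def] A0 del: of_real_diff)
  have "(F has_field_derivative 1 / of_real (1 - (cmod (f z))\<^sup>2) * (deriv f z * of_real (1 - (cmod z)\<^sup>2))) (at 0)"
    unfolding F_def by (rule DERIV_chain2[OF dB DERIV_chain2[OF df dA]])
  then have dF: "deriv F 0 = 1 / of_real (1 - (cmod (f z))\<^sup>2) * (deriv f z * of_real (1 - (cmod z)\<^sup>2))"
    by (rule DERIV_imp_deriv)
  have z2: "1 - (cmod z)\<^sup>2 > 0" using z by (simp add: abs_square_less_1)
  have "cmod (deriv F 0) = 1 / (1 - (cmod (f z))\<^sup>2) * (cmod (deriv f z) * (1 - (cmod z)\<^sup>2))"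
    unfolding dF norm_mult norm_divide norm_of_real using ne z2 by simp
  then have "cmod (deriv f z) * (1 - (cmod z)\<^sup>2) / (1 - (cmod (f z))\<^sup>2) \<le> 1" using F1 by simp
  then show ?thesis using ne by (simp only: pos_divide_le_eq mult_1)
qed



text \<open>Write p = (1 + \<omega>)/(1 - \<omega>) with \<omega> = z \<phi>. Then 2 z p' - (p^2 -
  1) = (p + 1)^2 z^2 \<phi>', and the Schwarz-Pick bound for \<phi> confines z p' to a disc about
  (p^2 - 1)/2. Keeping this centre, instead of bounding \<bar>z p'\<bar> alone, is what makes the
  later estimate sharp enough.\<close>

lemma caratheodory_deriv_bound:
  fixes p :: "complex \<Rightarrow> complex"
  assumes p: "p holomorphic_on ball 0 1" and p0: "p 0 = 1"
    and pos: "\<And>z. z \<in> ball 0 1 \<Longrightarrow> 0 < Re (p z)" and z: "z \<in> ball 0 1"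
  defines "a \<equiv> (1 + (cmod z)\<^sup>2) / (1 - (cmod z)\<^sup>2)"
  shows "2 * cmod (z * deriv p z - ((p z)\<^sup>2 - 1) / 2) \<le> 2 * a * Re (p z) - (cmod (p z))\<^sup>2 - 1"
proof -
  define \<omega> where "\<omega> w = (p w - 1) / (p w + 1)" for w
  have p1: "p w + 1 \<noteq> 0" if "w \<in> ball 0 1" for w
    using pos[OF that] by (auto simp: complex_eq_iff)
  have \<omega>: "\<omega> holomorphic_on ball 0 1" unfolding \<omega>_def[abs_def] using p p1 by (intro holomorphic_intros) auto
  have \<omega>1: "cmod (\<omega> w) < 1" if "cmod w < 1" for w
  proof -
    have "w \<in> ball 0 1" using that by simp
    then have "0 < Re (p w)" using pos by blast
    then have "(cmod (p w - 1))\<^sup>2 < (cmod (p w + 1))\<^sup>2"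
      unfolding cmod_power2 by (simp add: power2_eq_square algebra_simps)
    then have "cmod (p w - 1) < cmod (p w + 1)" by (simp add: power_less_imp_less_base)
    then show ?thesis using p1[of w] that by (simp add: \<omega>_def norm_divide)
  qed
  have \<omega>0: "\<omega> 0 = 0" by (simp add: \<omega>_def p0)
  obtain \<phi> where \<phi>: "\<phi> holomorphic_on ball 0 1" "\<And>w. cmod w < 1 \<Longrightarrow> \<omega> w = w * \<phi> w" "deriv \<omega> 0 = \<phi> 0"
    using Schwarz3[OF \<omega> \<omega>0] by blast
  \<comment> \<open>When \<omega> is a rotation, \<phi> is a unimodular constant and Schwarz-Pick
    does not apply; both sides are then 0.\<close>
  have key: "cmod (deriv \<phi> w) * (1 - (cmod w)\<^sup>2) \<le> 1 - (cmod (\<phi> w))\<^sup>2" if w: "w \<in> ball 0 1" for w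
  proof (cases "\<forall>v\<in>ball 0 1. cmod (\<phi> v) < 1")
    case True
    then show ?thesis using Schwarz_Pick_deriv[OF \<phi>(1) _ w] by blast
  next
    case False
    then obtain v where v: "cmod v < 1" "1 \<le> cmod (\<phi> v)" by auto
    have "cmod (\<omega> v) \<le> cmod v" using Schwarz_Lemma(1)[OF \<omega> \<omega>0 \<omega>1 v(1)] by simp
    then have "v \<noteq> 0 \<longrightarrow> cmod (\<omega> v) = cmod v"
      using v \<phi>(2)[OF v(1)] by (auto simp: norm_mult)
    moreover have "cmod (deriv \<omega> 0) \<le> 1" using Schwarz_Lemma(2)[OF \<omega> \<omega>0 \<omega>1 v(1)] by simp
    then have "v = 0 \<longrightarrow> cmod (deriv \<omega> 0) = 1" using v \<phi>(3) by auto
    ultimately have "(\<exists>z. cmod z < 1 \<and> z \<noteq> 0 \<and> cmod (\<omega> z) = cmod z) \<or> cmod (deriv \<omega> 0) = 1"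
      using v by metis
    from Schwarz_Lemma(3)[OF \<omega> \<omega>0 \<omega>1 v(1) this]
    obtain c where c: "\<And>z. cmod z < 1 \<Longrightarrow> \<omega> z = c * z" "cmod c = 1" by auto
    have c0: "\<phi> z = c" if "z \<in> ball 0 1 - {0}" for z
      using c(1)[of z] \<phi>(2)[of z] that by auto
    have "deriv \<omega> 0 = c"
      by (intro DERIV_imp_deriv has_field_derivative_transform_within_open[of "\<lambda>z. c * z" c 0 "ball 0 1" \<omega>])
         (auto intro!: derivative_eq_intros simp: c(1))
    then have cc: "\<phi> z = c" if "z \<in> ball 0 1" for z using c0 \<phi>(3) that by (cases "z = 0") auto
    have "deriv \<phi> w = 0"
      by (intro DERIV_imp_deriv has_field_derivative_transform_within_open[of "\<lambda>z. c" 0 w "ball 0 1" \<phi>])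
         (use w in \<open>auto simp: cc\<close>)
    then show ?thesis using cc[OF w] c(2) by simp
  qed
  define x where "x = \<omega> z"
  define P where "P = p z"
  have P1: "P + 1 \<noteq> 0" using p1[OF z] by (simp add: P_def)
  have x: "x * (P + 1) = P - 1" using P1 by (simp add: x_def \<omega>_def P_def)

  have dp: "(p has_field_derivative deriv p z) (at z)" using p z by (simp add: holomorphic_derivI)

  have d2: "(\<omega> has_field_derivative 2 * deriv p z / (P + 1)\<^sup>2) (at z)"
    unfolding \<omega>_def using P1 by (auto intro!: derivative_eq_intros dp simp: P_def power2_eq_square field_simps)
  have "\<phi> z + z * deriv \<phi> z = 2 * deriv p z / (P + 1)\<^sup>2"
    using deriv_id_times[OF \<phi>(1,2) z] DERIV_imp_deriv[OF d2] by simp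
  then have "(P + 1)\<^sup>2 * (\<phi> z + z * deriv \<phi> z) = 2 * deriv p z" using P1 by simp
  then have "2 * (z * deriv p z) = z * ((P + 1)\<^sup>2 * (\<phi> z + z * deriv \<phi> z))" by simp
  also have "\<dots> = (P + 1)\<^sup>2 * (z * \<phi> z + z\<^sup>2 * deriv \<phi> z)"
    by (simp add: algebra_simps power2_eq_square)
  also have "z * \<phi> z = x" using \<phi>(2)[of z] z by (simp add: x_def)
  also have "(P + 1)\<^sup>2 * (x + z\<^sup>2 * deriv \<phi> z) = (P + 1) * (x * (P + 1)) + (P + 1)\<^sup>2 * (z\<^sup>2 * deriv \<phi> z)"
    by (simp add: power2_eq_square algebra_simps)
  also have "\<dots> = P\<^sup>2 - 1 + (P + 1)\<^sup>2 * (z\<^sup>2 * deriv \<phi> z)"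
    unfolding x by (simp add: power2_eq_square algebra_simps)
  finally have "2 * (z * deriv p z) = P\<^sup>2 - 1 + (P + 1)\<^sup>2 * (z\<^sup>2 * deriv \<phi> z)" .
  then have e: "2 * (z * deriv p z) - (P\<^sup>2 - 1) = (P + 1)\<^sup>2 * (z\<^sup>2 * deriv \<phi> z)" by simp
  have "2 * (X - Y / 2) = 2 * X - Y" for X Y :: complex by (simp add: field_simps)
  then have "2 * (z * deriv p z - (P\<^sup>2 - 1) / 2) = (P + 1)\<^sup>2 * (z\<^sup>2 * deriv \<phi> z)" using e by metis
  then have "cmod (2 * (z * deriv p z - (P\<^sup>2 - 1) / 2)) = cmod ((P + 1)\<^sup>2 * (z\<^sup>2 * deriv \<phi> z))" by simp
  moreover have "cmod (2 * w) = 2 * cmod w" for w by (simp add: norm_mult)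
  ultimately have "2 * cmod (z * deriv p z - (P\<^sup>2 - 1) / 2) = cmod ((P + 1)\<^sup>2 * (z\<^sup>2 * deriv \<phi> z))" by metis
  then have eq: "2 * cmod (z * deriv p z - (P\<^sup>2 - 1) / 2) = (cmod (P + 1))\<^sup>2 * (cmod z)\<^sup>2 * cmod (deriv \<phi> z)"
    by (simp only: norm_mult norm_power mult.assoc)
  define r where "r = cmod z"
  have r1: "0 < 1 - r\<^sup>2" using z by (simp add: r_def abs_square_less_1)
  have zx: "r * cmod (\<phi> z) = cmod x" using \<phi>(2)[of z] z by (simp add: x_def r_def norm_mult)
  have "cmod (deriv \<phi> z) * (1 - r\<^sup>2) \<le> 1 - (cmod (\<phi> z))\<^sup>2" using key[OF z] by (simp add: r_def)
  then have "r\<^sup>2 * (cmod (deriv \<phi> z) * (1 - r\<^sup>2)) \<le> r\<^sup>2 * (1 - (cmod (\<phi> z))\<^sup>2)" by (intro mult_left_mono) auto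
  also have "\<dots> = r\<^sup>2 - (cmod x)\<^sup>2" unfolding zx[symmetric] by (simp add: algebra_simps power_mult_distrib)
  finally have "(cmod (P + 1))\<^sup>2 * (r\<^sup>2 * (cmod (deriv \<phi> z) * (1 - r\<^sup>2))) \<le> (cmod (P + 1))\<^sup>2 * (r\<^sup>2 - (cmod x)\<^sup>2)"
    by (intro mult_left_mono) auto
  also have "\<dots> = r\<^sup>2 * (cmod (P + 1))\<^sup>2 - (cmod (x * (P + 1)))\<^sup>2"
    unfolding norm_mult power_mult_distrib by (simp add: algebra_simps)
  also have "\<dots> = r\<^sup>2 * (cmod (P + 1))\<^sup>2 - (cmod (P - 1))\<^sup>2" by (simp add: x)
  also have "\<dots> = (1 + r\<^sup>2) * (2 * Re P) - (1 - r\<^sup>2) * ((cmod P)\<^sup>2 + 1)"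
    unfolding cmod_power2 by (simp add: power2_eq_square algebra_simps)
  finally have "(1 - r\<^sup>2) * (2 * cmod (z * deriv p z - (P\<^sup>2 - 1) / 2)) \<le> (1 + r\<^sup>2) * (2 * Re P) - (1 - r\<^sup>2) * ((cmod P)\<^sup>2 + 1)"
    unfolding eq by (simp add: r_def algebra_simps)
  then have "2 * cmod (z * deriv p z - (P\<^sup>2 - 1) / 2) \<le> ((1 + r\<^sup>2) * (2 * Re P) - (1 - r\<^sup>2) * ((cmod P)\<^sup>2 + 1)) / (1 - r\<^sup>2)"
    using r1 by (simp add: field_simps)
  also have "\<dots> = 2 * a * Re P - (cmod P)\<^sup>2 - 1"
    using r1 unfolding a_def r_def[symmetric] by (simp add: field_simps)
  finally show ?thesis by (simp add: P_def)
qed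

text \<open>2 Re q / q is 1 plus the unimodular number cnj q / q. The bound does not involve Im q,
  hence it is uniform in the shift i s added to p.\<close>

lemma Re_divide_lower_bound:
  fixes X q :: complex
  assumes "0 < Re q"
  shows "(Re X - cmod X) / 2 \<le> Re q * Re (X / q)"
proof -
  have q: "q \<noteq> 0" using assms by auto
  have "2 * of_real (Re q) = q + cnj q" by (simp add: complex_add_cnj)
  then have e: "of_real (2 * Re q) * (X / q) = X + X * (cnj q / q)" using q by (simp add: field_simps)
  have "Re (of_real t * Y) = t * Re Y" for t Y by simp
  then have "2 * Re q * Re (X / q) = Re (X + X * (cnj q / q))" unfolding e[symmetric] by metis
  also have "\<dots> \<ge> Re X - cmod X"
  proof -
    have "- cmod (X * (cnj q / q)) \<le> Re (X * (cnj q / q))"      using abs_Re_le_cmod[of "X * (cnj q / q)"] by linarith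
    moreover have "cmod (X * (cnj q / q)) = cmod X" using q by (simp add: norm_mult norm_divide)
    ultimately show ?thesis by simp
  qed
  finally show ?thesis by simp
qed

text \<open>With \<open>S = \<bar>P\<bar>\<^sup>2 + 1 \<le> 2 a U\<close> the left-hand side is \<open>U\<^sup>2 + S/2 - sqrt (S\<^sup>2 - 4 U\<^sup>2)/2 - 2 a U\<close>,
  which decreases in \<open>S\<close>.\<close>

lemma caratheodory_key_ineq:
  fixes P :: complex and r :: real
  assumes r: "0 \<le> r" "r < 1" and U: "0 < Re P"
    and S: "(cmod P)\<^sup>2 + 1 \<le> 2 * ((1 + r\<^sup>2) / (1 - r\<^sup>2)) * Re P"
  shows "Re P * (Re P - (1 + r) / (1 - r)) \<le>
    (Re (P\<^sup>2 - 1) - cmod (P\<^sup>2 - 1)) / 2 - (2 * ((1 + r\<^sup>2) / (1 - r\<^sup>2)) * Re P - (cmod P)\<^sup>2 - 1)"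
    and "(1 - r) / (1 + r) \<le> Re P"
proof -
  define U V a b S where "U = Re P" and "V = Im P" and "a = (1 + r\<^sup>2) / (1 - r\<^sup>2)" and "b = 2 * r / (1 - r\<^sup>2)"
    and "S = (cmod P)\<^sup>2 + 1"
  have r2: "0 < 1 - r\<^sup>2" using r by (simp add: abs_square_less_1)
  have fac: "1 - r\<^sup>2 = (1 - r) * (1 + r)" by (simp add: power2_eq_square algebra_simps)
  \<comment> \<open>The numbers a + b and a - b are reciprocal, so a^2 - b^2 = 1; this is used to
    eliminate a^2 throughout.\<close>
  have ab: "a + b = (1 + r) / (1 - r)" "a - b = (1 - r) / (1 + r)"
    using r r2 unfolding a_def b_def add_divide_distrib[symmetric] diff_divide_distrib[symmetric] fac
    by (simp_all add: divide_simps power2_eq_square algebra_simps)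
  have "(a + b) * (a - b) = 1" unfolding ab using r by simp
  then have ab1: "a\<^sup>2 - b\<^sup>2 = 1" by (simp add: power2_eq_square algebra_simps)
  have b: "0 \<le> b" using r r2 by (simp add: b_def)
  have SU: "S \<le> 2 * a * U" using S by (simp add: S_def a_def U_def)
  have SV: "S = U\<^sup>2 + V\<^sup>2 + 1" by (simp add: S_def cmod_power2 U_def V_def)
  have W2: "(cmod (P\<^sup>2 - 1))\<^sup>2 = S\<^sup>2 - 4 * U\<^sup>2"
    unfolding cmod_power2 SV U_def V_def by (simp add: power2_eq_square) algebra
  have R: "Re (P\<^sup>2 - 1) = 2 * U\<^sup>2 - S" by (simp add: SV U_def V_def power2_eq_square)
  define T where "T = cmod (P\<^sup>2 - 1)"
  have US: "U\<^sup>2 + 1 \<le> S" by (simp add: SV)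
  then have "(U - a)\<^sup>2 \<le> b\<^sup>2" using SU ab1 by (simp add: power2_eq_square algebra_simps)
  then have Uab: "\<bar>U - a\<bar> \<le> b" using b abs_le_square_iff[of "U - a" b] by simp
  \<comment> \<open>The bound is an equality when the slack d = 2 a U - S is 0. In general both
    sides are squared, and b \<le> a compares the terms linear in d.\<close>
  have "T \<le> 2 * b * U - (2 * a * U - S)"
  proof (rule power2_le_imp_le)
    define d where "d = 2 * a * U - S"
    have d: "0 \<le> d" "S = 2 * a * U - d" using SU by (auto simp: d_def)
    have aU: "b * U \<le> a * U"
      using U ab(2) r by (intro mult_right_mono) (auto simp: U_def, smt (verit) divide_nonneg_pos)
    have "T\<^sup>2 = (2 * b * U)\<^sup>2 - 4 * a * U * d + d\<^sup>2"
      unfolding T_def W2 d(2) using ab1 by algebra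
    also have "\<dots> \<le> (2 * b * U)\<^sup>2 - 4 * b * U * d + d\<^sup>2"
      using mult_right_mono[OF aU d(1)] by (simp add: algebra_simps)
    also have "\<dots> = (2 * b * U - d)\<^sup>2" by algebra
    finally show "T\<^sup>2 \<le> (2 * b * U - (2 * a * U - S))\<^sup>2" by (simp add: d_def)
    show "0 \<le> 2 * b * U - (2 * a * U - S)"
    proof -
      have "2 * (a - b) * U \<le> U\<^sup>2 + 1"
      proof -
        have "U * (a - b) \<le> U * U" using Uab U by (intro mult_left_mono) (auto simp: U_def)
        moreover have "(a - b) * U \<le> (a - b) * (a + b)"
          using Uab r by (intro mult_left_mono) (auto simp: ab(2))
        moreover have "(a - b) * (a + b) = 1" using ab1 by (simp add: power2_eq_square algebra_simps)
        ultimately show ?thesis by (simp add: power2_eq_square algebra_simps)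
      qed
      then show ?thesis using US by (simp add: algebra_simps)
    qed
  qed
  then show "Re P * (Re P - (1 + r) / (1 - r)) \<le>
    (Re (P\<^sup>2 - 1) - cmod (P\<^sup>2 - 1)) / 2 - (2 * ((1 + r\<^sup>2) / (1 - r\<^sup>2)) * Re P - (cmod P)\<^sup>2 - 1)"
    unfolding R ab(1)[symmetric] T_def[symmetric] a_def[symmetric] U_def[symmetric]
    using S_def by (simp add: power2_eq_square algebra_simps) argo
  show "(1 - r) / (1 + r) \<le> Re P" using Uab unfolding ab(2)[symmetric] U_def by linarith
qed

text \<open>Normalise p = \<alpha> + g Q and put q = p + i s, U = Re Q. The two preceding estimates
  bound Re q Re (z Q'/q) below by U (U - M)/2, so multiplying the claim by 2 Re q leaves the
  quadratic inequality in U.\<close>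

lemma Re_Briot_Bouquet_pos:
  fixes p :: "complex \<Rightarrow> complex"
  assumes \<alpha>: "0 < \<alpha>" "\<alpha> < 1" and p: "p holomorphic_on ball 0 1" and p0: "p 0 = 1"
    and pos: "\<And>z. z \<in> ball 0 1 \<Longrightarrow> \<alpha> < Re (p z)" and z: "cmod z \<le> r" and r: "r < 1"
    and zeta: "0 < zeta_poly \<alpha> r"
  shows "0 < Re (p z + z * deriv p z / (p z + \<i> * of_real s))"
proof -
  define g where "g = 1 - \<alpha>"
  have g: "0 < g" using \<alpha> by (simp add: g_def)
  define \<rho> where "\<rho> = cmod z"
  have \<rho>: "0 \<le> \<rho>" "\<rho> \<le> r" "\<rho> < 1" using z r by (auto simp: \<rho>_def)
  have zb: "z \<in> ball 0 1" using \<rho> by (simp add: \<rho>_def)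
  define Q where "Q w = (p w - of_real \<alpha>) / of_real g" for w
  have Qhol: "Q holomorphic_on ball 0 1" unfolding Q_def using p g by (intro holomorphic_intros) auto
  have Q0: "Q 0 = 1" using g by (simp add: Q_def p0 g_def)
  have Qpos: "0 < Re (Q w)" if "w \<in> ball 0 1" for w
    using pos[OF that] g by (simp add: Q_def Re_divide_of_real)
  have pQ: "p w = of_real \<alpha> + of_real g * Q w" for w using g by (simp add: Q_def)
  have dQ: "deriv p z = of_real g * deriv Q z"
  proof -
    have "(Q has_field_derivative deriv Q z) (at z)" using Qhol zb by (simp add: holomorphic_derivI)
    then have "(p has_field_derivative of_real g * deriv Q z) (at z)"
      unfolding pQ[abs_def] by (auto intro!: derivative_eq_intros)
    then show ?thesis by (rule DERIV_imp_deriv)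
  qed
  define P where "P = Q z"
  define U where "U = Re P"
  define a where "a = (1 + \<rho>\<^sup>2) / (1 - \<rho>\<^sup>2)"
  define D where "D = 2 * a * U - (cmod P)\<^sup>2 - 1"
  define X where "X = z * deriv Q z"
  have XD: "2 * cmod (X - (P\<^sup>2 - 1) / 2) \<le> D"
    using caratheodory_deriv_bound[OF Qhol Q0 Qpos zb] by (simp add: D_def a_def X_def P_def U_def \<rho>_def)
  have U0: "0 < U" using Qpos[OF zb] by (simp add: U_def P_def)
  have "0 \<le> D" using XD norm_ge_zero[of "X - (P\<^sup>2 - 1) / 2"] by linarith
  then have S: "(cmod P)\<^sup>2 + 1 \<le> 2 * ((1 + \<rho>\<^sup>2) / (1 - \<rho>\<^sup>2)) * Re P" by (simp add: D_def a_def U_def)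
  note key = caratheodory_key_ineq[OF \<rho>(1,3) U0[unfolded U_def] S]
  have "(Re X - cmod X) / 2 \<ge> U * (U - (1 + \<rho>) / (1 - \<rho>)) / 2"
  proof -
    have "Re X = Re ((P\<^sup>2 - 1) / 2) + Re (X - (P\<^sup>2 - 1) / 2)" by simp
    moreover have "- cmod (X - (P\<^sup>2 - 1) / 2) \<le> Re (X - (P\<^sup>2 - 1) / 2)"
      using abs_Re_le_cmod[of "X - (P\<^sup>2 - 1) / 2"] by linarith
    moreover have "cmod X \<le> cmod ((P\<^sup>2 - 1) / 2) + cmod (X - (P\<^sup>2 - 1) / 2)"
      using norm_triangle_ineq[of "(P\<^sup>2 - 1) / 2" "X - (P\<^sup>2 - 1) / 2"] by simp
    moreover have "cmod ((P\<^sup>2 - 1) / 2) = cmod (P\<^sup>2 - 1) / 2" by (simp add: norm_divide)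
    moreover have "Re ((P\<^sup>2 - 1) / 2) = Re (P\<^sup>2 - 1) / 2" by (simp add: Re_divide_numeral)
    moreover have "U * (U - (1 + \<rho>) / (1 - \<rho>)) \<le> (Re (P\<^sup>2 - 1) - cmod (P\<^sup>2 - 1)) / 2 - D"
      using key(1) by (simp add: U_def D_def a_def)
    ultimately show ?thesis using XD by argo
  qed
  moreover define q where "q = p z + \<i> * of_real s"
  have Req: "Re q = \<alpha> + g * U" by (simp add: q_def pQ U_def P_def)
  have q0: "0 < Re q" using \<alpha> g U0 by (simp add: Req add_pos_pos)
  moreover note Re_divide_lower_bound[OF q0, of X]
  ultimately have 1: "U * (U - (1 + \<rho>) / (1 - \<rho>)) / 2 \<le> (\<alpha> + g * U) * Re (X / q)" by (simp add: Req)
  \<comment> \<open>\<zeta> is controlled at r, while \<bar>z\<bar> may be smaller. Enlarging the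
    radius enlarges M, which weakens the lower bound 1/M for U and strengthens the quadratic
    inequality to be shown.\<close>
  define M where "M = (1 + r) / (1 - r)"
  have MM: "(1 + \<rho>) / (1 - \<rho>) \<le> M" unfolding M_def using \<rho> r by (intro frac_le) auto
  have M0: "0 < M" unfolding M_def using \<rho> r by (intro divide_pos_pos) auto
  have "1 / M = (1 - r) / (1 + r)" by (simp add: M_def)
  also have "\<dots> \<le> (1 - \<rho>) / (1 + \<rho>)" using \<rho> r by (intro frac_le) auto
  also have "\<dots> \<le> U" using key(2) by (simp add: U_def)
  finally have "1 / M \<le> U" .
  moreover have "0 < (1 - r)^4 * (8 * \<alpha> * M * (\<alpha> * M + (1 - \<alpha>)) - (1 - \<alpha>) * (M\<^sup>2 - 2 * (\<alpha> * M + (1 - \<alpha>)))\<^sup>2)"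
    using zeta r unfolding M_def by (subst zeta_poly_eq[symmetric]) auto
  then have "0 < 8 * \<alpha> * M * (\<alpha> * M + (1 - \<alpha>)) - (1 - \<alpha>) * (M\<^sup>2 - 2 * (\<alpha> * M + (1 - \<alpha>)))\<^sup>2"
    using r by (simp add: zero_less_mult_iff)
  ultimately have "0 < 2 * (\<alpha> + g * U)\<^sup>2 - g * U * (M - U)"
    using quadratic_pos_of_zeta[OF \<alpha> M0, of U] by (simp add: g_def)
  also have "\<dots> \<le> 2 * (\<alpha> + g * U)\<^sup>2 - g * U * ((1 + \<rho>) / (1 - \<rho>) - U)"
    using MM g U0 by (intro diff_left_mono mult_left_mono diff_right_mono) auto
  also have "\<dots> = 2 * (\<alpha> + g * U)\<^sup>2 + 2 * g * (U * (U - (1 + \<rho>) / (1 - \<rho>)) / 2)"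
  proof -
    have "T - g * U * (k - U) = T + 2 * g * (U * (U - k) / 2)" for T k by (simp add: field_simps)
    then show ?thesis .
  qed
  also have "\<dots> \<le> 2 * (\<alpha> + g * U)\<^sup>2 + 2 * g * ((\<alpha> + g * U) * Re (X / q))"
    using 1 g by (intro add_left_mono mult_left_mono) auto
  also have "\<dots> = 2 * Re q * (Re q + g * Re (X / q))" by (simp add: Req power2_eq_square algebra_simps)
  finally have "0 < Re q + g * Re (X / q)" using q0 by (simp add: zero_less_mult_iff)
  moreover have "z * deriv p z / q = of_real g * (X / q)" by (simp add: X_def dQ)
  moreover have "Re (of_real g * Y) = g * Re Y" for Y by simp
  ultimately have "0 < Re q + Re (z * deriv p z / q)" by metis
  moreover have "Re (p z + z * deriv p z / q) = Re q + Re (z * deriv p z / q)" by (simp add: q_def)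
  ultimately show ?thesis by (simp add: q_def)
qed

subsection \<open>The area theorem\<close>

text \<open>The area of a differentiable image is computed in \<open>real^2\<close>, whereas the
  iterated integral lives on pairs; the coordinate change preserves boxes and their content.\<close>

lemma has_integral_plane:
  fixes F :: "real \<times> real \<Rightarrow> real"
  assumes "continuous_on (cbox (a, c) (b, d)) F"
  shows "((\<lambda>v::real^2. F (v $ 1, v $ 2)) has_integral
    integral {a..b} (\<lambda>x. integral {c..d} (\<lambda>y. F (x, y)))) (cbox (vector [a, c]) (vector [b, d]))"
proof -
  define g where "g v = (v $ 1, v $ 2)" for v :: "real^2"
  define h where "h p = (vector [fst p, snd p] :: real^2)" for p :: "real \<times> real"
  have hg: "h (g v) = v" for v by (simp add: h_def g_def vec_eq_iff forall_2)
  have gh: "g (h p) = p" for p by (simp add: h_def g_def)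
  have gbox: "g ` cbox u v = cbox (u $ 1, u $ 2) (v $ 1, v $ 2)" for u v
  proof (intro equalityI subsetI)
    fix p assume "p \<in> cbox (u $ 1, u $ 2) (v $ 1, v $ 2)"
    then have "h p \<in> cbox u v" by (cases p) (auto simp: h_def mem_box_cart forall_2)
    then show "p \<in> g ` cbox u v" using gh by (metis imageI)
  qed (auto simp: g_def mem_box_cart forall_2)
  have hbox: "h ` cbox u v = cbox (h u) (h v)" for u v
  proof (intro equalityI subsetI)
    fix w assume "w \<in> cbox (h u) (h v)"
    then have "g w \<in> cbox u v" by (cases u; cases v) (auto simp: g_def h_def mem_box_cart forall_2)
    then show "w \<in> h ` cbox u v" using hg by (metis imageI)
  next
    fix w assume "w \<in> h ` cbox u v"
    then show "w \<in> cbox (h u) (h v)" by (cases u; cases v) (auto simp: h_def mem_box_cart forall_2)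
  qed
  have cont: "Henstock_Kurzweil_Integration.content (g ` cbox u v) = 1 * Henstock_Kurzweil_Integration.content (cbox u v)" for u v
  proof (cases "cbox u v = {}")
    case False
    then have "u $ 1 \<le> v $ 1" "u $ 2 \<le> v $ 2" by (auto simp: interval_ne_empty_cart)
    then show ?thesis using False unfolding gbox by (simp add: content_Pair content_cbox_cart prod_2 UNIV_2)
  qed simp
  have "(F has_integral integral (cbox (a, c) (b, d)) F) (cbox (a, c) (b, d))"
    by (intro integrable_integral integrable_continuous assms)
  from has_integral_twiddle[OF zero_less_one hg gh _ _ _ cont this]
  have "((\<lambda>v. F (g v)) has_integral integral (cbox (a, c) (b, d)) F) (h ` cbox (a, c) (b, d))"
    using gbox hbox by (auto simp: g_def[abs_def] intro!: continuous_intros)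
  then show ?thesis
    unfolding hbox integral_prod_continuous[OF assms] by (simp add: g_def h_def)
qed

text \<open>The real-linear map \<open>w \<mapsto> w - k cnj w\<close> has determinant \<open>1 - \<bar>k\<bar>\<^sup>2\<close>.\<close>

lemma area_holomorphic_image_le:
  assumes hol: "K holomorphic_on U" "open U"
    and box: "\<And>x y. a \<le> x \<Longrightarrow> x \<le> b \<Longrightarrow> c \<le> y \<Longrightarrow> y \<le> d \<Longrightarrow> Complex x y \<in> U"
    and inj: "inj_on K {z. a < Re z \<and> Re z < b \<and> c < Im z \<and> Im z < d}"
    and k: "cmod k < 1" and \<rho>: "0 \<le> \<rho>"
    and bd: "\<And>z. a < Re z \<Longrightarrow> Re z < b \<Longrightarrow> c < Im z \<Longrightarrow> Im z < d \<Longrightarrow> cmod (K z - k * cnj (K z)) < \<rho>"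
  shows "(1 - (cmod k)\<^sup>2) * integral {a..b} (\<lambda>x. integral {c..d} (\<lambda>y. (cmod (deriv K (Complex x y)))\<^sup>2)) \<le> pi * \<rho>\<^sup>2"
proof -
  define C where "C v = Complex (v $ 1) (v $ 2)" for v :: "real^2"
  define V where "V z = (vector [Re z, Im z] :: real^2)" for z
  define \<Lambda> where "\<Lambda> w = w - k * cnj w" for w
  define f where "f v = V (\<Lambda> (K (C v)))" for v
  define f' where "f' v w = V (\<Lambda> (deriv K (C v) * C w))" for v w
  define S where "S = box (vector [a, c]) (vector [b, d] :: real^2)"

  have linC: "bounded_linear C"
    unfolding linear_conv_bounded_linear[symmetric] by (intro linearI) (auto simp: C_def complex_eq_iff)
  have linV: "bounded_linear V"
    unfolding linear_conv_bounded_linear[symmetric] by (intro linearI) (auto simp: V_def vec_eq_iff forall_2)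
  have lin\<Lambda>: "bounded_linear \<Lambda>" unfolding \<Lambda>_def
    by (intro bounded_linear_sub bounded_linear_ident bounded_linear_const_mult bounded_linear_cnj)
  have CV: "C (V z) = z" for z by (simp add: C_def V_def)
  have VC: "V (C v) = v" for v by (simp add: C_def V_def vec_eq_iff forall_2)
  have normV: "norm (V z) = cmod z" for z
    by (simp add: V_def norm_vec_def L2_set_def sum_2 cmod_def)
  have Sb: "v \<in> S \<longleftrightarrow> a < Re (C v) \<and> Re (C v) < b \<and> c < Im (C v) \<and> Im (C v) < d" for v
    by (auto simp: S_def mem_box_cart forall_2 C_def)
  have inU: "C v \<in> U" if "v \<in> S" for v using box that unfolding Sb by (auto simp: C_def)
  have der: "(f has_derivative f' v) (at v within S)" if "v \<in> S" for v
  proof -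
    have "(K has_derivative (*) (deriv K (C v))) (at (C v))"
      using holomorphic_derivI[OF hol inU[OF that]] by (simp add: has_field_derivative_def)
    moreover have "(C has_derivative C) (at v)" by (rule bounded_linear_imp_has_derivative[OF linC])
    ultimately have "((\<lambda>v. K (C v)) has_derivative (\<lambda>w. deriv K (C v) * C w)) (at v)"
      using has_derivative_compose by blast
    then have "((\<lambda>v. \<Lambda> (K (C v))) has_derivative (\<lambda>w. \<Lambda> (deriv K (C v) * C w))) (at v)"
      by (rule bounded_linear.has_derivative[OF lin\<Lambda>])
    then have "((\<lambda>v. V (\<Lambda> (K (C v)))) has_derivative (\<lambda>w. V (\<Lambda> (deriv K (C v) * C w)))) (at v)"
      by (rule bounded_linear.has_derivative[OF linV])
    then show ?thesis unfolding f_def f'_def by (rule has_derivative_at_withinI)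
  qed
  have inj\<Lambda>: "w = 0" if "\<Lambda> w = 0" for w
  proof (rule ccontr)
    assume "w \<noteq> 0"
    have "cmod w = cmod (k * cnj w)" using that by (simp add: \<Lambda>_def)
    then have "cmod w = cmod k * cmod w" by (simp add: norm_mult)
    then show False using \<open>w \<noteq> 0\<close> k by simp
  qed
  have injf: "inj_on f S"
  proof (rule inj_onI)
    fix v w assume vw: "v \<in> S" "w \<in> S" "f v = f w"
    then have "\<Lambda> (K (C v)) = \<Lambda> (K (C w))" unfolding f_def using CV by metis
    then have "\<Lambda> (K (C v) - K (C w)) = 0" by (simp add: \<Lambda>_def algebra_simps)
    then have "K (C v) = K (C w)" using inj\<Lambda> by force
    then have "C v = C w" using inj vw unfolding Sb inj_on_def by blast
    then show "v = w" using VC by metis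
  qed
  have det: "det (matrix (f' v)) = (1 - (cmod k)\<^sup>2) * (cmod (deriv K (C v)))\<^sup>2" for v
  proof -
    obtain p1 p2 where p: "deriv K (C v) = Complex p1 p2" by (cases "deriv K (C v)")
    obtain k1 k2 where kk: "k = Complex k1 k2" by (cases k)
    have C1: "C (axis 1 1) = 1" "C (axis 2 1) = \<i>" by (simp_all add: C_def axis_def complex_eq_iff)
    show ?thesis
      by (simp add: det_2 matrix_def f'_def C1 V_def \<Lambda>_def p kk cmod_power2)
        (simp add: power2_eq_square algebra_simps)
  qed
  define F where "F p = (1 - (cmod k)\<^sup>2) * (cmod (deriv K (Complex (fst p) (snd p))))\<^sup>2" for p :: "real \<times> real"
  have dK: "continuous_on U (deriv K)"
    by (intro holomorphic_on_imp_continuous_on holomorphic_deriv hol)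
  have cF: "continuous_on (cbox (a, c) (b, d)) F"
  proof -
    have "continuous_on (cbox (a, c) (b, d)) (\<lambda>p. deriv K (Complex (fst p) (snd p)))"
    proof (rule continuous_on_compose2[OF dK])
      show "continuous_on (cbox (a, c) (b, d)) (\<lambda>p. Complex (fst p) (snd p))"
        unfolding complex_eq by (intro continuous_intros)
    qed (use box in auto)
    then show ?thesis unfolding F_def by (intro continuous_intros)
  qed
  define I where "I = integral {a..b} (\<lambda>x. integral {c..d} (\<lambda>y. F (x, y)))"
  have k2: "(cmod k)\<^sup>2 < 1" using k by (simp add: abs_square_less_1)
  have "((\<lambda>v. \<bar>det (matrix (f' v))\<bar>) has_integral I) S"
    using has_integral_plane[OF cF] k2
    unfolding S_def has_integral_open_interval det I_def by (simp add: F_def C_def abs_mult)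
  then have mS: "f ` S \<in> lmeasurable \<and> measure lebesgue (f ` S) = I"
    using has_measure_differentiable_image[of S f f' I] der injf by (simp add: S_def)
  have "f ` S \<subseteq> ball 0 \<rho>"
    using bd unfolding f_def by (auto simp: normV \<Lambda>_def Sb)
  then have "measure lebesgue (f ` S) \<le> measure lebesgue (ball (0 :: real^2) \<rho>)"
    using mS by (intro measure_mono_fmeasurable lmeasurable_ball) (auto dest: fmeasurableD)
  also have "\<dots> = pi * \<rho>\<^sup>2"
    using circle_area[OF \<rho>, of "0 :: real^2"] by (simp add: mult.commute)
  finally have "I \<le> pi * \<rho>\<^sup>2" using mS by simp
  then show ?thesis by (simp add: I_def F_def)
qed

text \<open>By Parseval the integral is 2 \<pi> times the sum of all squared moduli of the
  coefficients on the circle of radius t; only the terms of index 0 and 2 are kept.\<close>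

lemma integral_circle_ge:
  assumes e: "e holomorphic_on ball 0 R" and t: "0 < t" "t < R"
    and \<Psi>: "\<And>z. z \<in> ball 0 R \<Longrightarrow> \<Psi> z = A + B * z\<^sup>2 + z^3 * e z"
  shows "2 * pi * ((cmod A)\<^sup>2 + (cmod B)\<^sup>2 * t^4) \<le> integral {0..2 * pi} (\<lambda>y. (cmod (\<Psi> (of_real t * cis y)))\<^sup>2)"
proof -
  have hol: "\<Psi> holomorphic_on ball 0 R"
  proof -
    have "(\<lambda>z. A + B * z\<^sup>2 + z^3 * e z) holomorphic_on ball 0 R" using e by (intro holomorphic_intros)
    then show ?thesis by (rule holomorphic_transform) (simp add: \<Psi>)
  qed
  define f where "f z = \<Psi> (of_real t * z)" for z
  define r where "r = R / t"
  have r: "1 < r" using t by (simp add: r_def)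
  have tz: "of_real t * z \<in> ball 0 R" if "z \<in> ball 0 r" for z :: complex
    using that t by (simp add: r_def norm_mult pos_less_divide_eq mult.commute)
  have fh: "f holomorphic_on ball 0 r"
    unfolding f_def[abs_def] by (rule holomorphic_scale[OF hol tz])
  define a where "a n = fps_nth (fps_expansion f 0) n" for n
  have \<Psi>fps: "fps_nth (fps_expansion \<Psi> 0) 0 = A" "fps_nth (fps_expansion \<Psi> 0) 2 = B"
  proof -
    have R: "0 < R" using t by simp
    have "e has_fps_expansion fps_expansion e 0" using e R by (intro has_fps_expansion_fps_expansion[of "ball 0 R"]) auto
    then have "(\<lambda>z. A + B * z\<^sup>2 + z^3 * e z) has_fps_expansion
        (fps_const A + fps_const B * fps_X\<^sup>2 + fps_X^3 * fps_expansion e 0)"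
      by (intro fps_expansion_intros)
    then have 1: "fps_expansion (\<lambda>z. A + B * z\<^sup>2 + z^3 * e z) 0 = fps_const A + fps_const B * fps_X\<^sup>2 + fps_X^3 * fps_expansion e 0"
      by (rule fps_expansion_eqI)
    have 2: "fps_expansion \<Psi> 0 = fps_const A + fps_const B * fps_X\<^sup>2 + fps_X^3 * fps_expansion e 0"
      using fps_expansion_cong_ball[OF R \<Psi>] 1 by simp
    show "fps_nth (fps_expansion \<Psi> 0) 0 = A" "fps_nth (fps_expansion \<Psi> 0) 2 = B"
      unfolding 2 by (simp_all add: fps_X_power_mult_nth fps_X_power_nth)
  qed
  have a: "a 0 = A" "a 2 = B * (of_real t)\<^sup>2"
    unfolding a_def f_def using fps_expansion_scale[OF hol, of "of_real t"] t \<Psi>fps by simp_all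
  have *: "integral {0..2 * pi} (\<lambda>t. cis (of_int (1 * int n) * t) * cnj (f (cis t))) = 2 * pi * cnj (a n)" for n
  proof -
    have "integral {0..2 * pi} (\<lambda>t. cnj (cis (of_int (- int n) * t) * f (cis t)))
      = cnj (integral {0..2 * pi} (\<lambda>t. cis (of_int (- int n) * t) * f (cis t)))"
      by (rule integral_cnj[symmetric])
    also have "integral {0..2 * pi} (\<lambda>t. cis (of_int (- int n) * t) * f (cis t)) = 2 * pi * a n"
      using fourier_coeff_circle[OF fh r, of 1 "- int n"] by (simp add: mult.commute a_def)
    finally show ?thesis by (simp add: cis_cnj)
  qed
  have cf: "continuous_on {0..2 * pi} (\<lambda>t. f (cis t))" using continuous_on_circle[OF fh r, of _ 1] by simp
  have "(\<lambda>n. a n * (2 * pi * cnj (a n))) sums integral {0..2 * pi} (\<lambda>t. f (cis t) * cnj (f (cis t)))"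
    using fps_expansion_circle_sums[OF fh r, of "\<lambda>t. cnj (f (cis t))" 1] cf
    unfolding * by (simp add: a_def continuous_on_cnj)
  then have "(\<lambda>n. Re (a n * (2 * pi * cnj (a n)))) sums Re (integral {0..2 * pi} (\<lambda>t. f (cis t) * cnj (f (cis t))))"
    by (rule sums_Re)
  moreover have "Re (a n * (2 * pi * cnj (a n))) = 2 * pi * (cmod (a n))\<^sup>2" for n
    unfolding cmod_power2 by (simp add: power2_eq_square algebra_simps)
  moreover have "Re (integral {0..2 * pi} (\<lambda>t. f (cis t) * cnj (f (cis t)))) = integral {0..2 * pi} (\<lambda>y. (cmod (f (cis y)))\<^sup>2)"
  proof -
    have "(\<lambda>t. f (cis t) * cnj (f (cis t))) integrable_on {0..2 * pi}"
      by (intro integrable_continuous_interval continuous_intros cf)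
    from integral_linear[OF this bounded_linear_Re] show ?thesis
      by (simp add: o_def complex_mult_cnj cmod_power2)
  qed
  ultimately have s: "(\<lambda>n. 2 * pi * (cmod (a n))\<^sup>2) sums integral {0..2 * pi} (\<lambda>y. (cmod (f (cis y)))\<^sup>2)" by simp
  have "(\<Sum>n\<in>{0, 2}. 2 * pi * (cmod (a n))\<^sup>2) \<le> (\<Sum>n. 2 * pi * (cmod (a n))\<^sup>2)"
    using s by (intro sum_le_suminf) (auto simp: sums_iff)
  then show ?thesis using s t unfolding sums_iff
    by (simp add: a f_def norm_mult norm_power power_mult_distrib algebra_simps flip: power_mult)
qed

lemma holomorphic_taylor2:
  assumes "f holomorphic_on ball 0 R"
  obtains e where "e holomorphic_on ball 0 R" "\<And>z. z \<in> ball 0 R \<Longrightarrow> f z = f 0 + deriv f 0 * z + z\<^sup>2 * e z"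
proof -
  have "(\<lambda>z. f z - f 0) holomorphic_on ball 0 R" using assms by (intro holomorphic_intros)
  then obtain g where g: "g holomorphic_on ball 0 R" "\<And>z. cmod z < R \<Longrightarrow> f z - f 0 = z * g z"
    "deriv (\<lambda>z. f z - f 0) 0 = g 0"
    using Schwarz3[of "\<lambda>z. f z - f 0" R] by auto
  have "(\<lambda>z. g z - g 0) holomorphic_on ball 0 R" using g by (intro holomorphic_intros)
  then obtain e where e: "e holomorphic_on ball 0 R" "\<And>z. cmod z < R \<Longrightarrow> g z - g 0 = z * e z"
    using Schwarz3[of "\<lambda>z. g z - g 0" R] by auto
  show thesis
  proof (cases "0 < R")
    case True
    have "(f has_field_derivative deriv f 0) (at 0)" using assms True by (simp add: holomorphic_derivI)
    then have "((\<lambda>z. f z - f 0) has_field_derivative deriv f 0 - 0) (at 0)"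
      by (intro DERIV_diff DERIV_const)
    then have g0: "g 0 = deriv f 0" using g(3) by (simp add: DERIV_imp_deriv)
    have "f z = f 0 + deriv f 0 * z + z\<^sup>2 * e z" if "z \<in> ball 0 R" for z
    proof -
      have "f z = f 0 + z * g z" using g(2)[of z] that by (simp add: algebra_simps)
      moreover have "g z = g 0 + z * e z" using e(2)[of z] that by (simp add: algebra_simps)
      ultimately show ?thesis by (simp add: g0 power2_eq_square algebra_simps)
    qed
    then show thesis using that e(1) by blast
  next
    case False
    then have "\<not> cmod z < R" for z using norm_ge_zero[of z] by linarith
    then show thesis using that[of e] e(1) by auto
  qed
qed

lemma complex_exp_inj:
  assumes "exp z = exp w" "\<bar>Im z - Im w\<bar> < 2 * pi"
  shows "z = w"
proof -
  obtain n :: int where n: "z = w + of_int (2 * n) * pi * \<i>" using assms(1) by (auto simp: exp_eq)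
  then have "\<bar>of_int n * (2 * pi)\<bar> < 1 * (2 * pi)" using assms(2) by (simp add: mult_ac)
  then have "\<bar>of_int n :: real\<bar> < 1" unfolding abs_mult by simp
  then have "n = 0" by linarith
  then show ?thesis using n by simp
qed

text \<open>The divergent terms 1/\<epsilon>^2 of both sides cancel. The remainder is continuous in
  \<epsilon>, and its value B \<rho>^2 - 1/\<rho>^2 at 0 must be nonpositive.\<close>

lemma area_theorem_limit:
  fixes B \<rho> C \<epsilon>0 :: real
  assumes \<rho>: "0 < \<rho>" and \<epsilon>0: "0 < \<epsilon>0"
    and le: "\<And>\<epsilon>. 0 < \<epsilon> \<Longrightarrow> \<epsilon> < \<epsilon>0 \<Longrightarrow>
      (1 - B * \<epsilon>^4) * (1 / \<epsilon>\<^sup>2 - 1 / \<rho>\<^sup>2 + B * (\<rho>\<^sup>2 - \<epsilon>\<^sup>2)) \<le> (1 / \<epsilon> + C * \<epsilon>^3)\<^sup>2"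
  shows "B * \<rho>^4 \<le> 1"
proof -
  define \<phi> where "\<phi> \<epsilon> = - B * \<epsilon>\<^sup>2 + (1 - B * \<epsilon>^4) * (B * (\<rho>\<^sup>2 - \<epsilon>\<^sup>2) - 1 / \<rho>\<^sup>2) - 2 * C * \<epsilon>\<^sup>2 - C\<^sup>2 * \<epsilon>^6" for \<epsilon>
  have "\<phi> \<epsilon> \<le> 0" if "0 < \<epsilon>" "\<epsilon> < \<epsilon>0" for \<epsilon>
  proof -
    have "(1 - B * \<epsilon>^4) * (1 / \<epsilon>\<^sup>2) = 1 / \<epsilon>\<^sup>2 - B * \<epsilon>\<^sup>2"
      using that by (simp add: field_simps eval_nat_numeral)
    moreover have "(1 / \<epsilon> + C * \<epsilon>^3)\<^sup>2 = 1 / \<epsilon>\<^sup>2 + 2 * C * \<epsilon>\<^sup>2 + C\<^sup>2 * \<epsilon>^6"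
      using that by (simp add: field_simps eval_nat_numeral)
    moreover have "(1 - B * \<epsilon>^4) * (1 / \<epsilon>\<^sup>2 - 1 / \<rho>\<^sup>2 + B * (\<rho>\<^sup>2 - \<epsilon>\<^sup>2)) =
       (1 - B * \<epsilon>^4) * (1 / \<epsilon>\<^sup>2) + (1 - B * \<epsilon>^4) * (B * (\<rho>\<^sup>2 - \<epsilon>\<^sup>2) - 1 / \<rho>\<^sup>2)"
      by (simp only: distrib_left[symmetric]) simp
    ultimately show ?thesis using le[OF that] unfolding \<phi>_def by linarith
  qed
  then have "eventually (\<lambda>\<epsilon>. \<phi> \<epsilon> \<le> 0) (at_right 0)"
    using \<epsilon>0 unfolding eventually_at_right_field by blast
  moreover have "(\<phi> \<longlongrightarrow> \<phi> 0) (at_right 0)"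
    unfolding \<phi>_def by (intro tendsto_intros)
  ultimately have "\<phi> 0 \<le> 0" by (intro tendsto_upperbound) auto
  then have "B * \<rho>\<^sup>2 \<le> 1 / \<rho>\<^sup>2" by (simp add: \<phi>_def)
  then have "B * \<rho>\<^sup>2 * \<rho>\<^sup>2 \<le> 1" using \<rho> by (simp add: field_simps)
  then show ?thesis by (simp add: eval_nat_numeral mult.assoc)
qed

text \<open>Gronwall's area theorem for \<open>k(z) = u(z)/z\<close>, applied to the image of the annulus
  \<open>\<epsilon> < \<bar>z\<bar> < \<rho>\<close> in logarithmic coordinates. That image lies in an ellipse of area
  \<open>\<pi> (1/\<epsilon>\<^sup>2 + o(1))\<close>, since \<open>k(z) - \<beta> \<epsilon>\<^sup>2 cnj (k(z))\<close> is nearly \<open>1/z\<close> on the circle \<open>\<bar>z\<bar> = \<epsilon>\<close>.\<close>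

lemma area_theorem_odd:
  fixes U :: "complex \<Rightarrow> complex"
  assumes U: "U holomorphic_on ball 0 1" and U0: "U 0 = 1" and Unz: "\<And>z. z \<in> ball 0 1 \<Longrightarrow> U z \<noteq> 0"
    and inj: "inj_on (\<lambda>z. z / U (z\<^sup>2)) (ball 0 1)"
  shows "cmod (deriv U 0) \<le> 1"
proof -
  define \<beta> where "\<beta> = deriv U 0"
  define B where "B = (cmod \<beta>)\<^sup>2"
  have sq: "z\<^sup>2 \<in> ball 0 1" if "z \<in> ball 0 1" for z :: complex
    using that by (simp add: norm_power abs_square_less_1)
  obtain E where E: "E holomorphic_on ball 0 1" "\<And>z. z \<in> ball 0 1 \<Longrightarrow> U z = 1 + \<beta> * z + z\<^sup>2 * E z"
    using holomorphic_taylor2[OF U] unfolding U0 \<beta>_def by blast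
  \<comment> \<open>In logarithmic coordinates the derivative of k is z k'(z) = - V (z^2)/z, so the
    coefficients of V measure the area.\<close>
  define V where "V w = U w - 2 * w * deriv U w" for w
  have Vh: "V holomorphic_on ball 0 1" unfolding V_def[abs_def] using U by (intro holomorphic_intros) auto
  have V0: "V 0 = 1" "deriv V 0 = - \<beta>"
  proof -
    have "(U has_field_derivative deriv U 0) (at 0)" "(deriv U has_field_derivative deriv (deriv U) 0) (at 0)"
      using U by (auto intro!: holomorphic_derivI[of _ "ball 0 1"] holomorphic_deriv)
    then have "(V has_field_derivative (- \<beta>)) (at 0)"
      unfolding V_def \<beta>_def by (auto intro!: derivative_eq_intros)
    then show "deriv V 0 = - \<beta>" by (rule DERIV_imp_deriv)
  qed (simp add: V_def U0)
  obtain e where e: "e holomorphic_on ball 0 1" "\<And>z. z \<in> ball 0 1 \<Longrightarrow> V z = 1 - \<beta> * z + z\<^sup>2 * e z"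
    using holomorphic_taylor2[OF Vh] unfolding V0 by (metis diff_conv_add_uminus mult_minus_left)
  have sqh: "(\<lambda>z. F (z\<^sup>2)) holomorphic_on ball 0 1" if "F holomorphic_on ball 0 1" for F :: "complex \<Rightarrow> complex"
    using holomorphic_on_compose_gen[of "\<lambda>z. z\<^sup>2" "ball 0 1" F "ball 0 1"] that sq
    by (simp add: o_def image_subset_iff holomorphic_intros del: mem_ball)
  define h where "h z = z / U (z\<^sup>2)" for z
  have hh: "h holomorphic_on ball 0 1"
    unfolding h_def[abs_def] using sqh[OF U] Unz[OF sq] by (intro holomorphic_intros) auto
  have hinj: "inj_on h (ball 0 1)" using inj by (simp add: h_def[abs_def])
  define k where "k z = U (z\<^sup>2) / z" for z
  have hk: "k z = 1 / h z" for z by (simp add: h_def k_def)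
  define K where "K \<zeta> = k (exp \<zeta>)" for \<zeta>
  define H where "H = {\<zeta>::complex. Re \<zeta> < 0}"
  have expH: "exp \<zeta> \<in> ball 0 1" if "\<zeta> \<in> H" for \<zeta> using that by (simp add: H_def)
  have Hop: "open H" unfolding H_def by (rule open_halfspace_Re_lt)
  have dK: "(K has_field_derivative - (V ((exp \<zeta>)\<^sup>2) / exp \<zeta>)) (at \<zeta>)" if "\<zeta> \<in> H" for \<zeta>
  proof -
    have "(U has_field_derivative deriv U ((exp \<zeta>)\<^sup>2)) (at ((exp \<zeta>)\<^sup>2))"
      using U sq[OF expH[OF that]] by (simp add: holomorphic_derivI)
    moreover have "((\<lambda>z. (exp z)\<^sup>2) has_field_derivative 2 * (exp \<zeta>)\<^sup>2) (at \<zeta>)"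
      by (auto intro!: derivative_eq_intros simp: power2_eq_square)
    ultimately have "((\<lambda>z. U ((exp z)\<^sup>2)) has_field_derivative deriv U ((exp \<zeta>)\<^sup>2) * (2 * (exp \<zeta>)\<^sup>2)) (at \<zeta>)"
      by (rule DERIV_chain2)
    then have "((\<lambda>z. U ((exp z)\<^sup>2) * exp (- z)) has_field_derivative
        deriv U ((exp \<zeta>)\<^sup>2) * (2 * (exp \<zeta>)\<^sup>2) * exp (- \<zeta>) + - exp (- \<zeta>) * U ((exp \<zeta>)\<^sup>2)) (at \<zeta>)"
      by (intro DERIV_mult) (auto intro!: derivative_eq_intros)
    moreover have "(\<lambda>z. U ((exp z)\<^sup>2) * exp (- z)) = K" by (auto simp: K_def k_def exp_minus field_simps)
    moreover have "deriv U ((exp \<zeta>)\<^sup>2) * (2 * (exp \<zeta>)\<^sup>2) * exp (- \<zeta>) + - exp (- \<zeta>) * U ((exp \<zeta>)\<^sup>2) =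
       - (V ((exp \<zeta>)\<^sup>2) / exp \<zeta>)"
      unfolding V_def exp_minus divide_inverse by (simp add: algebra_simps)
    ultimately show ?thesis by simp
  qed
  then have Kh: "K holomorphic_on H" by (auto simp: holomorphic_on_open[OF Hop])
  have absdK: "(cmod (deriv K (Complex x y)))\<^sup>2 = exp (- 2 * x) * (cmod (V ((of_real (exp x) * cis y)\<^sup>2)))\<^sup>2"
    if "x < 0" for x y
  proof -
    have "Complex x y \<in> H" using that by (simp add: H_def)
    have e: "exp (Complex x y) = of_real (exp x) * cis y" by (simp add: exp_eq_polar)
    have "cmod (deriv K (Complex x y)) = cmod (V ((of_real (exp x) * cis y)\<^sup>2)) / exp x"
      unfolding DERIV_imp_deriv[OF dK[OF \<open>Complex x y \<in> H\<close>]] e norm_minus_cancel norm_divide norm_mult norm_of_real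
      by simp
    moreover have "(c / exp x)\<^sup>2 = exp (- 2 * x) * c\<^sup>2" for c :: real
    proof -
      have "exp (- 2 * x) = 1 / (exp x)\<^sup>2" using exp_double[of x] by (simp add: exp_minus inverse_eq_divide)
      then show ?thesis by (simp add: power_divide)
    qed
    ultimately show ?thesis by simp
  qed
  have "compact (E ` cball 0 (1/4))"
    by (intro compact_continuous_image continuous_on_subset[OF holomorphic_on_imp_continuous_on[OF E(1)]]) auto
  then have "bounded (E ` cball 0 (1/4))" by (rule compact_imp_bounded)
  then obtain C where "\<forall>x\<in>E ` cball 0 (1/4). cmod x \<le> C" unfolding bounded_iff by blast
  then have C: "cmod (E z) \<le> C" if "cmod z \<le> 1/4" for z using that by auto
  have C0: "0 \<le> C" using order_trans[OF norm_ge_zero C[of 0]] by simp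
  \<comment> \<open>The summands bound the error terms of order \<epsilon>^3 on the small circle: d,
    then \<kappa> cnj (\<beta> z), then \<kappa> cnj d. The final 1 makes the inequality
    strict.\<close>
  define C1 where "C1 = C + B + cmod \<beta> * C + 1"
  have C1: "0 < C1" using C0 by (simp add: C1_def B_def add_nonneg_pos)
  define \<epsilon>0 where "\<epsilon>0 = 1 / (2 * (cmod \<beta> + 1))"
  have b1: "0 < cmod \<beta> + 1" by (simp add: add_nonneg_pos)
  have \<epsilon>0: "0 < \<epsilon>0" "\<epsilon>0 \<le> 1/2" "cmod \<beta> * \<epsilon>0 < 1"
  proof -
    show "0 < \<epsilon>0" using b1 by (simp add: \<epsilon>0_def)
    show "\<epsilon>0 \<le> 1/2" unfolding \<epsilon>0_def by (intro divide_left_mono) (auto simp: add_nonneg_pos)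
    have "(cmod \<beta> + 1) * \<epsilon>0 = 1/2" using b1 by (simp add: \<epsilon>0_def)
    moreover have "cmod \<beta> * \<epsilon>0 \<le> (cmod \<beta> + 1) * \<epsilon>0" using \<open>0 < \<epsilon>0\<close> by simp
    ultimately show "cmod \<beta> * \<epsilon>0 < 1" by simp
  qed
  have main: "(1 - B * \<epsilon>^4) * (1 / \<epsilon>\<^sup>2 - 1 / \<rho>\<^sup>2 + B * (\<rho>\<^sup>2 - \<epsilon>\<^sup>2)) \<le> (1 / \<epsilon> + C1 * \<epsilon>^3)\<^sup>2"
    if \<rho>: "\<rho> < 1" and \<epsilon>: "0 < \<epsilon>" "\<epsilon> < min \<epsilon>0 \<rho>" for \<epsilon> \<rho>
  proof -
    have \<epsilon>1: "\<epsilon> < 1/2" "\<epsilon> < \<rho>" "\<epsilon> < 1" using \<epsilon> \<epsilon>0 by auto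
    \<comment> \<open>On \<bar>z\<bar> = \<epsilon> one has \<epsilon>^2 cnj (1/z) = z, so \<kappa>
      cnj (1/z) cancels the term \<beta> z of k.\<close>
    define \<kappa> where "\<kappa> = \<beta> * of_real (\<epsilon>\<^sup>2)"
    have n\<kappa>: "cmod \<kappa> = cmod \<beta> * \<epsilon>\<^sup>2" by (simp add: \<kappa>_def norm_mult norm_power)
    have \<kappa>: "cmod \<kappa> < 1"
    proof -
      have "\<epsilon>\<^sup>2 \<le> \<epsilon>" using \<epsilon> \<epsilon>1 by (simp add: power2_eq_square mult_left_le_one_le)
      also have "\<epsilon> \<le> \<epsilon>0" using \<epsilon> by simp
      finally have "cmod \<beta> * \<epsilon>\<^sup>2 \<le> cmod \<beta> * \<epsilon>0" by (intro mult_left_mono) auto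
      then show ?thesis using \<epsilon>0 n\<kappa> by simp
    qed
    define \<Lambda> where "\<Lambda> w = w - \<kappa> * cnj w" for w
    have circ: "cmod (\<Lambda> (k z)) < 1 / \<epsilon> + C1 * \<epsilon>^3" if z: "cmod z = \<epsilon>" for z
    proof -
      have z0: "z \<noteq> 0" using z \<epsilon> by auto
      have z2: "cmod (z\<^sup>2) \<le> 1/4"
      proof -
        have "cmod (z\<^sup>2) = (cmod z)\<^sup>2" by (rule norm_power)
        also have "\<dots> = \<epsilon> * \<epsilon>" by (simp add: z power2_eq_square)
        also have "\<dots> \<le> 1/2 * (1/2)" using \<epsilon> \<epsilon>1 by (intro mult_mono) auto
        finally show ?thesis by simp
      qed
      define d where "d = z^3 * E (z\<^sup>2)"
      have kz: "k z = 1 / z + \<beta> * z + d"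
      proof -
        have "U (z\<^sup>2) = 1 + \<beta> * z\<^sup>2 + (z\<^sup>2)\<^sup>2 * E (z\<^sup>2)" using z \<epsilon>1 by (intro E(2) sq) simp
        then show ?thesis using z0 by (simp add: k_def d_def field_simps eval_nat_numeral)
      qed
      have "of_real (\<epsilon>\<^sup>2) = z * cnj z" using complex_norm_square[of z] z by simp
      then have c: "of_real (\<epsilon>\<^sup>2) * cnj (1 / z) = z" using z0 by (simp add: field_simps)
      have "\<Lambda> (k z) = 1 / z + \<beta> * z + d - \<beta> * (of_real (\<epsilon>\<^sup>2) * cnj (1 / z)) - \<kappa> * cnj (\<beta> * z) - \<kappa> * cnj d"
        unfolding \<Lambda>_def kz \<kappa>_def by (simp add: algebra_simps)
      also have "\<dots> = 1 / z + d - \<kappa> * cnj (\<beta> * z) - \<kappa> * cnj d" unfolding c by simp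
      finally have L: "\<Lambda> (k z) = 1 / z + d - \<kappa> * cnj (\<beta> * z) - \<kappa> * cnj d" .
      have nd: "cmod d \<le> C * \<epsilon>^3"
        using C[OF z2] \<epsilon> by (simp add: d_def norm_mult norm_power z mult.commute[of C] mult_left_mono)
      have t1: "cmod (1 / z) = 1 / \<epsilon>" by (simp add: norm_divide z)
      have t2: "cmod (\<kappa> * cnj (\<beta> * z)) = B * \<epsilon>^3"
        by (simp add: norm_mult n\<kappa> z B_def eval_nat_numeral mult_ac)
      have t3: "cmod (\<kappa> * cnj d) \<le> cmod \<beta> * C * \<epsilon>^3"
      proof -
        have "cmod (\<kappa> * cnj d) = cmod \<beta> * (\<epsilon>\<^sup>2 * cmod d)" by (simp add: norm_mult n\<kappa>)
        also have "\<dots> \<le> cmod \<beta> * (1 * (C * \<epsilon>^3))"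
          using nd \<epsilon> \<epsilon>1 by (intro mult_left_mono mult_mono) (auto simp: power_le_one)
        finally show ?thesis by (simp add: mult_ac)
      qed
      have "cmod (\<Lambda> (k z)) \<le> cmod (1 / z) + cmod d + cmod (\<kappa> * cnj (\<beta> * z)) + cmod (\<kappa> * cnj d)"
        unfolding L by (intro order_trans[OF norm_triangle_ineq4] add_right_mono norm_triangle_ineq)
      also have "\<dots> \<le> 1 / \<epsilon> + C * \<epsilon>^3 + B * \<epsilon>^3 + cmod \<beta> * C * \<epsilon>^3" using nd t1 t2 t3 by linarith
      also have "\<dots> < 1 / \<epsilon> + C1 * \<epsilon>^3" using \<epsilon> by (simp add: C1_def algebra_simps)
      finally show ?thesis .
    qed
    \<comment> \<open>The bound passes from the circle to the rest of the disc: the segment from 0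
      to h z crosses the image of the circle, which gives k z = s k \<zeta> with 0 < s \<le> 1, and
      \<Lambda> is real-linear.\<close>
    have out: "cmod (\<Lambda> (k z)) < 1 / \<epsilon> + C1 * \<epsilon>^3" if z: "\<epsilon> \<le> cmod z" "cmod z < 1" for z
    proof (cases "h z \<in> h ` ball 0 \<epsilon>")
      case True
      then obtain z' where z': "z' \<in> ball 0 \<epsilon>" "h z = h z'" by auto
      then have "z = z'" using hinj z \<epsilon>1 unfolding inj_on_def by auto
      then show ?thesis using z z' by simp
    next
      case False
      obtain s \<zeta> where s: "0 < s" "s \<le> 1" "cmod \<zeta> = \<epsilon>" "h \<zeta> = of_real s * h z"
        using ray_meets_circle_image[OF hh hinj _ \<epsilon>(1) \<epsilon>1(3) False] by (auto simp: h_def)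
      have "k z = of_real s * k \<zeta>" using s by (simp add: hk)
      then have "\<Lambda> (k z) = of_real s * \<Lambda> (k \<zeta>)" by (simp add: \<Lambda>_def algebra_simps)
      then have "cmod (\<Lambda> (k z)) = s * cmod (\<Lambda> (k \<zeta>))" using s by (simp add: norm_mult)
      also have "\<dots> \<le> cmod (\<Lambda> (k \<zeta>))" using s by (simp add: mult_left_le_one_le)
      also have "\<dots> < 1 / \<epsilon> + C1 * \<epsilon>^3" by (rule circ[OF s(3)])
      finally show ?thesis .
    qed
    define a b where "a = ln \<epsilon>" and "b = ln \<rho>"
    have \<rho>0: "0 < \<rho>" using \<epsilon> \<epsilon>1 by simp
    have ab: "a < b" "b < 0" "exp a = \<epsilon>" "exp b = \<rho>" using \<epsilon> \<epsilon>1 \<rho> \<rho>0 by (auto simp: a_def b_def)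
    define J where "J x = integral {0..2 * pi} (\<lambda>y. (cmod (deriv K (Complex x y)))\<^sup>2)" for x
    have area: "(1 - (cmod \<kappa>)\<^sup>2) * integral {a..b} J \<le> pi * (1 / \<epsilon> + C1 * \<epsilon>^3)\<^sup>2"
      unfolding J_def
    proof (rule area_holomorphic_image_le[OF Kh Hop _ _ \<kappa>])
      show "Complex x y \<in> H" if "x \<le> b" for x y using that ab by (simp add: H_def)
      show "inj_on K {z. a < Re z \<and> Re z < b \<and> 0 < Im z \<and> Im z < 2 * pi}"
      proof (rule inj_onI)
        fix z w assume z: "z \<in> {z. a < Re z \<and> Re z < b \<and> 0 < Im z \<and> Im z < 2 * pi}"
          and w: "w \<in> {z. a < Re z \<and> Re z < b \<and> 0 < Im z \<and> Im z < 2 * pi}" and eq: "K z = K w"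
        have zw: "exp z \<in> ball 0 1" "exp w \<in> ball 0 1" using z w ab by auto
        have "h (exp z) = h (exp w)" using eq by (simp add: K_def hk)
        then have "exp z = exp w" using hinj zw unfolding inj_on_def by blast
        moreover have "\<bar>Im z - Im w\<bar> < 2 * pi" using z w by auto
        ultimately show "z = w" by (rule complex_exp_inj)
      qed
      show "cmod (K z - \<kappa> * cnj (K z)) < 1 / \<epsilon> + C1 * \<epsilon>^3" if "a < Re z" "Re z < b" for z
      proof -
        have "exp a < exp (Re z)" "exp (Re z) < exp 0" using that ab by (auto simp del: exp_zero)
        then show ?thesis using out[of "exp z"] ab by (simp add: K_def \<Lambda>_def)
      qed
    qed (use \<epsilon> C1 in auto)
    have Jlow: "2 * pi * (exp (- 2 * x) + B * exp (2 * x)) \<le> J x" if "x \<in> {a..b}" for x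
    proof -
      have x: "x < 0" using that ab by simp
      have "2 * pi * ((cmod 1)\<^sup>2 + (cmod (- \<beta>))\<^sup>2 * (exp x)^4) \<le>
         integral {0..2 * pi} (\<lambda>y. (cmod (V ((of_real (exp x) * cis y)\<^sup>2)))\<^sup>2)"
      proof (rule integral_circle_ge)
        show "(\<lambda>z. z * e (z\<^sup>2)) holomorphic_on ball 0 1" using sqh[OF e(1)] by (intro holomorphic_intros)
        show "V (z\<^sup>2) = 1 + - \<beta> * z\<^sup>2 + z^3 * (z * e (z\<^sup>2))" if "z \<in> ball 0 1" for z
          using e(2)[OF sq[OF that]] by (simp add: eval_nat_numeral)
      qed (use x in auto)
      then have "exp (- 2 * x) * (2 * pi * (1 + B * (exp x)^4)) \<le>
        exp (- 2 * x) * integral {0..2 * pi} (\<lambda>y. (cmod (V ((of_real (exp x) * cis y)\<^sup>2)))\<^sup>2)"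
        by (intro mult_left_mono) (auto simp: B_def)
      also have "\<dots> = J x" unfolding J_def absdK[OF x] by simp
      also have "exp (- 2 * x) * (2 * pi * (1 + B * (exp x)^4)) = 2 * pi * (exp (- 2 * x) + B * exp (2 * x))"
      proof -
        have "exp (- 2 * x) * (exp x)^4 = exp (2 * x)"
          by (simp add: exp_of_nat_mult[symmetric] exp_add[symmetric])
        then show ?thesis by (simp add: algebra_simps)
      qed
      finally show ?thesis .
    qed
    have low: "((\<lambda>x. 2 * pi * (exp (- 2 * x) + B * exp (2 * x))) has_integral
      pi * (1 / \<epsilon>\<^sup>2 - 1 / \<rho>\<^sup>2 + B * (\<rho>\<^sup>2 - \<epsilon>\<^sup>2))) {a..b}"
    proof -
      define F where "F x = pi * (B * exp (2 * x) - exp (- 2 * x))" for x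
      have "((\<lambda>x. 2 * pi * (exp (- 2 * x) + B * exp (2 * x))) has_integral (F b - F a)) {a..b}"
      proof -
        have "(F has_vector_derivative 2 * pi * (exp (- 2 * x) + B * exp (2 * x))) (at x within {a..b})" for x
          unfolding F_def has_real_derivative_iff_has_vector_derivative[symmetric]
          by (auto intro!: derivative_eq_intros simp: algebra_simps)
        then show ?thesis using ab by (intro fundamental_theorem_of_calculus) auto
      qed
      moreover have "exp (2 * x) = (exp x)\<^sup>2" "exp (- 2 * x) = 1 / (exp x)\<^sup>2" for x :: real
        by (simp_all add: exp_double exp_minus inverse_eq_divide)
      then have "F b - F a = pi * (1 / \<epsilon>\<^sup>2 - 1 / \<rho>\<^sup>2 + B * (\<rho>\<^sup>2 - \<epsilon>\<^sup>2))"
        unfolding F_def using ab by (simp add: algebra_simps)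
      ultimately show ?thesis by simp
    qed
    have Jint: "J integrable_on {a..b}"
    proof -
      have "continuous_on ({a..b} \<times> cbox 0 (2 * pi)) (\<lambda>p. deriv K (Complex (fst p) (snd p)))"
      proof (rule continuous_on_compose2[of H "deriv K"])
        show "continuous_on H (deriv K)"
          by (intro holomorphic_on_imp_continuous_on holomorphic_deriv Kh Hop)
        show "continuous_on ({a..b} \<times> cbox 0 (2 * pi)) (\<lambda>p. Complex (fst p) (snd p))"
          unfolding complex_eq by (intro continuous_intros)
      qed (use ab in \<open>auto simp: H_def\<close>)
      then have "continuous_on ({a..b} \<times> cbox 0 (2 * pi)) (\<lambda>(x, y). (cmod (deriv K (Complex x y)))\<^sup>2)"
        by (simp add: case_prod_unfold continuous_intros)
      then have "continuous_on {a..b} J" unfolding J_def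
        using integral_continuous_on_param[of "{a..b}" 0 "2 * pi" "\<lambda>x y. (cmod (deriv K (Complex x y)))\<^sup>2"] by simp
      then show ?thesis by (rule integrable_continuous_interval)
    qed
    have "pi * (1 / \<epsilon>\<^sup>2 - 1 / \<rho>\<^sup>2 + B * (\<rho>\<^sup>2 - \<epsilon>\<^sup>2)) \<le> integral {a..b} J"
      by (rule has_integral_le[OF low integrable_integral[OF Jint] Jlow])
    then have "(1 - (cmod \<kappa>)\<^sup>2) * (pi * (1 / \<epsilon>\<^sup>2 - 1 / \<rho>\<^sup>2 + B * (\<rho>\<^sup>2 - \<epsilon>\<^sup>2))) \<le> (1 - (cmod \<kappa>)\<^sup>2) * integral {a..b} J"
      using \<kappa> by (intro mult_left_mono) (auto simp: abs_square_le_1 less_imp_le)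
    also note area
    also have "(1 - (cmod \<kappa>)\<^sup>2) = 1 - B * \<epsilon>^4"
      by (simp add: n\<kappa> B_def power_mult_distrib)
    finally have "pi * ((1 - B * \<epsilon>^4) * (1 / \<epsilon>\<^sup>2 - 1 / \<rho>\<^sup>2 + B * (\<rho>\<^sup>2 - \<epsilon>\<^sup>2))) \<le> pi * (1 / \<epsilon> + C1 * \<epsilon>^3)\<^sup>2"
      by (simp only: mult_ac)
    then show ?thesis by simp
  qed
  \<comment> \<open>At fixed \<rho> the inner radius \<epsilon> tends to 0; afterwards \<rho> tends
    to 1.\<close>
  have "B * \<rho>^4 \<le> 1" if "0 < \<rho>" "\<rho> < 1" for \<rho>
    by (rule area_theorem_limit[of \<rho> "min \<epsilon>0 \<rho>" B C1]) (use main that \<epsilon>0 in auto)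
  then have "eventually (\<lambda>\<rho>. B * \<rho>^4 \<le> 1) (at_left 1)"
    unfolding eventually_at_left_field by (intro exI[of _ 0]) auto
  moreover have "((\<lambda>\<rho>. B * \<rho>^4) \<longlongrightarrow> B * 1^4) (at_left 1)" by (intro tendsto_intros)
  ultimately have "B * 1^4 \<le> 1" by (intro tendsto_upperbound) auto
  then show ?thesis by (simp add: B_def \<beta>_def abs_square_le_1)
qed

subsection \<open>Univalent functions\<close>

lemma class_S_D:
  assumes "f \<in> class_S"
  shows "f holomorphic_on ball 0 1" "f 0 = 0" "deriv f 0 = 1" "inj_on f (ball 0 1)"
  using assms by (auto simp: class_S_def class_A_def)

text \<open>The square root transform z / U (z^2) of f is odd and univalent when U is the branch of
  (f z / z)^(- 1/2) with value 1 at 0. With a the second coefficient of f, U' is - a/2 at 0 and the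
  second derivative of f is 2 a.\<close>

theorem Bieberbach_second_coefficient:
  assumes f: "f \<in> class_S"
  shows "cmod (deriv (deriv f) 0) \<le> 4"
proof -
  note S = class_S_D[OF f]
  obtain q where q: "q holomorphic_on ball 0 1" "\<And>z. cmod z < 1 \<Longrightarrow> f z = z * q z" "deriv f 0 = q 0"
    using Schwarz3[OF S(1,2)] by blast
  have q0: "q 0 = 1" using q(3) S(3) by simp
  have qnz: "q z \<noteq> 0" if "z \<in> ball 0 1" for z
  proof
    assume "q z = 0"
    then have "f z = f 0" using q(2)[of z] that S(2) by simp
    then have "z = 0" using S(4) that unfolding inj_on_def by auto
    then show False using \<open>q z = 0\<close> q0 by simp
  qed
  obtain l where l: "l holomorphic_on ball 0 1" "\<And>z. z \<in> ball 0 1 \<Longrightarrow> exp (l z) = q z"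
    using holomorphic_logarithm_exists[OF convex_ball open_ball q(1) qnz, of 0] by auto
  define U where "U w = exp (- ((l w - l 0) / 2))" for w
  have Uh: "U holomorphic_on ball 0 1" unfolding U_def[abs_def] using l(1) by (intro holomorphic_intros) auto
  have U2: "(z / U (z\<^sup>2))\<^sup>2 = f (z\<^sup>2)" and z2: "cmod (z\<^sup>2) < 1" if "z \<in> ball 0 1" for z
  proof -
    show z2: "cmod (z\<^sup>2) < 1" using that by (simp add: norm_power abs_square_less_1)
    have two: "2 * (- (x / 2)) = - x" for x :: complex by simp
    have "(U (z\<^sup>2))\<^sup>2 = exp (- (l (z\<^sup>2) - l 0))"
      unfolding U_def exp_double[symmetric] two ..
    also have "\<dots> = exp (l 0) / exp (l (z\<^sup>2))" by (simp add: exp_diff)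
    also have "\<dots> = 1 / q (z\<^sup>2)" using l(2)[of 0] l(2)[of "z\<^sup>2"] z2 q0 by simp
    finally show "(z / U (z\<^sup>2))\<^sup>2 = f (z\<^sup>2)" using q(2)[OF z2] by (simp add: power_divide)
  qed
  have "inj_on (\<lambda>z. z / U (z\<^sup>2)) (ball 0 1)"
  proof (rule inj_onI)
    fix z w assume zw: "z \<in> ball 0 1" "w \<in> ball 0 1" "z / U (z\<^sup>2) = w / U (w\<^sup>2)"
    then have "f (z\<^sup>2) = f (w\<^sup>2)" using U2[OF zw(1)] U2[OF zw(2)] by metis
    then have "z\<^sup>2 = w\<^sup>2" using S(4) z2[OF zw(1)] z2[OF zw(2)] unfolding inj_on_def by auto
    \<comment> \<open>Only z^2 = w^2 is known, but then the denominators agree and the equality of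
      the quotients fixes the sign.\<close>
    then show "z = w" using zw(3) by (simp add: U_def)
  qed
  then have le: "cmod (deriv U 0) \<le> 1"
    by (intro area_theorem_odd[OF Uh]) (auto simp: U_def)
  have dl: "(l has_field_derivative deriv l 0) (at 0)" using l(1) by (simp add: holomorphic_derivI)
  have "(U has_field_derivative (- deriv l 0 / 2)) (at 0)"
    unfolding U_def[abs_def] by (auto intro!: derivative_eq_intros dl)
  then have dU: "deriv U 0 = - deriv l 0 / 2" by (rule DERIV_imp_deriv)
  have "deriv q 0 = deriv l 0" using deriv_exp_log[OF l, of 0] q0 by simp
  then have dq: "(q has_field_derivative deriv l 0) (at 0)"
    using holomorphic_derivI[OF q(1) open_ball, of 0] by simp
  have ddq: "(deriv q has_field_derivative deriv (deriv q) 0) (at 0)"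
    using q(1) by (intro holomorphic_derivI[of _ "ball 0 1"] holomorphic_deriv) auto
  note df = deriv_id_times[OF q(1,2)]
  have "((\<lambda>z. q z + z * deriv q z) has_field_derivative deriv l 0 + deriv l 0) (at 0)"
    using DERIV_imp_deriv[OF dq] by (auto intro!: derivative_eq_intros dq ddq)
  then have "(deriv f has_field_derivative deriv l 0 + deriv l 0) (at 0)"
    by (rule has_field_derivative_transform_within_open[of _ _ _ "ball 0 1"]) (use df in auto)
  then have "deriv (deriv f) 0 = - 4 * deriv U 0" using dU by (simp add: DERIV_imp_deriv)
  then show ?thesis using le by (simp add: norm_mult)
qed

text \<open>The Koebe transform moves z to 0 by a disc automorphism and renormalises f; the bounded
  expression is the second derivative of the transform at 0.\<close>

lemma Koebe_transform_bound:
  fixes f :: "complex \<Rightarrow> complex" and z :: complex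
  assumes f: "f \<in> class_S" and z: "z \<in> ball 0 1"
  shows "deriv f z \<noteq> 0"
    and "cmod ((1 - (cmod z)\<^sup>2) * (deriv (deriv f) z / deriv f z) - 2 * cnj z) \<le> 4"
proof -
  note S = class_S_D[OF f]
  show fz: "deriv f z \<noteq> 0" using holomorphic_injective_imp_regular[OF S(1) open_ball S(4) z] .
  have z1: "cmod z < 1" using z by simp
  define c where "c = of_real (1 - (cmod z)\<^sup>2) * deriv f z"
  have "(cmod z)\<^sup>2 < 1" using z1 by (simp add: abs_square_less_1)
  then have t: "1 - (cmod z)\<^sup>2 \<noteq> 0" by simp
  then have c0: "c \<noteq> 0" using fz unfolding c_def by (metis mult_eq_0_iff of_real_eq_0_iff)
  define A where "A w = (w + z) / (1 + cnj z * w)" for w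
  have Aball: "A w \<in> ball 0 1" "1 + cnj z * w \<noteq> 0" if "w \<in> ball 0 1" for w
    using Moebius_in_ball[OF z1, of w] that by (simp_all add: A_def)
  have dA: "(A has_field_derivative of_real (1 - (cmod z)\<^sup>2) / (1 + cnj z * w)\<^sup>2) (at w)" if "w \<in> ball 0 1" for w
    using Moebius_deriv[OF z1 that] by (simp add: A_def[abs_def])
  have A0: "A 0 = z" by (simp add: A_def)
  define F where "F w = (f (A w) - f z) / c" for w
  have dF: "(F has_field_derivative deriv f (A w) / ((1 + cnj z * w)\<^sup>2 * deriv f z)) (at w)" if w: "w \<in> ball 0 1" for w
  proof -
    have "(f has_field_derivative deriv f (A w)) (at (A w))" using S(1) Aball[OF w] by (simp add: holomorphic_derivI)
    from DERIV_chain2[OF this dA[OF w]]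
    have "((\<lambda>w. (f (A w) - f z) / c) has_field_derivative
       (deriv f (A w) * (of_real (1 - (cmod z)\<^sup>2) / (1 + cnj z * w)\<^sup>2) - 0) / c) (at w)"
      by (intro DERIV_cdivide DERIV_diff DERIV_const)
    moreover have "(deriv f (A w) * (of_real (1 - (cmod z)\<^sup>2) / (1 + cnj z * w)\<^sup>2) - 0) / c =
       deriv f (A w) / ((1 + cnj z * w)\<^sup>2 * deriv f z)"
    proof -
      have e: "of_real (1 - (cmod z)\<^sup>2) / c = 1 / deriv f z"
        using t unfolding c_def by (metis nonzero_divide_mult_cancel_left of_real_eq_0_iff)
      have "(X * (T / Y) - 0) / c = X / (Y * d)" if "T / c = 1 / d" for X T Y d
      proof -
        have "(X * (T / Y) - 0) / c = X * (T / c) / Y" by simp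
        also have "\<dots> = X / (Y * d)" unfolding that by simp
        finally show ?thesis .
      qed
      from this[OF e] show ?thesis .
    qed
    ultimately show ?thesis by (simp add: F_def[abs_def])
  qed
  have Fh: "F holomorphic_on ball 0 1"
    unfolding holomorphic_on_open[OF open_ball] using dF by blast
  have dF': "deriv F w = deriv f (A w) / ((1 + cnj z * w)\<^sup>2 * deriv f z)" if "w \<in> ball 0 1" for w
    using DERIV_imp_deriv[OF dF[OF that]] .
  have "inj_on F (ball 0 1)"
  proof (rule inj_onI)
    fix v w assume vw: "v \<in> ball 0 1" "w \<in> ball 0 1" "F v = F w"
    then have "f (A v) = f (A w)" using c0 by (simp add: F_def)
    then have "A v = A w" using S(4) Aball vw unfolding inj_on_def by blast
    then have "(v + z) * (1 + cnj z * w) = (w + z) * (1 + cnj z * v)"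
      using Aball(2)[OF vw(1)] Aball(2)[OF vw(2)] by (simp add: A_def field_simps)
    then have "(v - w) * (1 - z * cnj z) = 0" by (simp add: algebra_simps)
    moreover have "1 - z * cnj z \<noteq> 0" using t unfolding complex_norm_square[symmetric] by (metis of_real_1 of_real_diff of_real_eq_0_iff)
    ultimately show "v = w" by simp
  qed
  then have "F \<in> class_S"
    using Fh dF'[of 0] fz by (simp add: class_S_def class_A_def A0) (simp add: F_def A0)
  then have le: "cmod (deriv (deriv F) 0) \<le> 4" by (rule Bieberbach_second_coefficient)
  have "(deriv f has_field_derivative deriv (deriv f) z) (at (A 0))"
    unfolding A0 using S(1) z by (intro holomorphic_derivI[of _ "ball 0 1"] holomorphic_deriv) auto
  from DERIV_chain2[OF this dA[of 0]]
  have dfA: "((\<lambda>w. deriv f (A w)) has_field_derivative deriv (deriv f) z * of_real (1 - (cmod z)\<^sup>2)) (at 0)" by simp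
  have "((\<lambda>w. deriv f (A w) / ((1 + cnj z * w)\<^sup>2 * deriv f z)) has_field_derivative
      (deriv (deriv f) z * of_real (1 - (cmod z)\<^sup>2) - 2 * cnj z * deriv f z) / deriv f z) (at 0)"
    using fz by (auto intro!: derivative_eq_intros dfA simp: A0 power2_eq_square field_simps)
  then have "(deriv F has_field_derivative
      (deriv (deriv f) z * of_real (1 - (cmod z)\<^sup>2) - 2 * cnj z * deriv f z) / deriv f z) (at 0)"
    by (rule has_field_derivative_transform_within_open[of _ _ _ "ball 0 1"]) (use dF' in auto)
  then have "deriv (deriv F) 0 = of_real (1 - (cmod z)\<^sup>2) * (deriv (deriv f) z / deriv f z) - 2 * cnj z"
    using fz by (simp add: DERIV_imp_deriv diff_divide_distrib mult.commute)
  then show "cmod ((1 - (cmod z)\<^sup>2) * (deriv (deriv f) z / deriv f z) - 2 * cnj z) \<le> 4" using le by simp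
qed

text \<open>Multiplying the preceding bound by z gives (1 - r^2) Re (1 + z f''/f') \<ge> 1 - 4 r +
  r^2 for r = \<bar>z\<bar>. The smaller root of the right-hand side is 2 - sqrt 3.\<close>

lemma class_S_star_factor_deriv:
  assumes f: "f \<in> class_S"
  shows "star_factor (deriv f) (ball 0 (2 - sqrt 3))"
proof -
  note S = class_S_D[OF f]
  have s3: "1 < sqrt 3" "sqrt 3 < 2" by (auto intro: real_less_rsqrt real_less_lsqrt)
  have sub: "ball 0 (2 - sqrt 3) \<subseteq> ball (0::complex) 1" using s3(1) by (intro subset_ball) linarith
  have "0 < Re (1 + z * deriv (deriv f) z / deriv f z)" if z: "z \<in> ball 0 (2 - sqrt 3)" for z
  proof -
    have zb: "z \<in> ball 0 1" using sub z by blast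
    define r where "r = cmod z"
    have r: "0 \<le> r" "r < 2 - sqrt 3" using z by (auto simp: r_def)
    have r2: "r\<^sup>2 < 1" using zb by (simp add: r_def abs_square_less_1)
    define X where "X = deriv (deriv f) z / deriv f z"
    have "cmod (z * ((1 - r\<^sup>2) * X - 2 * cnj z)) \<le> r * 4"
      unfolding norm_mult using Koebe_transform_bound(2)[OF f zb]
      by (intro mult_mono) (auto simp: r_def X_def)
    moreover have "z * ((1 - r\<^sup>2) * X - 2 * cnj z) = of_real (1 - r\<^sup>2) * (z * X) - of_real (2 * r\<^sup>2)"
      unfolding of_real_mult complex_norm_square r_def by (simp add: algebra_simps)
    moreover have "- cmod w \<le> Re w" for w using abs_Re_le_cmod[of w] by linarith
    ultimately have "- (r * 4) \<le> Re (of_real (1 - r\<^sup>2) * (z * X) - of_real (2 * r\<^sup>2))"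
      by (metis neg_le_iff_le order_trans)
    also have "\<dots> = (1 - r\<^sup>2) * Re (z * X) - 2 * r\<^sup>2"
      by (simp only: minus_complex.sel Re_complex_of_real times_complex.sel(1) Im_complex_of_real)
    finally have "r\<^sup>2 - 4 * r + 1 \<le> (1 - r\<^sup>2) * (1 + Re (z * X))" by (simp add: algebra_simps)
    moreover have "0 < r\<^sup>2 - 4 * r + 1"
    proof -
      have "(sqrt 3)\<^sup>2 < (2 - r)\<^sup>2" using r by (intro power_strict_mono) auto
      then show ?thesis by (simp add: power2_eq_square algebra_simps)
    qed
    ultimately have "0 < (1 - r\<^sup>2) * (1 + Re (z * X))" by linarith
    then have "0 < 1 + Re (z * X)" using r2 by (simp add: zero_less_mult_iff)
    then show ?thesis by (simp add: X_def)
  qed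
  moreover have "deriv f holomorphic_on ball 0 (2 - sqrt 3)"
    using S(1) sub by (intro holomorphic_deriv) (auto intro: holomorphic_on_subset)
  ultimately show ?thesis
    using Koebe_transform_bound(1)[OF f] sub unfolding star_factor_def by blast
qed

text \<open>For \<bar>z\<bar> < 1/10 the logarithm of f' has derivative at most 5 in modulus, so the
  argument of f' stays below 1/2 < \<pi>/2. The radius 1/10 is a crude choice, made only to bound
  \<open>r_cc\<close> from below.\<close>

lemma class_S_Re_deriv_pos:
  assumes f: "f \<in> class_S" and z: "cmod z < 1/10"
  shows "0 < Re (deriv f z)"
proof -
  note S = class_S_D[OF f]
  have hol: "deriv f holomorphic_on ball 0 1" using S(1) by (intro holomorphic_deriv) auto
  obtain l where l: "l holomorphic_on ball 0 1" "\<And>z. z \<in> ball 0 1 \<Longrightarrow> exp (l z) = deriv f z"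
    using holomorphic_logarithm_exists[OF convex_ball open_ball hol Koebe_transform_bound(1)[OF f], of 0] by auto
  have bd: "cmod (deriv l w) \<le> 5" if w: "w \<in> ball 0 (1/10)" for w
  proof -
    have wb: "w \<in> ball 0 1" using w by simp
    have X: "deriv (deriv f) w / deriv f w = deriv l w"
      using deriv_exp_log[OF l wb] Koebe_transform_bound(1)[OF f wb] by simp
    define r where "r = cmod w"
    have r: "0 \<le> r" "r < 1/10" using w by (auto simp: r_def)
    have r2: "r\<^sup>2 \<le> 1/100" using r mult_mono[of r "1/10" r "1/10"] by (simp add: power2_eq_square)
    have "cmod (of_real (1 - r\<^sup>2) * deriv l w) \<le> cmod (of_real (1 - r\<^sup>2) * deriv l w - 2 * cnj w) + cmod (2 * cnj w)"
      using norm_triangle_ineq[of "of_real (1 - r\<^sup>2) * deriv l w - 2 * cnj w" "2 * cnj w"] by simp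
    also have "\<dots> \<le> 4 + 2 * r"
      using Koebe_transform_bound(2)[OF f wb] by (simp add: X r_def norm_mult)
    finally have "(1 - r\<^sup>2) * cmod (deriv l w) \<le> 4 + 2 * r"
      using r2 unfolding norm_mult norm_of_real by simp
    moreover have "99/100 * cmod (deriv l w) \<le> (1 - r\<^sup>2) * cmod (deriv l w)"
      using r2 by (intro mult_right_mono) auto
    ultimately show ?thesis using r by linarith
  qed
  have zb: "z \<in> ball 0 (1/10)" using z by simp
  have "cmod (l z - l 0) \<le> 5 * cmod (z - 0)"
  proof (rule field_differentiable_bound[of "ball 0 (1/10)" l "deriv l"])
    show "(l has_field_derivative deriv l w) (at w within ball 0 (1/10))" if "w \<in> ball 0 (1/10)" for w
      by (rule has_field_derivative_at_within, rule holomorphic_derivI[OF l(1) open_ball]) (use that in simp)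
    show "cmod (deriv l w) \<le> 5" if "w \<in> ball 0 (1/10)" for w by (rule bd[OF that])
    show "0 \<in> ball (0::complex) (1/10)" by simp
  qed (use zb in simp_all)
  then have "cmod (l z - l 0) < 1/2" using z by simp
  then have "\<bar>Im (l z - l 0)\<bar> < pi / 2"
    using abs_Im_le_cmod[of "l z - l 0"] pi_gt3 by linarith
  then have "- (pi / 2) < Im (l z - l 0)" "Im (l z - l 0) < pi / 2" by linarith+
  then have "0 < cos (Im (l z - l 0))" by (rule cos_gt_zero_pi)
  then have "0 < Re (exp (l z - l 0))" by (simp add: Re_exp)
  moreover have "exp (l z - l 0) = deriv f z"
    using l(2)[of z] l(2)[of 0] z S(3) by (simp add: exp_diff)
  ultimately show ?thesis by simp
qed

subsection \<open>Roots of the polynomial\<close>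

text \<open>At this radius M = sqrt 2, so M^2 - 2 (\<alpha> M + 1 - \<alpha>) reduces to - 2
  \<alpha> (sqrt 2 - 1). The subtracted square is then at most 4 \<alpha>, against a first term of
  at least 8 \<alpha>.\<close>

lemma zeta_poly_at_3_minus_2_sqrt_2:
  assumes "0 < \<alpha>" "\<alpha> < 1"
  shows "0 < zeta_poly \<alpha> (3 - 2 * sqrt 2)"
proof -
  define t where "t = sqrt 2"
  have t2: "t * t = 2" and t: "1 < t" "t < 2" by (auto simp: t_def intro: real_less_rsqrt real_less_lsqrt)
  define r where "r = 3 - 2 * t"
  have r: "r \<noteq> 1" "1 - r > 0" using t by (auto simp: r_def)
  have M: "(1 + r) / (1 - r) = t" using t t2 by (simp add: r_def divide_simps algebra_simps)
  define y where "y = \<alpha> * t + (1 - \<alpha>)"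
  have y: "y = 1 + \<alpha> * (t - 1)" by (simp add: y_def algebra_simps)
  have "(t - 1)\<^sup>2 \<le> 1" using t by (simp add: abs_square_le_1 abs_le_iff)
  moreover have "\<alpha>\<^sup>2 \<le> \<alpha>" using assms by (simp add: power2_eq_square mult_left_le_one_le)
  ultimately have "(1 - \<alpha>) * (\<alpha>\<^sup>2 * (t - 1)\<^sup>2) \<le> 1 * (\<alpha> * 1)"
    using assms by (intro mult_mono) auto
  moreover have "(1 - \<alpha>) * (t\<^sup>2 - 2 * y)\<^sup>2 = 4 * ((1 - \<alpha>) * (\<alpha>\<^sup>2 * (t - 1)\<^sup>2))"
  proof -
    have "t\<^sup>2 = 2" using t2 by (simp add: power2_eq_square)
    moreover have "2 - 2 * (1 + \<alpha> * (t - 1)) = - (2 * \<alpha> * (t - 1))" by (simp add: algebra_simps)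
    ultimately show ?thesis unfolding y by (simp add: power_mult_distrib)
  qed
  moreover have "8 * \<alpha> * 1 \<le> 8 * \<alpha> * (t * y)"
  proof (intro mult_left_mono)
    have "1 \<le> y" using assms t by (simp add: y)
    then show "1 \<le> t * y" using t mult_mono[of 1 t 1 y] by simp
  qed (use assms in simp)
  ultimately have "0 < 8 * \<alpha> * t * y - (1 - \<alpha>) * (t\<^sup>2 - 2 * y)\<^sup>2"
    using assms(1) by (simp only: mult.assoc)
  then have "0 < (1 - r)^4 * (8 * \<alpha> * t * y - (1 - \<alpha>) * (t\<^sup>2 - 2 * y)\<^sup>2)" using r by simp
  then show ?thesis using zeta_poly_eq[OF r(1), of \<alpha>] unfolding M y_def[symmetric] by (simp add: r_def t_def)
qed

text \<open>The zero set on the interval is compact, so a least zero exists; without that the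
  \<open>LEAST\<close> operator on the reals would carry no information.\<close>

lemma Least_root:
  fixes F :: "real \<Rightarrow> real"
  assumes "continuous_on {a..b} F" "F a \<noteq> 0" "\<exists>x\<in>{a..b}. F x = 0"
  obtains m where "a < m" "m \<le> b" "F m = 0" "\<And>x. a < x \<Longrightarrow> F x = 0 \<Longrightarrow> m \<le> x"
proof -
  define T where "T = {a..b} \<inter> F -` {0}"
  have "closed T" unfolding T_def using assms(1) by (intro continuous_closed_preimage) auto
  moreover have "bounded T" by (rule bounded_subset[of "{a..b}"]) (auto simp: T_def)
  ultimately have "compact T" using compact_eq_bounded_closed by blast
  moreover have "T \<noteq> {}" using assms(3) by (auto simp: T_def)
  ultimately obtain m where m: "m \<in> T" "\<And>t. t \<in> T \<Longrightarrow> m \<le> t" using compact_attains_inf[of T] by auto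
  show thesis
  proof (rule that[of m])
    show "a < m" using m(1) assms(2) by (cases "m = a") (auto simp: T_def)
    show "m \<le> x" if "a < x" "F x = 0" for x
      using m that by (cases "x \<le> b") (auto simp: T_def)
  qed (use m(1) in \<open>auto simp: T_def\<close>)
qed

text \<open>\<zeta> is positive at the left end and equals - 16 (1 - \<alpha>) at 1. A nonpositive
  value before the least root would produce an earlier root.\<close>

lemma R1_properties:
  assumes \<alpha>: "0 < \<alpha>" "\<alpha> < 1"
  shows "3 - 2 * sqrt 2 < R\<^sub>1 \<alpha>" "R\<^sub>1 \<alpha> < 1"
    and "\<And>r. 3 - 2 * sqrt 2 < r \<Longrightarrow> r < R\<^sub>1 \<alpha> \<Longrightarrow> 0 < zeta_poly \<alpha> r"
proof -
  define a where "a = 3 - 2 * sqrt 2"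
  have a1: "a < 1" by (simp add: a_def)
  have cont: "continuous_on S (zeta_poly \<alpha>)" for S
    unfolding zeta_poly_def[abs_def] by (intro continuous_intros)
  have za: "0 < zeta_poly \<alpha> a" unfolding a_def by (rule zeta_poly_at_3_minus_2_sqrt_2[OF \<alpha>])
  have "zeta_poly \<alpha> 1 = 16 * (\<alpha> - 1)" by (simp add: zeta_poly_def algebra_simps eval_nat_numeral)
  then have z1: "zeta_poly \<alpha> 1 < 0" using \<alpha> by simp
  have ivt: "\<exists>x. a \<le> x \<and> x \<le> b \<and> zeta_poly \<alpha> x = 0" if "zeta_poly \<alpha> b \<le> 0" "a \<le> b" for b
    using IVT2'[of "zeta_poly \<alpha>" b 0 a] that za cont by auto
  obtain m where m: "a < m" "m \<le> 1" "zeta_poly \<alpha> m = 0" "\<And>x. a < x \<Longrightarrow> zeta_poly \<alpha> x = 0 \<Longrightarrow> m \<le> x"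
  proof -
    have ex: "\<exists>x\<in>{a..1}. zeta_poly \<alpha> x = 0" using ivt[of 1] z1 a1 by auto
    have ne: "zeta_poly \<alpha> a \<noteq> 0" using za by simp
    show thesis by (rule Least_root[OF cont ne ex], rule that)
  qed
  have "m \<noteq> 1" using m(3) z1 by auto
  then have m1: "m < 1" using m(2) by simp
  have "R\<^sub>1 \<alpha> = m" unfolding R\<^sub>1_def a_def[symmetric]
    by (rule Least_equality) (use m m1 in auto)
  moreover have "0 < zeta_poly \<alpha> r" if r: "a < r" "r < m" for r
  proof (rule ccontr)
    assume "\<not> 0 < zeta_poly \<alpha> r"
    then obtain x where x: "a \<le> x" "x \<le> r" "zeta_poly \<alpha> x = 0" using ivt[of r] r by auto
    then have "a < x" using za by (cases "x = a") auto
    then show False using m(4)[of x] x r by simp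
  qed
  ultimately show "3 - 2 * sqrt 2 < R\<^sub>1 \<alpha>" "R\<^sub>1 \<alpha> < 1"
    "\<And>r. 3 - 2 * sqrt 2 < r \<Longrightarrow> r < R\<^sub>1 \<alpha> \<Longrightarrow> 0 < zeta_poly \<alpha> r"
    using m m1 unfolding a_def by auto
qed

text \<open>At \<alpha> = 0 the polynomial is - (s^2 - 6 s + 1)^2, which vanishes only for s = 3 - 2
  sqrt 2 and s = 3 + 2 sqrt 2; the bounds on \<open>r_cc\<close> put s strictly between them. At
  \<alpha> = 1 it is 8 (s^2 - 1)^2, so a root in (0, 1] exists and the least one is
  attained.\<close>

lemma \<alpha>0_pos:
  assumes "1/10 \<le> r_cc" "r_cc \<le> 1"
  shows "0 < \<alpha>\<^sub>0"
proof -
  define s where "s = (2 - sqrt 3) / r_cc"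
  have q1: "sqrt 3 < 1.74" by (rule real_less_lsqrt) (simp_all add: power2_eq_square)
  have q2: "1.7 < sqrt 3" by (rule real_less_rsqrt) (simp add: power2_eq_square)
  note q = q1 q2
  have "2 - sqrt 3 \<le> s" unfolding s_def using assms q by (simp add: pos_le_divide_eq mult_left_le)
  then have s1: "1/5 < s" using q by simp
  have "s \<le> (2 - sqrt 3) / (1/10)" unfolding s_def using assms q by (intro divide_left_mono) auto
  then have s2: "s < 5" using q by simp
  have "(s - 1/5) * (s - 5) < 0" using s1 s2 by (simp add: mult_pos_neg)
  moreover have "(s - 1/5) * (s - 5) = s\<^sup>2 - 26/5 * s + 1" by (simp add: power2_eq_square field_simps)
  ultimately have "s\<^sup>2 - 6 * s + 1 < 0" using s1 by linarith
  moreover have "zeta_poly 0 s = - (s\<^sup>2 - 6 * s + 1)\<^sup>2" by (simp add: zeta_poly_def algebra_simps eval_nat_numeral)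
  ultimately have z0: "zeta_poly 0 s < 0" by simp
  have "zeta_poly 1 s = 8 * (s\<^sup>2 - 1)\<^sup>2" by (simp add: zeta_poly_def algebra_simps eval_nat_numeral)
  then have z1: "0 \<le> zeta_poly 1 s" by simp
  have cont: "continuous_on {0..1} (\<lambda>\<alpha>. zeta_poly \<alpha> s)"
    unfolding zeta_poly_def[abs_def] by (intro continuous_intros)
  have "\<exists>x\<in>{0..1}. zeta_poly x s = 0" using IVT'[of "\<lambda>\<alpha>. zeta_poly \<alpha> s" 0 0 1] z0 z1 cont by auto
  then obtain m where m: "0 < m" "zeta_poly m s = 0" "\<And>x. 0 < x \<Longrightarrow> zeta_poly x s = 0 \<Longrightarrow> m \<le> x"
    using Least_root[OF cont] z0 by auto
  have "\<alpha>\<^sub>0 = m" unfolding \<alpha>\<^sub>0_def s_def[symmetric] by (rule Least_equality) (use m in auto)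
  then show ?thesis using m(1) by simp
qed

subsection \<open>Starlikeness of Hadamard products\<close>

lemma fps_expansion_Euler:
  assumes "f holomorphic_on ball 0 R" "0 < R"
  shows "fps_nth (fps_expansion (\<lambda>z. z * deriv f z + c * f z) 0) n = (of_nat n + c) * fps_nth (fps_expansion f 0) n"
proof -
  have f: "f has_fps_expansion fps_expansion f 0" using assms by (intro has_fps_expansion_fps_expansion[of "ball 0 R"]) auto
  have "(\<lambda>z. z * deriv f z + c * f z) has_fps_expansion
      (fps_X * fps_deriv (fps_expansion f 0) + fps_const c * fps_expansion f 0)"
    by (intro fps_expansion_intros f)
  then have "fps_expansion (\<lambda>z. z * deriv f z + c * f z) 0 =
      fps_X * fps_deriv (fps_expansion f 0) + fps_const c * fps_expansion f 0"
    by (rule fps_expansion_eqI)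
  then show ?thesis by (cases n) (simp_all add: algebra_simps)
qed

text \<open>The operator z d/dz + c multiplies the n-th coefficient by n + c, and so may be applied
  to one factor or to the product.\<close>

lemma hadamard_Euler:
  assumes f: "f holomorphic_on ball 0 1" and g: "g holomorphic_on ball 0 1" and z: "z \<in> ball 0 1"
  shows "hadamard f (\<lambda>z. z * deriv g z + c * g z) z = z * deriv (hadamard f g) z + c * hadamard f g z"
proof -
  define F where "F = hadamard f g"
  have Fh: "F holomorphic_on ball 0 1" using hadamard_holomorphic[OF f _ g] by (simp add: F_def)
  then have "(\<lambda>z. z * deriv F z + c * F z) holomorphic_on ball 0 1" by (intro holomorphic_intros) auto
  from sums_fps_expansion[OF this, of z] z
  have "(\<lambda>n. (of_nat n + c) * fps_nth (fps_expansion F 0) n * z ^ n) sums (z * deriv F z + c * F z)"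
    using fps_expansion_Euler[OF Fh] by simp
  then have "(\<lambda>n. fps_nth (fps_expansion f 0) n * ((of_nat n + c) * fps_nth (fps_expansion g 0) n) * z ^ n)
      sums (z * deriv F z + c * F z)"
    unfolding F_def using fps_expansion_hadamard[OF f _ g] by (simp add: mult_ac)
  then show ?thesis unfolding hadamard_def fps_expansion_Euler[OF g zero_less_one]
    by (simp add: sums_iff F_def[symmetric] hadamard_def[symmetric])
qed

text \<open>Nonvanishing of \<open>z F' + c F\<close> for all purely imaginary \<open>c\<close> keeps \<open>z F' / F\<close> off the imaginary axis.\<close>

lemma starlike_hadamard:
  assumes f: "f \<in> class_A" and g: "g \<in> class_A" and \<rho>: "0 < \<rho>" "\<rho> \<le> 1"
    and nz: "\<And>z. z \<in> ball 0 \<rho> \<Longrightarrow> z \<noteq> 0 \<Longrightarrow> hadamard f g z \<noteq> 0"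
    and nz': "\<And>z s. z \<in> ball 0 \<rho> \<Longrightarrow> z \<noteq> 0 \<Longrightarrow> hadamard f (\<lambda>z. z * deriv g z + \<i> * of_real s * g z) z \<noteq> 0"
  shows "starlike_in_disc (hadamard f g) \<rho>"
proof -
  define F where "F = hadamard f g"
  have fh: "f holomorphic_on ball 0 1" "deriv f 0 = 1" "f 0 = 0" using f by (auto simp: class_A_def)
  have gh: "g holomorphic_on ball 0 1" "deriv g 0 = 1" using g by (auto simp: class_A_def)
  have "F holomorphic_on ball 0 1" using hadamard_holomorphic[OF fh(1) _ gh(1)] by (simp add: F_def)
  then have Fh: "F holomorphic_on ball 0 \<rho>" using \<rho> by (auto intro: holomorphic_on_subset)
  have c: "fps_nth (fps_expansion f 0) 0 = f 0" "fps_nth (fps_expansion f 0) 1 = deriv f 0" for f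
    by (simp_all add: fps_expansion_def)
  have F0: "F 0 = 0" "deriv F 0 = 1"
    using fps_expansion_hadamard[OF fh(1) _ gh(1), of 0] fps_expansion_hadamard[OF fh(1) _ gh(1), of 1] fh gh
    unfolding c by (simp_all add: F_def)
  obtain Q where Q: "Q holomorphic_on ball 0 \<rho>" "\<And>z. cmod z < \<rho> \<Longrightarrow> F z = z * Q z" "deriv F 0 = Q 0"
    using Schwarz3[OF Fh F0(1)] by blast
  have Qnz: "Q z \<noteq> 0" if "z \<in> ball 0 \<rho>" for z
    using nz[OF that] Q F0 that by (cases "z = 0") (auto simp: F_def)
  define W where "W z = 1 + z * deriv Q z / Q z" for z
  have W: "z * deriv F z = W z * F z" if z: "z \<in> ball 0 \<rho>" for z
    using deriv_id_times[OF Q(1,2) z] Q(2)[of z] z Qnz[OF z] by (simp add: W_def field_simps)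
  have Wne: "Re (W z) \<noteq> 0" if z: "z \<in> ball 0 \<rho>" for z
  proof (cases "z = 0")
    case False
    show ?thesis
    proof
      assume "Re (W z) = 0"
      define y where "y = - Im (W z)"
      have W0: "W z = - \<i> * of_real y" using \<open>Re (W z) = 0\<close> by (simp add: complex_eq_iff y_def)
      have "hadamard f (\<lambda>z. z * deriv g z + \<i> * of_real y * g z) z = z * deriv F z + \<i> * of_real y * F z"
        unfolding F_def by (rule hadamard_Euler[OF fh(1) gh(1)]) (use z \<rho> in auto)
      also have "\<dots> = (W z + \<i> * of_real y) * F z" using W[OF z] by (simp add: algebra_simps)
      also have "\<dots> = 0" using W0 by simp
      finally show False using nz'[OF z False, of y] by simp
    qed
  qed (simp add: W_def)
  have Wc: "continuous_on (ball 0 \<rho>) (\<lambda>z. Re (W z))"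
  proof -
    have "W holomorphic_on ball 0 \<rho>" unfolding W_def[abs_def] using Q(1) Qnz by (intro holomorphic_intros) auto
    then show ?thesis by (intro continuous_intros holomorphic_on_imp_continuous_on)
  qed
  \<comment> \<open>Re W is 1 at the origin and never 0, so connectedness of the disc fixes its
    sign.\<close>
  have Wpos: "0 < Re (W z)" if z: "z \<in> ball 0 \<rho>" for z
  proof (rule ccontr)
    assume "\<not> 0 < Re (W z)"
    then have "Re (W z) \<le> 0" by simp
    have "connected ((\<lambda>z. Re (W z)) ` ball 0 \<rho>)" by (intro connected_continuous_image Wc) auto
    moreover have "Re (W z) \<in> (\<lambda>z. Re (W z)) ` ball 0 \<rho>" "1 \<in> (\<lambda>z. Re (W z)) ` ball 0 \<rho>"
      using z \<rho> by (auto simp: W_def intro!: image_eqI[of _ _ 0])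
    ultimately have "0 \<in> (\<lambda>z. Re (W z)) ` ball 0 \<rho>"
      using \<open>Re (W z) \<le> 0\<close> connectedD_interval[of _ "Re (W z)" 1 0] by auto
    then show False using Wne by auto
  qed
  have "starlike_in_disc F \<rho>"
  proof (rule starlike_in_disc_of_Re_pos[OF \<rho>(1) Fh F0(1)])
    show "F z \<noteq> 0 \<and> 0 < Re (z * deriv F z / F z)" if "z \<in> ball 0 \<rho>" "z \<noteq> 0" for z
    proof -
      have "F z \<noteq> 0" using nz[OF that] by (simp add: F_def)
      then show ?thesis using W[OF that(1)] Wpos[OF that(1)] by simp
    qed
  qed (use F0 in simp)
  then show ?thesis by (simp add: F_def)
qed

text \<open>p is z g'/g written as 1 + z q'/q, which is holomorphic at 0 and has the correct value 1
  there.\<close>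

lemma class_St_factor:
  assumes g: "g \<in> class_St \<alpha>" and \<alpha>: "0 \<le> \<alpha>" "\<alpha> < 1"
  obtains q p where "star_factor q (ball 0 1)" "\<And>z. z \<in> ball 0 1 \<Longrightarrow> g z = z * q z"
    "p holomorphic_on ball 0 1" "p 0 = 1" "\<And>z. z \<in> ball 0 1 \<Longrightarrow> p z = 1 + z * deriv q z / q z"
    "\<And>z. z \<in> ball 0 1 \<Longrightarrow> \<alpha> < Re (p z)"
    "\<And>z. z \<in> ball 0 1 \<Longrightarrow> z * deriv g z = z * (q z * p z)"
proof -
  have gh: "g holomorphic_on ball 0 1" "g 0 = 0" "deriv g 0 = 1"
    and gp: "\<And>z. z \<in> ball 0 1 \<Longrightarrow> z \<noteq> 0 \<Longrightarrow> g z \<noteq> 0 \<and> \<alpha> < Re (z * deriv g z / g z)"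
    using g by (auto simp: class_St_def class_A_def)
  obtain q where q: "q holomorphic_on ball 0 1" "\<And>z. cmod z < 1 \<Longrightarrow> g z = z * q z" "deriv g 0 = q 0"
    using Schwarz3[OF gh(1,2)] by blast
  have qnz: "q z \<noteq> 0" if "z \<in> ball 0 1" for z
    using gp[OF that] q gh that by (cases "z = 0") auto
  define p where "p z = 1 + z * deriv q z / q z" for z
  have dg: "deriv g z = q z * p z" if z: "z \<in> ball 0 1" for z
    using deriv_id_times[OF q(1,2) z] qnz[OF z] by (simp add: p_def field_simps)
  have pp: "\<alpha> < Re (p z)" if z: "z \<in> ball 0 1" for z
  proof (cases "z = 0")
    case False
    have "z * deriv g z / g z = p z"
      using dg[OF z] q(2)[of z] z False qnz[OF z] by simp
    then show ?thesis using gp[OF z False] by simp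
  qed (use \<alpha> in \<open>simp add: p_def\<close>)
  show thesis
  proof (rule that[of q p])
    show "star_factor q (ball 0 1)"
      unfolding star_factor_def using q(1) qnz pp \<alpha> by (fastforce simp: p_def)
    show "p holomorphic_on ball 0 1" unfolding p_def[abs_def] using q(1) qnz by (intro holomorphic_intros) auto
  qed (use q(2) pp dg in \<open>auto simp: p_def\<close>)
qed

lemma starlike_2_minus_sqrt_3:
  assumes f: "f \<in> class_S" and g: "g \<in> class_St \<alpha>" and \<alpha>: "0 \<le> \<alpha>" "\<alpha> < 1"
  shows "starlike_in_disc (hadamard f g) (2 - sqrt 3)"
proof -
  have s3: "1 < sqrt 3" "sqrt 3 < 2" by (auto intro: real_less_rsqrt real_less_lsqrt)
  obtain q p where q: "star_factor q (ball 0 1)" "\<And>z. z \<in> ball 0 1 \<Longrightarrow> g z = z * q z"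
    and p: "p holomorphic_on ball 0 1" "p 0 = 1" "\<And>z. z \<in> ball 0 1 \<Longrightarrow> p z = 1 + z * deriv q z / q z"
      "\<And>z. z \<in> ball 0 1 \<Longrightarrow> \<alpha> < Re (p z)" "\<And>z. z \<in> ball 0 1 \<Longrightarrow> z * deriv g z = z * (q z * p z)"
    using class_St_factor[OF g \<alpha>] by metis
  have fh: "f holomorphic_on ball 0 (2 - sqrt 3)"
    by (rule holomorphic_on_subset[OF class_S_D(1)[OF f]], rule subset_ball) (use s3(1) in linarith)
  have nz: "hadamard f (\<lambda>z. z * q z * P z) z \<noteq> 0"
    if "P holomorphic_on ball 0 1" "\<And>z. z \<in> ball 0 1 \<Longrightarrow> 0 < Re (1 * P z)" "z \<in> ball 0 (2 - sqrt 3)" "z \<noteq> 0" for P z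
    by (rule hadamard_nonzero[OF fh class_S_star_factor_deriv[OF f] _ q(1) _ that(1,2)]) (use that s3 in auto)
  show ?thesis
  proof (rule starlike_hadamard)
    show "f \<in> class_A" "g \<in> class_A" using f g by (auto simp: class_S_def class_St_def)
    fix z :: complex and s :: real assume z: "z \<in> ball 0 (2 - sqrt 3)" "z \<noteq> 0"
    \<comment> \<open>A Hadamard product depends on the Taylor coefficients at 0 alone, so equality
      inside the unit disc is enough to exchange a factor.\<close>
    have "fps_expansion g 0 = fps_expansion (\<lambda>z. z * q z * 1) 0"
      by (rule fps_expansion_cong_ball[of 1]) (use q in auto)
    then show "hadamard f g z \<noteq> 0" using nz[of "\<lambda>_. 1" z] z by (simp add: hadamard_def)
    have "fps_expansion (\<lambda>z. z * deriv g z + \<i> * of_real s * g z) 0 = fps_expansion (\<lambda>z. z * q z * (p z + \<i> * of_real s)) 0"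
      by (rule fps_expansion_cong_ball[of 1]) (use q p in \<open>auto simp: algebra_simps\<close>)
    moreover have "hadamard f (\<lambda>z. z * q z * (p z + \<i> * of_real s)) z \<noteq> 0"
      using p(4) \<alpha> z by (intro nz holomorphic_intros p) (auto intro: le_less_trans)
    ultimately show "hadamard f (\<lambda>z. z * deriv g z + \<i> * of_real s * g z) z \<noteq> 0" by (simp add: hadamard_def)
  qed (use s3 in auto)
qed

text \<open>With F z = f (r z)/r one has z F' = z h' (F'/h'), where h' is a star factor by convexity
  of h and F'/h' has positive real part. The primitive H of Q takes the place of the convex
  function.\<close>

lemma close_to_convex_hadamard_nonzero:
  assumes f: "f holomorphic_on ball 0 1" and r: "0 < r" "r \<le> 1"
    and cc: "close_to_convex (\<lambda>z. f (of_real r * z) / of_real r)"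
    and Q: "star_factor Q (ball 0 \<rho>)" and \<rho>: "0 < \<rho>" and z: "z \<in> ball 0 \<rho>" "z \<noteq> 0"
  shows "hadamard f (\<lambda>z. z * Q z) (of_real r * z) \<noteq> 0"
proof -
  define F where "F z = f (of_real r * z) / of_real r" for z
  have Fh: "F holomorphic_on ball 0 1" using cc by (simp add: close_to_convex_def class_A_def F_def[abs_def])
  obtain h where h: "convex_function h" "\<And>z. z \<in> ball 0 1 \<Longrightarrow> 0 < Re (deriv F z / deriv h z)"
    using cc by (auto simp: close_to_convex_def F_def[abs_def])
  have hh: "h holomorphic_on ball 0 1" using h by (simp add: convex_function_def)
  have Qh: "Q holomorphic_on ball 0 \<rho>" using Q by (simp add: star_factor_def)
  \<comment> \<open>H is fixed only up to an additive constant; the constant coefficient meets the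
    factor n = 0 of z F'.\<close>
  obtain H where H: "\<And>x. x \<in> ball 0 \<rho> \<Longrightarrow> (H has_field_derivative Q x) (at x within ball 0 \<rho>)"
    using holomorphic_convex_primitive'[OF convex_ball open_ball Qh] by blast
  then have H': "(H has_field_derivative Q x) (at x)" if "x \<in> ball 0 \<rho>" for x
    using that at_within_open[OF that open_ball] by metis
  then have Hh: "H holomorphic_on ball 0 \<rho>" unfolding holomorphic_on_open[OF open_ball] by blast
  have dH: "deriv H x = Q x" if "x \<in> ball 0 \<rho>" for x using DERIV_imp_deriv[OF H'[OF that]] .
  have hs: "star_factor (deriv h) (ball 0 1)"
    unfolding star_factor_def using convex_function_Re_pos[OF h(1)] hh by (auto intro!: holomorphic_deriv)
  have "hadamard H (\<lambda>z. z * deriv h z * (deriv F z / deriv h z)) z \<noteq> 0"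
  proof (rule hadamard_nonzero[OF Hh _ \<rho> hs, where c = 1])
    show "star_factor (deriv H) (ball 0 \<rho>)" by (rule star_factor_cong[OF Q open_ball dH])
    show "(\<lambda>z. deriv F z / deriv h z) holomorphic_on ball 0 1"
      using convex_function_Re_pos(1)[OF h(1)] hh Fh by (intro holomorphic_intros) auto
  qed (use h z in auto)
  moreover have "fps_expansion (\<lambda>z. z * deriv h z * (deriv F z / deriv h z)) 0 = fps_expansion (\<lambda>z. z * deriv F z + 0 * F z) 0"
    by (rule fps_expansion_cong_ball[of 1]) (use convex_function_Re_pos(1)[OF h(1)] in auto)
  ultimately have "hadamard H (\<lambda>z. z * deriv F z + 0 * F z) z \<noteq> 0" by (simp add: hadamard_def)
  \<comment> \<open>The factor n, which turns the coefficients of H into those of z Q, is moved over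
    to F.\<close>
  moreover have "hadamard H (\<lambda>z. z * deriv F z + 0 * F z) z = hadamard f (\<lambda>z. z * Q z) (of_real r * z) / of_real r"
  proof -
    define a where "a n = fps_nth (fps_expansion f 0) n" for n
    define b where "b n = fps_nth (fps_expansion H 0) n" for n
    have "fps_expansion (\<lambda>z. z * Q z) 0 = fps_expansion (\<lambda>z. z * deriv H z + 0 * H z) 0"
      by (rule fps_expansion_cong_ball[OF \<rho>]) (use dH in auto)
    then have G: "fps_nth (fps_expansion (\<lambda>z. z * Q z) 0) n = of_nat n * b n" for n
      using fps_expansion_Euler[OF Hh \<rho>, of 0 n] by (simp add: b_def)
    have Ff: "fps_nth (fps_expansion F 0) n = a n * of_real r ^ n / of_real r" for n
    proof -
      have "(\<lambda>z. f (of_real r * z)) = (\<lambda>z. of_real r * F z)" using r by (simp add: F_def)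
      then have "(\<lambda>z. f (of_real r * z)) holomorphic_on ball 0 1" using Fh by (simp add: holomorphic_intros)
      then have "(\<lambda>z. f (of_real r * z)) has_fps_expansion fps_expansion (\<lambda>z. f (of_real r * z)) 0"
        by (intro has_fps_expansion_fps_expansion[of "ball 0 1"]) auto
      then have "(\<lambda>z. (1 / of_real r) * f (of_real r * z)) has_fps_expansion fps_const (1 / of_real r) * fps_expansion (\<lambda>z. f (of_real r * z)) 0"
        by (intro fps_expansion_intros)
      moreover have "(\<lambda>z. (1 / of_real r) * f (of_real r * z)) = F" by (simp add: F_def[abs_def])
      ultimately have "fps_expansion F 0 = fps_const (1 / of_real r) * fps_expansion (\<lambda>z. f (of_real r * z)) 0"
        using fps_expansion_eqI by metis
      then show ?thesis using fps_expansion_scale[OF f, of "of_real r" n] by (simp add: a_def)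
    qed
    have "of_real r * z \<in> ball 0 (1 * \<rho>)"
    proof -
      have "cmod (of_real r * z) \<le> 1 * cmod z" unfolding norm_mult using r by (intro mult_right_mono) auto
      then show ?thesis using z by simp
    qed
    moreover have "(\<lambda>z. z * Q z) holomorphic_on ball 0 \<rho>" using Qh by (intro holomorphic_intros)
    ultimately have "(\<lambda>n. a n * (of_nat n * b n) * (of_real r * z) ^ n) sums hadamard f (\<lambda>z. z * Q z) (of_real r * z)"
      using hadamard_sums[OF f zero_less_one _ \<rho>, of "\<lambda>z. z * Q z" "of_real r * z"] unfolding G a_def[symmetric]
      by blast
    from sums_divide[OF this, of "of_real r"]
    have "(\<lambda>n. b n * (of_nat n * (a n * of_real r ^ n / of_real r)) * z ^ n) sums (hadamard f (\<lambda>z. z * Q z) (of_real r * z) / of_real r)"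
      by (simp add: power_mult_distrib mult_ac)
    then show ?thesis
      unfolding hadamard_def[of H] fps_expansion_Euler[OF Fh zero_less_one] Ff b_def[symmetric]
      by (simp add: sums_iff)
  qed
  ultimately show ?thesis by auto
qed

text \<open>For q (p + i s) the expression in the definition of a star factor is p + z p'/(p + i s),
  because p = 1 + z q'/q; its positivity is the differential inequality.\<close>

lemma starlike_R1_times:
  assumes f: "f \<in> class_S" and g: "g \<in> class_St \<alpha>" and \<alpha>: "0 < \<alpha>" "\<alpha> < 1"
    and r: "0 < r" "r \<le> 1" and cc: "close_to_convex (\<lambda>z. f (of_real r * z) / of_real r)"
  shows "starlike_in_disc (hadamard f g) (R\<^sub>1 \<alpha> * r)"
proof -
  define R where "R = R\<^sub>1 \<alpha>"
  define a where "a = 3 - 2 * sqrt 2"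
  have "sqrt 2 < 1.5" by (intro real_less_lsqrt) (auto simp: power2_eq_square)
  then have a0: "0 < a" by (simp add: a_def)
  have R: "a < R" "R < 1" "\<And>r. a < r \<Longrightarrow> r < R \<Longrightarrow> 0 < zeta_poly \<alpha> r"
    using R1_properties[OF \<alpha>] by (auto simp: R_def a_def)
  have R0: "0 < R" using R a0 by simp
  have fh: "f holomorphic_on ball 0 1" using class_S_D(1)[OF f] .
  obtain q p where q: "star_factor q (ball 0 1)" "\<And>z. z \<in> ball 0 1 \<Longrightarrow> g z = z * q z"
    and p: "p holomorphic_on ball 0 1" "p 0 = 1" "\<And>z. z \<in> ball 0 1 \<Longrightarrow> p z = 1 + z * deriv q z / q z"
      "\<And>z. z \<in> ball 0 1 \<Longrightarrow> \<alpha> < Re (p z)" "\<And>z. z \<in> ball 0 1 \<Longrightarrow> z * deriv g z = z * (q z * p z)"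
    using class_St_factor[OF g less_imp_le[OF \<alpha>(1)] \<alpha>(2)] by metis
  have qh: "q holomorphic_on ball 0 1" and qnz: "\<And>z. z \<in> ball 0 1 \<Longrightarrow> q z \<noteq> 0"
    using q(1) by (auto simp: star_factor_def)
  have sub: "ball 0 R \<subseteq> ball (0::complex) 1" using R by (intro subset_ball) simp
  have sf: "star_factor (\<lambda>z. q z * (p z + \<i> * of_real s)) (ball 0 R)" for s
    unfolding star_factor_def
  proof (intro conjI ballI)
    show "(\<lambda>z. q z * (p z + \<i> * of_real s)) holomorphic_on ball 0 R"
      using holomorphic_on_subset[OF qh sub] holomorphic_on_subset[OF p(1) sub] by (intro holomorphic_intros)
    fix z :: complex assume zR: "z \<in> ball 0 R"
    have z: "z \<in> ball 0 1" using zR sub by blast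
    have "0 < Re (p z + \<i> * of_real s)" using p(4)[OF z] \<alpha> by simp
    then have pnz: "p z + \<i> * of_real s \<noteq> 0" by (metis less_irrefl zero_complex.sel(1))
    show "q z * (p z + \<i> * of_real s) \<noteq> 0" using pnz qnz[OF z] by simp
    have "(q has_field_derivative deriv q z) (at z)" "(p has_field_derivative deriv p z) (at z)"
      using qh p(1) z by (auto intro!: holomorphic_derivI[of _ "ball 0 1"])
    then have "((\<lambda>z. q z * (p z + \<i> * of_real s)) has_field_derivative
        deriv q z * (p z + \<i> * of_real s) + deriv p z * q z) (at z)"
      by (auto intro!: derivative_eq_intros)
    then have d: "deriv (\<lambda>z. q z * (p z + \<i> * of_real s)) z = deriv q z * (p z + \<i> * of_real s) + deriv p z * q z"
      by (rule DERIV_imp_deriv)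
    have "1 + z * deriv (\<lambda>z. q z * (p z + \<i> * of_real s)) z / (q z * (p z + \<i> * of_real s)) =
        p z + z * deriv p z / (p z + \<i> * of_real s)"
    proof -
      have "z * (A * P + B * Q) / (Q * P) = z * A / Q + z * B / P" if "Q \<noteq> 0" "P \<noteq> 0" for A B P Q
        using that by (simp add: field_simps)
      from this[OF qnz[OF z] pnz] show ?thesis unfolding d using p(3)[OF z] by simp
    qed
    moreover have "0 < Re (p z + z * deriv p z / (p z + \<i> * of_real s))"
    proof -
      \<comment> \<open>Positivity of \<zeta> is known only on (a, R). A point near 0 is assigned a
        radius in that interval which is at least its modulus.\<close>
      define t where "t = max (cmod z) ((a + R) / 2)"
      have "a < (a + R) / 2" "(a + R) / 2 < R" using R(1) by auto
      then have t: "cmod z \<le> t" "a < t" "t < R" using zR by (auto simp: t_def less_max_iff_disj)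
      show ?thesis by (rule Re_Briot_Bouquet_pos[OF \<alpha> p(1,2,4) t(1)]) (use t R in auto)
    qed
    ultimately show "0 < Re (1 + z * deriv (\<lambda>z. q z * (p z + \<i> * of_real s)) z / (q z * (p z + \<i> * of_real s)))"
      by simp
  qed
  have scale: "\<exists>w. w \<in> ball 0 R \<and> w \<noteq> 0 \<and> z = of_real r * w" if "z \<in> ball 0 (R * r)" "z \<noteq> 0" for z :: complex
    using that r by (intro exI[of _ "z / of_real r"]) (auto simp: norm_divide pos_divide_less_eq)
  show ?thesis unfolding R_def[symmetric]
  proof (rule starlike_hadamard)
    show "f \<in> class_A" "g \<in> class_A" using f g by (auto simp: class_S_def class_St_def)
    show "0 < R * r" using R0 r by simp
    show "R * r \<le> 1" using R r by (intro mult_le_one) auto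
    fix z :: complex and s :: real assume z: "z \<in> ball 0 (R * r)" "z \<noteq> 0"
    then obtain w where w: "w \<in> ball 0 R" "w \<noteq> 0" "z = of_real r * w" using scale by blast
    have "fps_expansion g 0 = fps_expansion (\<lambda>z. z * q z) 0"
      by (rule fps_expansion_cong_ball[of 1]) (use q in auto)
    then show "hadamard f g z \<noteq> 0"
      using close_to_convex_hadamard_nonzero[OF fh r cc star_factor_subset[OF q(1) sub] R0 w(1,2)] w(3)
      by (simp add: hadamard_def)
    have "fps_expansion (\<lambda>z. z * deriv g z + \<i> * of_real s * g z) 0 = fps_expansion (\<lambda>z. z * (q z * (p z + \<i> * of_real s))) 0"
      by (rule fps_expansion_cong_ball[of 1]) (use q p in \<open>auto simp: algebra_simps\<close>)
    then show "hadamard f (\<lambda>z. z * deriv g z + \<i> * of_real s * g z) z \<noteq> 0"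
      using close_to_convex_hadamard_nonzero[OF fh r cc sf R0 w(1,2), of s] w(3)
      by (simp add: hadamard_def)
  qed
qed

text \<open>The identity serves as the convex comparison function, since Re f' > 0 on the small
  disc.\<close>

lemma close_to_convex_tenth:
  assumes f: "f \<in> class_S"
  shows "close_to_convex (\<lambda>z. f (complex_of_real (1/10) * z) / complex_of_real (1/10))"
proof -
  define F where "F z = f (complex_of_real (1/10) * z) / complex_of_real (1/10)" for z
  note S = class_S_D[OF f]
  have dF: "(F has_field_derivative deriv f (complex_of_real (1/10) * z)) (at z)" if "z \<in> ball 0 1" for z
  proof -
    have "complex_of_real (1/10) * z \<in> ball 0 1" using that by simp
    then have "(f has_field_derivative deriv f (complex_of_real (1/10) * z)) (at (complex_of_real (1/10) * z))"
      using S(1) by (simp add: holomorphic_derivI)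
    moreover have "((\<lambda>z. complex_of_real (1/10) * z) has_field_derivative complex_of_real (1/10)) (at z)"
      by (auto intro!: derivative_eq_intros)
    ultimately have "((\<lambda>z. f (complex_of_real (1/10) * z)) has_field_derivative
       deriv f (complex_of_real (1/10) * z) * complex_of_real (1/10)) (at z)"
      by (rule DERIV_chain2)
    from DERIV_cdivide[OF this, of "complex_of_real (1/10)"] show ?thesis by (simp add: F_def[abs_def])
  qed
  have "F holomorphic_on ball 0 1" unfolding holomorphic_on_open[OF open_ball] using dF by blast
  moreover have "F 0 = 0" using S(2) by (simp add: F_def)
  moreover have dF': "deriv F z = deriv f (complex_of_real (1/10) * z)" if "z \<in> ball 0 1" for z
    using DERIV_imp_deriv[OF dF[OF that]] .
  moreover have "deriv F 0 = 1" using dF'[of 0] S(3) by simp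
  moreover have "convex_function (\<lambda>z. z)" by (simp add: convex_function_def inj_on_def)
  moreover have "0 < Re (deriv F z / deriv (\<lambda>z. z) z)" if "z \<in> ball 0 1" for z
    using class_S_Re_deriv_pos[OF f, of "complex_of_real (1/10) * z"] that dF'[OF that] by simp
  ultimately have "close_to_convex F" unfolding close_to_convex_def class_A_def by blast
  then show ?thesis by (simp only: F_def[abs_def])
qed

theorem theorem1:
  fixes \<alpha> :: real
  assumes "0 \<le> \<alpha>" and "\<alpha> < 1"
  shows "R_bound \<alpha> \<le> radius_of_starlikeness (hadamard_set class_S (class_St \<alpha>))"
proof -
  define M where "M = hadamard_set class_S (class_St \<alpha>)"
  define A where "A = {r. 0 < r \<and> r \<le> 1 \<and> (\<forall>F \<in> M. starlike_in_disc F r)}"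
  define C where "C = {r. 0 < r \<and> r \<le> 1 \<and>
     (\<forall>f \<in> class_S. close_to_convex (\<lambda>z. f (complex_of_real r * z) / complex_of_real r))}"
  have rad: "radius_of_starlikeness M = Sup A" by (simp add: radius_of_starlikeness_def A_def)
  have bA: "bdd_above A" by (rule bdd_aboveI[of _ 1]) (auto simp: A_def)
  have bC: "bdd_above C" by (rule bdd_aboveI[of _ 1]) (auto simp: C_def)
  have rcc: "r_cc = Sup C" by (simp add: r_cc_def C_def)
  \<comment> \<open>A member of C makes \<open>r_cc\<close> a supremum of a nonempty bounded
    set.\<close>
  have tC: "1/10 \<in> C" unfolding C_def using close_to_convex_tenth by simp
  have r1: "1/10 \<le> r_cc" unfolding rcc by (rule cSup_upper[OF tC bC])
  have r2: "r_cc \<le> 1" unfolding rcc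
  proof (rule cSup_least)
    show "C \<noteq> {}" using tC by blast
  qed (simp add: C_def)
  show ?thesis
  proof (cases "\<alpha> \<le> \<alpha>\<^sub>0")
    case True
    have "1 < sqrt 3" "sqrt 3 < 2" by (auto intro: real_less_rsqrt real_less_lsqrt)
    then have "2 - sqrt 3 \<in> A"
      using starlike_2_minus_sqrt_3[OF _ _ assms] unfolding A_def M_def hadamard_set_def by auto
    then have "2 - sqrt 3 \<le> Sup A" by (rule cSup_upper[OF _ bA])
    then show ?thesis using True unfolding M_def[symmetric] rad by (simp add: R_bound_def)
  next
    case False
    then have \<alpha>: "0 < \<alpha>" using \<alpha>0_pos[OF r1 r2] by simp
    define R where "R = R\<^sub>1 \<alpha>"
    have "sqrt 2 < 1.5" by (intro real_less_lsqrt) (auto simp: power2_eq_square)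
    then have R: "0 < R" "R < 1" using R1_properties(1,2)[OF \<alpha> assms(2)] by (auto simp: R_def)
    have "R * r \<in> A" if "r \<in> C" for r
    proof -
      have r: "0 < r" "r \<le> 1" using that by (auto simp: C_def)
      have "R * r \<le> 1" using R r by (intro mult_le_one) auto
      moreover have "starlike_in_disc F (R * r)" if "F \<in> M" for F
        using that starlike_R1_times[OF _ _ \<alpha> assms(2) r] \<open>r \<in> C\<close>
        unfolding M_def hadamard_set_def C_def R_def by blast
      ultimately show ?thesis using R r by (simp add: A_def)
    qed
    \<comment> \<open>Close-to-convexity is used only at members r of C; the bound reaches
      \<open>r_cc\<close> through the supremum, so whether it is attained does not enter.\<close>
    then have le: "R * r \<le> Sup A" if "r \<in> C" for r using that cSup_upper[OF _ bA] by blast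
    have "r \<le> Sup A / R" if "r \<in> C" for r
      using le[OF that] R(1) by (subst pos_le_divide_eq) (simp_all add: mult.commute)
    then have "r_cc \<le> Sup A / R" unfolding rcc using tC by (intro cSup_least) auto
    then have "R * r_cc \<le> Sup A" using R by (simp add: pos_le_divide_eq mult.commute)
    then show ?thesis using False unfolding M_def[symmetric] rad by (simp add: R_bound_def R_def)
  qed
qed

end
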